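(* Let $\Bbbk$ be an $F$-finite field of characteristic $p>0$, let $L$ be a (two-sided) ladder with $v$ lower-outside corners, let $\mathbf{t}=(t_1,\ldots,t_v)\in\mathbb{Z}_{>0}^v$, and let $I_{\mathbf t}(L)\subseteq R=\Bbbk[L]$ be the corresponding mixed ladder determinantal ideal. Then the blowup algebras $\mathcal{R}^s(I_{\mathbf t}(L))=\bigoplus_{n\ge0}I_{\mathbf t}(L)^{(n)}$ and $\mathrm{gr}^s(I_{\mathbf t}(L))=\bigoplus_{n\ge0}I_{\mathbf t}(L)^{(n)}/I_{\mathbf t}(L)^{(n+1)}$ are $F$-pure. In particular, $R/I_{\mathbf t}(L)$ is $F$-pure.
   Context: Ladders. Let $X=(x_{i,j})$ be a $k\times\ell$ matrix of distinct indeterminates. A subset $L\subseteq X$ is a (two-sided) ladder if whenever $x_{i,j},x_{i',j'}\in L$ with $i\le i'$ and $j\ge j'$, then $x_{u,w}\in L$ for all $i\le u\le i'$, $j'\le w\le j$. (An entry with indices out of range is regarded as not in $L$.) The upper-outside corners of $L$ are the elements $x_{b_1,a_1},\ldots,x_{b_u,a_u}\in L$, with $1=b_1<\cdots<b_u$ and $a_1<\cdots<a_u=\ell$, defined by $x_{b_h-1,a_h}\notin L$ and $x_{b_h,a_h+1}\notin L$. The lower-outside corners $x_{d_1,c_1},\ldots,x_{d_v,c_v}\in L$, with $d_1\le\cdots\le d_v=k$ and $1=c_1\le\cdots\le c_v$, are part of the data of the ladder: they include all $x_{i,j}\in L$ with $x_{i+1,j}\notin L$ and $x_{i,j-1}\notin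 L$, and each of them satisfies $x_{d_h+1,c_h}\notin L$ or $x_{d_h,c_h-1}\notin L$. All corners are assumed distinct. For $j=1,\ldots,v$ set $L_j=\{x_{b,a}\in L\mid 1\le b\le d_j,\ c_j\le a\le \ell\}$. Ideals. $\Bbbk[L]$ is the polynomial ring over $\Bbbk$ in the entries of $L$. For a positive integer $t$ and a subladder $L'\subseteq L$, $I_t(L')$ is the ideal of $\Bbbk[L]$ generated by the $t$-minors of $X$ all of whose entries lie in $L'$. The mixed ladder determinantal ideal is $I_{\mathbf t}(L)=I_{t_1}(L_1)+\cdots+I_{t_v}(L_v)$; it is prime. Standing assumptions: (1) every entry of $L$ is involved in some of the generating minors of $I_{\mathbf t}(L)$; (2) no two consecutive corners coincide, and no two upper-outside corners belong to the same row or the same column; (3) $I_{t_i}(L_i)\not\subseteq I_{t_j}(L_j)$ for all $i\ne j$; (4) no proper submatrix of $X$ contains $L$. $I^{(n)}$ denotes the $n$-th symbolic power of $I$, with $I^{(0)}=R$. A ring $S$ of characteristic $p>0$ is $F$-pure if the Frobenius map $S\to F_*S$ is pure, i.e. remains injective after tensoring with any $S$-module. *)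

theory Defs
  imports
    "HOL-Algebra.Algebra"
    "HOL-Algebra.Algebraic_Closure_Type"
    "HOL-Algebra.Free_Abelian_Groups"
    "HOL-Library.Poly_Mapping"
    "Jordan_Normal_Form.Determinant"
begin

section \<open>Tensor products, purity and F-purity\<close>

definition tensor_relations ::
    "('r, 'e) ring_scheme \<Rightarrow> ('r, 'n) module \<Rightarrow> ('r, 'm) module \<Rightarrow> ('n \<times> 'm \<Rightarrow>\<^sub>0 int) set" where
  "tensor_relations S N M =
     {frag_of (x \<oplus>\<^bsub>N\<^esub> y, m) - frag_of (x, m) - frag_of (y, m) | x y m.
        x \<in> carrier N \<and> y \<in> carrier N \<and> m \<in> carrier M} \<union>
     {frag_of (x, m \<oplus>\<^bsub>M\<^esub> m') - frag_of (x, m) - frag_of (x, m') | x m m'.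
        x \<in> carrier N \<and> m \<in> carrier M \<and> m' \<in> carrier M} \<union>
     {frag_of (s \<odot>\<^bsub>N\<^esub> x, m) - frag_of (x, s \<odot>\<^bsub>M\<^esub> m) | s x m.
        s \<in> carrier S \<and> x \<in> carrier N \<and> m \<in> carrier M}"

definition tensor_kernel ::
    "('r, 'e) ring_scheme \<Rightarrow> ('r, 'n) module \<Rightarrow> ('r, 'm) module \<Rightarrow> ('n \<times> 'm \<Rightarrow>\<^sub>0 int) set" where
  "tensor_kernel S N M =
     generate (free_Abelian_group (carrier N \<times> carrier M)) (tensor_relations S N M)"

text \<open>Only the additive group of the tensor product is constructed: the \<open>S\<close>-module structure is
  irrelevant for the injectivity of induced maps.\<close>

definition tensor_product ::
    "('r, 'e) ring_scheme \<Rightarrow> ('r, 'n) module \<Rightarrow> ('r, 'm) module \<Rightarrow> ('n \<times> 'm \<Rightarrow>\<^sub>0 int) set monoid" where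
  "tensor_product S N M =
     free_Abelian_group (carrier N \<times> carrier M) Mod tensor_kernel S N M"

text \<open>The map \<open>f \<otimes> id\<close> from \<open>N \<otimes> M\<close> to \<open>N' \<otimes> M\<close>. For \<open>S\<close>-linear \<open>f\<close> all members \<open>c\<close> of a coset
  \<open>A\<close> contribute the same coset, so the union is that coset.\<close>

definition tensor_map ::
    "('r, 'e) ring_scheme \<Rightarrow> ('r, 'n2) module \<Rightarrow> ('r, 'm) module \<Rightarrow> ('n1 \<Rightarrow> 'n2) \<Rightarrow>
       ('n1 \<times> 'm \<Rightarrow>\<^sub>0 int) set \<Rightarrow> ('n2 \<times> 'm \<Rightarrow>\<^sub>0 int) set" where
  "tensor_map S N' M f A =
     (\<Union>c\<in>A. tensor_kernel S N' M #>\<^bsub>free_Abelian_group (carrier N' \<times> carrier M)\<^esub>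
               frag_extend (\<lambda>(x, m). frag_of (f x, m)) c)"

text \<open>HOL cannot quantify over types inside a definition. The modules \<open>M\<close> range over all modules
  with carrier in the type \<open>'m\<close>; a statement in which \<open>'m\<close> is a free type variable of the conclusion
  speaks about all modules.\<close>

definition pure_map ::
    "'m itself \<Rightarrow> ('r, 'e) ring_scheme \<Rightarrow> ('r, 'n1) module \<Rightarrow> ('r, 'n2) module \<Rightarrow> ('n1 \<Rightarrow> 'n2) \<Rightarrow> bool" where
  "pure_map _ S N N' f \<longleftrightarrow>
     (\<forall>M :: ('r, 'm) module. Module.module S M \<longrightarrow>
        inj_on (tensor_map S N' M f) (carrier (tensor_product S N M)))"

definition self_module :: "('r, 'e) ring_scheme \<Rightarrow> ('r, 'r) module" where
  "self_module S =
     \<lparr>carrier = carrier S, monoid.mult = monoid.mult S, one = \<one>\<^bsub>S\<^esub>, ring.zero = \<zero>\<^bsub>S\<^esub>, add = ring.add S,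
      module.smult = monoid.mult S\<rparr>"

text \<open>\<open>F\<^sub>* S\<close>: the ring \<open>S\<close>, viewed as an \<open>S\<close>-module through the Frobenius map.\<close>

definition frobenius_module :: "nat \<Rightarrow> ('r, 'e) ring_scheme \<Rightarrow> ('r, 'r) module" where
  "frobenius_module p S =
     \<lparr>carrier = carrier S, monoid.mult = monoid.mult S, one = \<one>\<^bsub>S\<^esub>, ring.zero = \<zero>\<^bsub>S\<^esub>, add = ring.add S,
      module.smult = (\<lambda>s x. (s [^]\<^bsub>S\<^esub> p) \<otimes>\<^bsub>S\<^esub> x)\<rparr>"

text \<open>\<open>F_pure TYPE('m) p S\<close>: \<open>S\<close> is a commutative ring of prime characteristic \<open>p\<close> (the additive
  order of \<open>1\<close>) whose Frobenius map \<open>S \<rightarrow> F\<^sub>* S\<close> is pure.\<close>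

definition F_pure :: "'m itself \<Rightarrow> nat \<Rightarrow> ('r, 'e) ring_scheme \<Rightarrow> bool" where
  "F_pure T p S \<longleftrightarrow>
     cring S \<and> Factorial_Ring.prime p \<and> group.ord (add_monoid S) \<one>\<^bsub>S\<^esub> = p \<and>
     pure_map T S (self_module S) (frobenius_module p S) (\<lambda>x. x [^]\<^bsub>S\<^esub> p)"

text \<open>\<open>F\<^sub>* k\<close> is a finitely generated \<open>k\<close>-module, where \<open>c\<close> acts on \<open>F\<^sub>* k\<close> as multiplication by
  \<open>c ^ p\<close>.\<close>

definition F_finite_field :: "'k::field itself \<Rightarrow> bool" where
  "F_finite_field _ \<longleftrightarrow>
     (\<exists>B :: 'k set. finite B \<and> (\<forall>x. \<exists>c. x = (\<Sum>b\<in>B. c b ^ CHAR('k) * b)))"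


section \<open>Symbolic powers and blowup algebras\<close>

definition minimal_primes :: "('a, 'e) ring_scheme \<Rightarrow> 'a set \<Rightarrow> 'a set set" where
  "minimal_primes R I =
     {P. primeideal P R \<and> I \<subseteq> P \<and> (\<forall>Q. primeideal Q R \<and> I \<subseteq> Q \<and> Q \<subseteq> P \<longrightarrow> Q = P)}"

text \<open>The intersection, over the minimal primes \<open>P\<close> of \<open>I\<close>, of the contractions
  \<open>I\<^sup>n R\<^sub>P \<inter> R = {r. s r \<in> I\<^sup>n for some s \<notin> P}\<close>. If \<open>I\<close> is prime, then \<open>P = I\<close> is the only one.\<close>

definition symbolic_power :: "('a, 'e) ring_scheme \<Rightarrow> 'a set \<Rightarrow> nat \<Rightarrow> 'a set" where
  "symbolic_power R I n =
     {r \<in> carrier R. \<forall>P\<in>minimal_primes R I.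
        \<exists>s \<in> carrier R - P. s \<otimes>\<^bsub>R\<^esub> r \<in> I [^]\<^bsub>ideals_set R\<^esub> n}"

text \<open>\<open>UP R\<close> consists of the finitely supported sequences in \<open>R\<close> with convolution as
  multiplication; restricted to sequences with \<open>n\<close>-th term in the \<open>n\<close>-th symbolic power this is the
  direct sum of the symbolic powers.\<close>

definition symbolic_rees :: "('a, 'e) ring_scheme \<Rightarrow> 'a set \<Rightarrow> ('a, nat \<Rightarrow> 'a) up_ring" where
  "symbolic_rees R I =
     UP R \<lparr>carrier := {f \<in> up R. \<forall>n. f n \<in> symbolic_power R I n}\<rparr>"

text \<open>Elements are finitely supported sequences whose \<open>n\<close>-th term is a coset of \<open>I\<^sup>(\<^sup>n\<^sup>+\<^sup>1\<^sup>)\<close> in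
  \<open>I\<^sup>(\<^sup>n\<^sup>)\<close>. The product of the classes of \<open>x \<in> I\<^sup>(\<^sup>i\<^sup>)\<close> and \<open>y \<in> I\<^sup>(\<^sup>n\<^sup>-\<^sup>i\<^sup>)\<close> is the class of
  \<open>x y\<close> modulo \<open>I\<^sup>(\<^sup>n\<^sup>+\<^sup>1\<^sup>)\<close>, which is what \<open>rcoset_mult\<close> computes; these are summed in
  \<open>R / I\<^sup>(\<^sup>n\<^sup>+\<^sup>1\<^sup>)\<close>.\<close>

definition symbolic_gr :: "('a, 'e) ring_scheme \<Rightarrow> 'a set \<Rightarrow> (nat \<Rightarrow> 'a set) ring" where
  "symbolic_gr R I = (let J = symbolic_power R I in
     \<lparr>carrier = {A. (\<forall>n. A n \<in> (\<lambda>x. J (Suc n) +>\<^bsub>R\<^esub> x) ` J n) \<and> finite {n. A n \<noteq> J (Suc n)}},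
      monoid.mult = (\<lambda>A B n. \<Oplus>\<^bsub>R Quot J (Suc n)\<^esub>i\<in>{..n}. rcoset_mult R (J (Suc n)) (A i) (B (n - i))),
      one = (\<lambda>n. if n = 0 then J 1 +>\<^bsub>R\<^esub> \<one>\<^bsub>R\<^esub> else J (Suc n)),
      ring.zero = (\<lambda>n. J (Suc n)),
      add = (\<lambda>A B n. A n <+>\<^bsub>R\<^esub> B n)\<rparr>)"


section \<open>Ladders\<close>

text \<open>The pair \<open>(i, j)\<close> stands for the indeterminate \<open>x\<^sub>i\<^sub>,\<^sub>j\<close>; rows and columns are numbered
  from \<open>1\<close>, so that an index \<open>0\<close> is out of range.\<close>

definition ladder :: "nat \<Rightarrow> nat \<Rightarrow> (nat \<times> nat) set \<Rightarrow> bool" where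
  "ladder k l L \<longleftrightarrow>
     L \<subseteq> {1..k} \<times> {1..l} \<and>
     (\<forall>i j i' j'. (i, j) \<in> L \<and> (i', j') \<in> L \<and> i \<le> i' \<and> j' \<le> j \<longrightarrow>
        (\<forall>u w. i \<le> u \<and> u \<le> i' \<and> j' \<le> w \<and> w \<le> j \<longrightarrow> (u, w) \<in> L))"

definition upper_outside_corners :: "(nat \<times> nat) set \<Rightarrow> (nat \<times> nat) set" where
  "upper_outside_corners L = {(b, a) \<in> L. (b - 1, a) \<notin> L \<and> (b, a + 1) \<notin> L}"

definition lower_outside_corners ::
    "nat \<Rightarrow> (nat \<times> nat) set \<Rightarrow> nat \<Rightarrow> (nat \<Rightarrow> nat) \<Rightarrow> (nat \<Rightarrow> nat) \<Rightarrow> bool" where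
  "lower_outside_corners k L v d c \<longleftrightarrow>
     1 \<le> v \<and> mono_on {1..v} d \<and> d v = k \<and> c 1 = 1 \<and> mono_on {1..v} c \<and>
     (\<forall>h\<in>{1..v}. (d h, c h) \<in> L \<and> ((d h + 1, c h) \<notin> L \<or> (d h, c h - 1) \<notin> L)) \<and>
     (\<forall>(i, j)\<in>L. (i + 1, j) \<notin> L \<and> (i, j - 1) \<notin> L \<longrightarrow> (\<exists>h\<in>{1..v}. (i, j) = (d h, c h)))"

definition distinct_corners ::
    "(nat \<times> nat) set \<Rightarrow> nat \<Rightarrow> (nat \<Rightarrow> nat) \<Rightarrow> (nat \<Rightarrow> nat) \<Rightarrow> bool" where
  "distinct_corners L v d c \<longleftrightarrow>
     inj_on (\<lambda>h. (d h, c h)) {1..v} \<and>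
     (\<forall>h\<in>{1..v}. (d h, c h) \<notin> upper_outside_corners L)"

definition subladder ::
    "nat \<Rightarrow> (nat \<times> nat) set \<Rightarrow> (nat \<Rightarrow> nat) \<Rightarrow> (nat \<Rightarrow> nat) \<Rightarrow> nat \<Rightarrow> (nat \<times> nat) set" where
  "subladder l L d c j = {(b, a) \<in> L. 1 \<le> b \<and> b \<le> d j \<and> c j \<le> a \<and> a \<le> l}"

definition in_no_proper_submatrix :: "nat \<Rightarrow> nat \<Rightarrow> (nat \<times> nat) set \<Rightarrow> bool" where
  "in_no_proper_submatrix k l L \<longleftrightarrow>
     (\<forall>A B. A \<subseteq> {1..k} \<and> B \<subseteq> {1..l} \<and> L \<subseteq> A \<times> B \<longrightarrow> A = {1..k} \<and> B = {1..l})"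

text \<open>The upper-outside corners of a ladder contained in no proper submatrix are, listed by rows,
  \<open>(b\<^sub>1, a\<^sub>1), \<dots>, (b\<^sub>u, a\<^sub>u)\<close> with \<open>1 = b\<^sub>1 < \<dots> < b\<^sub>u\<close> and \<open>a\<^sub>1 < \<dots> < a\<^sub>u = l\<close>: this part
  of the description follows from the two conditions defining the corners.\<close>

lemma upper_outside_corners_increasing:
  assumes L: "ladder k l L"
    and x: "(b, a) \<in> upper_outside_corners L" and y: "(b', a') \<in> upper_outside_corners L"
    and ne: "(b, a) \<noteq> (b', a')"
  shows "b < b' \<and> a < a' \<or> b' < b \<and> a' < a"
proof -
  have L0: "(u, w) \<in> L" if "(i, j) \<in> L" "(i', j') \<in> L" "i \<le> u" "u \<le> i'" "j' \<le> w" "w \<le> j"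
    for i j i' j' u w
    using L that unfolding ladder_def by (meson le_trans)
  have *: False
    if "(b, a) \<in> upper_outside_corners L" "(b', a') \<in> upper_outside_corners L"
       "(b, a) \<noteq> (b', a')" "b \<le> b'" "a' \<le> a" for a b a' b'
  proof (cases "b = b'")
    case True
    then show False
      using that L0[of b a b' a' b' "a' + 1"] by (auto simp: upper_outside_corners_def)
  next
    case False
    then have "b \<le> b' - 1"
      using that by linarith
    then show False
      using that L0[of b a b' a' "b' - 1" a'] by (auto simp: upper_outside_corners_def)
  qed
  show ?thesis
    using *[OF x y ne] *[OF y x ne[symmetric]] by (meson linorder_not_le nle_le)
qed

lemma upper_outside_corners_ends:
  assumes "ladder k l L" and "in_no_proper_submatrix k l L" and "1 \<le> k" and "1 \<le> l"
  shows "1 \<in> fst ` upper_outside_corners L" and "l \<in> snd ` upper_outside_corners L"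
proof -
  have sub: "L \<subseteq> {1..k} \<times> {1..l}"
    using assms(1) by (simp add: ladder_def)
  have rows: "fst ` L = {1..k} \<and> snd ` L = {1..l}"
  proof -
    have "fst ` L \<subseteq> {1..k}" "snd ` L \<subseteq> {1..l}"
      using image_mono[OF sub, of fst] image_mono[OF sub, of snd] by (auto split: if_splits)
    moreover have "L \<subseteq> fst ` L \<times> snd ` L"
      by force
    ultimately show ?thesis
      using assms(2)[unfolded in_no_proper_submatrix_def, rule_format, of "fst ` L" "snd ` L"] by simp
  qed
  have zero: "(0, a) \<notin> L" and right: "(b, l + 1) \<notin> L" for a b
    using subsetD[OF sub] by fastforce+
  have fin: "finite L"
    using sub by (rule finite_subset) simp
  let ?A = "{a. (1, a) \<in> L}" and ?B = "{b. (b, l) \<in> L}"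
  have finA: "finite ?A" "?A \<noteq> {}"
  proof -
    have "?A \<subseteq> snd ` L" by force
    then show "finite ?A" using fin finite_subset by blast
    have "1 \<in> fst ` L" using rows \<open>1 \<le> k\<close> by simp
    then show "?A \<noteq> {}" by auto
  qed
  have "(1, Max ?A) \<in> L" "(1, Max ?A + 1) \<notin> L"
    using Max_in[OF finA] Max_ge[OF finA(1), of "Max ?A + 1"] by auto
  then have "(1, Max ?A) \<in> upper_outside_corners L"
    using zero by (simp add: upper_outside_corners_def)
  then show "1 \<in> fst ` upper_outside_corners L"
    by force
  have finB: "finite ?B" "?B \<noteq> {}"
  proof -
    have "?B \<subseteq> fst ` L" by force
    then show "finite ?B" using fin finite_subset by blast
    have "l \<in> snd ` L" using rows \<open>1 \<le> l\<close> by simp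
    then show "?B \<noteq> {}" by auto
  qed
  have "(Min ?B, l) \<in> L"
    using Min_in[OF finB] by simp
  moreover have "(Min ?B - 1, l) \<notin> L"
  proof
    assume in_L: "(Min ?B - 1, l) \<in> L"
    then have "Min ?B \<le> Min ?B - 1"
      using Min_le[OF finB(1), of "Min ?B - 1"] by simp
    then have "Min ?B - 1 = 0"
      by linarith
    with in_L zero show False
      by metis
  qed
  ultimately have "(Min ?B, l) \<in> upper_outside_corners L"
    using right by (simp add: upper_outside_corners_def)
  then show "l \<in> snd ` upper_outside_corners L"
    by force
qed


section \<open>Mixed ladder determinantal ideals\<close>

type_synonym 'k mat_poly = "(nat \<times> nat \<Rightarrow>\<^sub>0 nat) \<Rightarrow>\<^sub>0 'k"

definition ladder_ring :: "(nat \<times> nat) set \<Rightarrow> 'k::field mat_poly ring" where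
  "ladder_ring L =
     ring_of_type_algebra \<lparr>carrier := {f. \<forall>m\<in>Poly_Mapping.keys f. Poly_Mapping.keys m \<subseteq> L}\<rparr>"

definition indeterminate :: "nat \<times> nat \<Rightarrow> 'k::field mat_poly" where
  "indeterminate x = Poly_Mapping.single (Poly_Mapping.single x 1) 1"

text \<open>The rows \<open>r 0 < \<dots> < r (t - 1)\<close> and columns \<open>s 0 < \<dots> < s (t - 1)\<close> select a \<open>t \<times> t\<close> submatrix
  of \<open>X\<close> with all entries in \<open>L'\<close>.\<close>

definition square_submatrix ::
    "nat \<Rightarrow> (nat \<times> nat) set \<Rightarrow> (nat \<Rightarrow> nat) \<Rightarrow> (nat \<Rightarrow> nat) \<Rightarrow> bool" where
  "square_submatrix t L' r s \<longleftrightarrow>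
     strict_mono_on {..<t} r \<and> strict_mono_on {..<t} s \<and> (\<forall>a<t. \<forall>b<t. (r a, s b) \<in> L')"

definition minors :: "nat \<Rightarrow> (nat \<times> nat) set \<Rightarrow> 'k::field mat_poly set" where
  "minors t L' =
     {det (mat t t (\<lambda>(a, b). indeterminate (r a, s b))) | r s. square_submatrix t L' r s}"

definition determinantal_ideal ::
    "(nat \<times> nat) set \<Rightarrow> nat \<Rightarrow> (nat \<times> nat) set \<Rightarrow> 'k::field mat_poly set" where
  "determinantal_ideal L t L' = genideal (ladder_ring L) (minors t L')"

definition mixed_ladder_ideal ::
    "nat \<Rightarrow> (nat \<times> nat) set \<Rightarrow> nat \<Rightarrow> (nat \<Rightarrow> nat) \<Rightarrow> (nat \<Rightarrow> nat) \<Rightarrow> (nat \<Rightarrow> nat) \<Rightarrow>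
       'k::field mat_poly set" where
  "mixed_ladder_ideal l L v d c t =
     {finsum (ladder_ring L) f {1..v} | f.
        \<forall>j\<in>{1..v}. f j \<in> determinantal_ideal L (t j) (subladder l L d c j)}"

definition all_entries_involved ::
    "nat \<Rightarrow> (nat \<times> nat) set \<Rightarrow> nat \<Rightarrow> (nat \<Rightarrow> nat) \<Rightarrow> (nat \<Rightarrow> nat) \<Rightarrow> (nat \<Rightarrow> nat) \<Rightarrow> bool" where
  "all_entries_involved l L v d c t \<longleftrightarrow>
     (\<forall>x\<in>L. \<exists>h\<in>{1..v}. \<exists>r s. square_submatrix (t h) (subladder l L d c h) r s \<and>
        x \<in> r ` {..<t h} \<times> s ` {..<t h})"

end

theory Submission
  imports Defs "HOL-Library.Product_Lexorder"
begin

text \<open>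
  Give \<open>x\<^sub>i\<^sub>,\<^sub>j\<close> the weight \<open>(i + 1)(j + 1)\<close>; the lightest term of a minor is then the product of its
  antidiagonal (running from north-east to south-west). A monomial is standard if it contains no
  antidiagonal of one of the generating minors. Distributing the entries of a standard monomial into
  levels by the length of the longest chain ending there, and substituting for \<open>X\<close> a sum of generic
  rank one matrices with supports prescribed by the levels, one sees that a polynomial with a
  standard lightest term is not in the kernel of this substitution into a domain. As non-standard
  monomials can be rewritten modulo the minors, \<open>I = I\<^sub>t(L)\<close> is this kernel, hence prime.

  Call an entry \<open>x\<close> special if it is the north-east end of an antidiagonal of a generating minor, and
  choose such a minor \<open>y\<^sub>x\<close> with contiguous rows and columns and of minimal size. It has the form
  \<open>x \<delta>\<^sub>x + z\<close> with \<open>\<delta>\<^sub>x \<notin> I\<close>, where \<open>\<delta>\<^sub>x\<close> and \<open>z\<close> involve only entries to the south-west of \<open>x\<close>. Solving for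
  the special entries one after the other leaves a polynomial all of whose terms are standard; thus
  the \<open>y\<^sub>x\<close> generate \<open>I\<close> locally at \<open>I\<close>. Let \<open>h\<close> be their number. For each antidiagonal line of the ladder, a
  minor on an initial run of the line is, up to a factor outside \<open>I\<close>, a determinant of bordering
  minors, and therefore lies locally in a power of \<open>I\<close>. The product \<open>g\<close> of these minors and of the
  remaining variables is homogeneous, lies in \<open>I\<^sup>h\<close> locally, and has the product of all variables as
  its lightest term. Hence \<open>r \<mapsto> tr (g\<^sup>p\<^sup>-\<^sup>1 r)\<close> is a splitting of the Frobenius map, which by the
  pigeonhole principle maps \<open>I\<^sup>(\<^sup>n\<^sup>p\<^sup>+\<^sup>1\<^sup>)\<close> into \<open>I\<^sup>(\<^sup>n\<^sup>+\<^sup>1\<^sup>)\<close>. Such a splitting induces splittings of the blowup algebras.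
\<close>


section \<open>Splittings and purity\<close>

text \<open>The weight serves twice. By the rearrangement inequality it makes the antidiagonal of a
  minor its unique lightest term. It also counts the pairs (a, b) with a \<le> i and b \<le> j, so
  that among the rearrangements of given rows and columns an antichain, if there is one, is the
  unique heaviest. A lightest standard term is split into antichains, one per piece, so no other
  term can cancel its image; this uniqueness replaces a tie-breaking monomial order.

  Primality comes first because it turns the symbolic powers into contractions from one
  localisation, where \<open>card H\<close> elements generate I. The pigeonhole count then asks for
  g of order \<open>card H\<close> along I, while the splitting asks for a lightest term that is
  squarefree in all variables. Both are met line by line: a line with m special entries gets a minor
  that lies locally in the m-th power of I and whose antidiagonal stays on that line. As g is
  homogeneous, no term of its power contributes anything to tr (g^(p-1)) besides 1.\<close>

definition frobenius_splitting :: "nat \<Rightarrow> ('r, 'e) ring_scheme \<Rightarrow> ('r \<Rightarrow> 'r) \<Rightarrow> bool" where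
  "frobenius_splitting p S \<sigma> \<longleftrightarrow>
     \<sigma> \<in> carrier S \<rightarrow> carrier S \<and>
     (\<forall>x\<in>carrier S. \<forall>y\<in>carrier S. \<sigma> (x \<oplus>\<^bsub>S\<^esub> y) = \<sigma> x \<oplus>\<^bsub>S\<^esub> \<sigma> y) \<and>
     (\<forall>s\<in>carrier S. \<forall>x\<in>carrier S. \<sigma> ((s [^]\<^bsub>S\<^esub> p) \<otimes>\<^bsub>S\<^esub> x) = s \<otimes>\<^bsub>S\<^esub> \<sigma> x) \<and>
     \<sigma> \<one>\<^bsub>S\<^esub> = \<one>\<^bsub>S\<^esub>"

text \<open>Additivity and linearity of \<open>g\<close> carry each defining relation to a defining
  relation, so the generated subgroups correspond. The closure conditions keep the relations inside
  the free group, where inversion is negation.\<close>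

lemma frag_extend_tensor_kernel:
  fixes N :: "('r, 'n1) module" and N' :: "('r, 'n2) module" and M :: "('r, 'm) module"
  assumes closed: "\<And>x. x \<in> carrier N \<Longrightarrow> g x \<in> carrier N'"
    and add: "\<And>x y. x \<in> carrier N \<Longrightarrow> y \<in> carrier N \<Longrightarrow> g (x \<oplus>\<^bsub>N\<^esub> y) = g x \<oplus>\<^bsub>N'\<^esub> g y"
    and smult: "\<And>s x. s \<in> carrier S \<Longrightarrow> x \<in> carrier N \<Longrightarrow> g (s \<odot>\<^bsub>N\<^esub> x) = s \<odot>\<^bsub>N'\<^esub> g x"
    and smult_closed: "\<And>s x. s \<in> carrier S \<Longrightarrow> x \<in> carrier N \<Longrightarrow> s \<odot>\<^bsub>N\<^esub> x \<in> carrier N"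
    and add_closed: "\<And>x y. x \<in> carrier N \<Longrightarrow> y \<in> carrier N \<Longrightarrow> x \<oplus>\<^bsub>N\<^esub> y \<in> carrier N"
    and M: "Module.module S M"
    and c: "c \<in> tensor_kernel S N M"
  shows "frag_extend (\<lambda>(x, m). frag_of (g x, m)) c \<in> tensor_kernel S N' M"
proof -
  interpret M: Module.module S M by fact
  let ?G = "free_Abelian_group (carrier N \<times> carrier M)"
  let ?G' = "free_Abelian_group (carrier N' \<times> carrier M)"
  let ?h = "frag_extend (\<lambda>(x, m). frag_of (g x, m))"
  have keys_rel: "Poly_Mapping.keys r \<subseteq> carrier N \<times> carrier M" if "r \<in> tensor_relations S N M" for r
    using that unfolding tensor_relations_def
    by (auto simp: smult_closed add_closed dest!: subsetD[OF keys_diff])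
  have rel: "?h r \<in> tensor_relations S N' M" if "r \<in> tensor_relations S N M" for r
    using that unfolding tensor_relations_def
  proof (elim UnE CollectE exE conjE, goal_cases)
    case (1 x y m)
    then show ?case
      apply (intro UnI1)
      apply (rule CollectI, rule exI[of _ "g x"], rule exI[of _ "g y"], rule exI[of _ m])
      by (simp add: frag_extend_diff add closed)
  next
    case (2 x m m')
    then show ?case
      apply -
      apply (rule UnI1, rule UnI2)
      apply (rule CollectI, rule exI[of _ "g x"], rule exI[of _ m], rule exI[of _ m'])
      by (simp add: frag_extend_diff add closed)
  next
    case (3 s x m)
    then show ?case
      apply (intro UnI2)
      apply (rule CollectI, rule exI[of _ s], rule exI[of _ "g x"], rule exI[of _ m])
      by (simp add: frag_extend_diff smult closed)
  qed
  have keys_rel': "Poly_Mapping.keys (?h r) \<subseteq> carrier N' \<times> carrier M" if "Poly_Mapping.keys r \<subseteq> carrier N \<times> carrier M" for r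
    using that closed by (force simp: keys_frag_of dest!: subsetD[OF keys_frag_extend])
  show ?thesis
    using c unfolding tensor_kernel_def
  proof (induction rule: generate.induct)
    case one
    show ?case by (simp add: generate.one[of ?G', simplified])
  next
    case (incl h)
    then show ?case by (blast intro: generate.incl rel)
  next
    case (inv h)
    have "?h (- h) = - ?h h" by (rule frag_extend_minus)
    with inv show ?case
      using generate.inv[OF rel[OF inv], of ?G'] keys_rel[OF inv] keys_rel'[OF keys_rel[OF inv]] by simp
  next
    case (eng h1 h2)
    then show ?case
      using generate.eng[of "?h h1" ?G' _ "?h h2"] by (simp add: frag_extend_add)
  qed
qed

lemma frag_extend_id_on:
  assumes "\<And>x m. (x, m) \<in> Poly_Mapping.keys a \<Longrightarrow> f x = x"
  shows "frag_extend (\<lambda>(x, m). frag_of (f x, m)) a = a"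
proof -
  have "frag_extend (\<lambda>(x, m). frag_of (f x, m)) a = frag_extend frag_of a"
    by (rule frag_extend_eq) (use assms in auto)
  then show ?thesis using frag_expansion by metis
qed

text \<open>The map induced by \<open>g\<close> is a left inverse of the one induced by
  \<open>f\<close>. On representatives: if the images of \<open>a\<close> and \<open>b'\<close>
  differ by a kernel element \<open>k\<close>, then \<open>a\<close> and \<open>b'\<close> differ by
  the image of \<open>k\<close> under \<open>g\<close>, which is again in the kernel.\<close>

lemma pure_map_if_retract:
  fixes N :: "('r, 'n1) module" and N' :: "('r, 'n2) module"
  assumes f: "\<And>x. x \<in> carrier N \<Longrightarrow> f x \<in> carrier N'"
    and closed: "\<And>x. x \<in> carrier N' \<Longrightarrow> g x \<in> carrier N"
    and add: "\<And>x y. x \<in> carrier N' \<Longrightarrow> y \<in> carrier N' \<Longrightarrow> g (x \<oplus>\<^bsub>N'\<^esub> y) = g x \<oplus>\<^bsub>N\<^esub> g y"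
    and smult: "\<And>s x. s \<in> carrier S \<Longrightarrow> x \<in> carrier N' \<Longrightarrow> g (s \<odot>\<^bsub>N'\<^esub> x) = s \<odot>\<^bsub>N\<^esub> g x"
    and smult_closed: "\<And>s x. s \<in> carrier S \<Longrightarrow> x \<in> carrier N' \<Longrightarrow> s \<odot>\<^bsub>N'\<^esub> x \<in> carrier N'"
    and add_closed: "\<And>x y. x \<in> carrier N' \<Longrightarrow> y \<in> carrier N' \<Longrightarrow> x \<oplus>\<^bsub>N'\<^esub> y \<in> carrier N'"
    and smult_closedN: "\<And>s x. s \<in> carrier S \<Longrightarrow> x \<in> carrier N \<Longrightarrow> s \<odot>\<^bsub>N\<^esub> x \<in> carrier N"
    and add_closedN: "\<And>x y. x \<in> carrier N \<Longrightarrow> y \<in> carrier N \<Longrightarrow> x \<oplus>\<^bsub>N\<^esub> y \<in> carrier N"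
    and gf: "\<And>x. x \<in> carrier N \<Longrightarrow> g (f x) = x"
  shows "pure_map TYPE('m) S N N' f"
  unfolding pure_map_def
proof (intro allI impI inj_onI)
  fix M :: "('r, 'm) module" and A B
  assume M: "Module.module S M"
    and A: "A \<in> carrier (tensor_product S N M)" and B: "B \<in> carrier (tensor_product S N M)"
    and eq: "tensor_map S N' M f A = tensor_map S N' M f B"
  interpret M: Module.module S M by fact
  let ?G = "free_Abelian_group (carrier N \<times> carrier M)"
  let ?G' = "free_Abelian_group (carrier N' \<times> carrier M)"
  let ?K = "tensor_kernel S N M" and ?K' = "tensor_kernel S N' M"
  let ?f = "frag_extend (\<lambda>(x, m). frag_of (f x, m))"
  let ?g = "frag_extend (\<lambda>(x, m). frag_of (g x, m))"
  interpret G: group ?G by simp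
  interpret G': group ?G' by simp
  have relN: "tensor_relations S N M \<subseteq> carrier ?G"
    unfolding tensor_relations_def
    by (auto simp: smult_closedN add_closedN dest!: subsetD[OF keys_diff])
  have K: "subgroup ?K ?G"
    unfolding tensor_kernel_def by (rule G.generate_is_subgroup[OF relN])
  have zero: "0 \<in> ?K'"
    using generate.one[of ?G'] unfolding tensor_kernel_def by simp
  have coset: "\<exists>a. a \<in> carrier ?G \<and> A = ?K #>\<^bsub>?G\<^esub> a" if "A \<in> carrier (tensor_product S N M)" for A
    using that unfolding tensor_product_def FactGroup_def RCOSETS_def by (auto simp del: carrier_free_Abelian_group_iff)
  obtain a where a: "a \<in> carrier ?G" "A = ?K #>\<^bsub>?G\<^esub> a" using coset[OF A] by blast
  obtain b where b: "b \<in> carrier ?G" "B = ?K #>\<^bsub>?G\<^esub> b" using coset[OF B] by blast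
  have aA: "a \<in> A" using G.rcos_self[OF a(1) K] a(2) by simp
  have "?f a \<in> tensor_map S N' M f A"
    unfolding tensor_map_def r_coset_def using aA zero by force
  then have "?f a \<in> tensor_map S N' M f B" using eq by simp
  then obtain b' k where b': "b' \<in> B" and k: "k \<in> ?K'" and fa: "?f a = k + ?f b'"
    unfolding tensor_map_def r_coset_def by auto
  have b'c: "b' \<in> carrier ?G"
    using b' b G.r_coset_subset_G[OF subgroup.subset[OF K] b(1)] by blast
  have gf': "?g (?f c) = c" if "c \<in> carrier ?G" for c
  proof -
    have "?g (?f c) = frag_extend (\<lambda>(x, m). frag_of (g (f x), m)) c"
      using frag_extend_compose[of "\<lambda>(x, m). frag_of (g x, m)" "\<lambda>(x, m). (f x, m)" c]
      by (simp add: o_def case_prod_unfold)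
    also have "\<dots> = c"
      by (rule frag_extend_id_on) (use that gf in auto)
    finally show ?thesis .
  qed
  have "a = ?g (?f a)" using gf'[OF a(1)] by simp
  also have "\<dots> = ?g k + b'"
    using gf'[OF b'c] by (simp add: fa frag_extend_add)
  finally have "a = ?g k + b'" .
  moreover have "?g k \<in> ?K"
    by (rule frag_extend_tensor_kernel[OF closed add smult smult_closed add_closed M k])
  ultimately have "a \<in> ?K #>\<^bsub>?G\<^esub> b'"
    unfolding r_coset_def by auto
  moreover have "?K #>\<^bsub>?G\<^esub> b' = B"
    using G.repr_independence[of b' ?K b] K b b' by simp
  ultimately have "a \<in> B" by simp
  then show "A = B"
    using G.repr_independence[of a ?K b] K a b by simp
qed

text \<open>The splitting is an S-linear retraction of Frobenius, since it sends s^p * 1 to s. As 1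
  \<noteq> 0, the additive order of 1, a divisor of p, is p itself.\<close>

lemma F_pure_if_splitting:
  assumes cr: "cring S" and p: "Factorial_Ring.prime p" and one: "\<one>\<^bsub>S\<^esub> \<noteq> \<zero>\<^bsub>S\<^esub>"
    and p0: "[p] \<cdot>\<^bsub>S\<^esub> \<one>\<^bsub>S\<^esub> = \<zero>\<^bsub>S\<^esub>" and splitting: "frobenius_splitting p S \<sigma>"
  shows "F_pure TYPE('m) p S"
proof -
  interpret cring S by fact
  have s: "\<sigma> \<in> carrier S \<rightarrow> carrier S"
    and sadd: "\<And>x y. x \<in> carrier S \<Longrightarrow> y \<in> carrier S \<Longrightarrow> \<sigma> (x \<oplus>\<^bsub>S\<^esub> y) = \<sigma> x \<oplus>\<^bsub>S\<^esub> \<sigma> y"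
    and smul: "\<And>s x. s \<in> carrier S \<Longrightarrow> x \<in> carrier S \<Longrightarrow> \<sigma> ((s [^]\<^bsub>S\<^esub> p) \<otimes>\<^bsub>S\<^esub> x) = s \<otimes>\<^bsub>S\<^esub> \<sigma> x"
    and s1: "\<sigma> \<one>\<^bsub>S\<^esub> = \<one>\<^bsub>S\<^esub>" using splitting unfolding frobenius_splitting_def by blast+
  have "group.ord (add_monoid S) \<one>\<^bsub>S\<^esub> dvd p"
    using add.pow_eq_id[of "\<one>\<^bsub>S\<^esub>" p] p0 by simp
  moreover have "group.ord (add_monoid S) \<one>\<^bsub>S\<^esub> \<noteq> 1"
    using add.ord_eq_1[of "\<one>\<^bsub>S\<^esub>"] one by simp
  ultimately have ord: "group.ord (add_monoid S) \<one>\<^bsub>S\<^esub> = p"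
    using p prime_nat_iff by blast
  have "pure_map TYPE('m) S (self_module S) (frobenius_module p S) (\<lambda>x. x [^]\<^bsub>S\<^esub> p)"
  proof (rule pure_map_if_retract[where g = \<sigma>])
    fix x assume "x \<in> carrier (self_module S)"
    then show "\<sigma> (x [^]\<^bsub>S\<^esub> p) = x"
      using smul[of x "\<one>\<^bsub>S\<^esub>"] s1 by (simp add: self_module_def)
  qed (use s sadd smul in \<open>auto simp: self_module_def frobenius_module_def\<close>)
  then show ?thesis
    using cr p ord by (simp add: F_pure_def)
qed

section \<open>Blowup algebras of a filtration compatible with a splitting\<close>

lemma ring_of_type_algebra_sel [simp]:
  "carrier ring_of_type_algebra = UNIV"
  "monoid.mult ring_of_type_algebra = (*)"
  "one ring_of_type_algebra = 1"
  "ring.zero ring_of_type_algebra = 0"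
  "add ring_of_type_algebra = (+)"
  by (simp_all add: ring_of_type_algebra_def)

lemma cring_image:
  assumes S: "cring S"
    and carr: "carrier T = \<rho> ` carrier S"
    and h_add: "\<And>x y. x \<in> carrier S \<Longrightarrow> y \<in> carrier S \<Longrightarrow> \<rho> (x \<oplus>\<^bsub>S\<^esub> y) = \<rho> x \<oplus>\<^bsub>T\<^esub> \<rho> y"
    and h_mult: "\<And>x y. x \<in> carrier S \<Longrightarrow> y \<in> carrier S \<Longrightarrow> \<rho> (x \<otimes>\<^bsub>S\<^esub> y) = \<rho> x \<otimes>\<^bsub>T\<^esub> \<rho> y"
    and h_one: "\<rho> \<one>\<^bsub>S\<^esub> = \<one>\<^bsub>T\<^esub>" and h_zero: "\<rho> \<zero>\<^bsub>S\<^esub> = \<zero>\<^bsub>T\<^esub>"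
  shows "cring T"
proof -
  interpret cring S by fact
  note fl = h_add[symmetric] h_mult[symmetric] h_one[symmetric] h_zero[symmetric]
  show ?thesis
  proof (rule cringI)
    show "abelian_group T"
    proof (rule abelian_groupI)
      fix x assume "x \<in> carrier T"
      then obtain x' where "x' \<in> carrier S" "x = \<rho> x'" using carr by auto
      then show "\<exists>y\<in>carrier T. y \<oplus>\<^bsub>T\<^esub> x = \<zero>\<^bsub>T\<^esub>"
        by (intro bexI[of _ "\<rho> (\<ominus>\<^bsub>S\<^esub> x')"]) (auto simp: carr fl l_neg)
    qed (auto simp: carr fl a_ac)
    show "comm_monoid T"
      by (rule comm_monoidI) (auto simp: carr fl m_ac)
  qed (auto simp: carr fl l_distr)
qed

text \<open>\<open>T\<close> inherits the ring axioms along \<open>\<rho>\<close>, and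
  \<open>compat\<close> lets \<open>\<sigma>\<close> descend through arbitrarily chosen preimages.
  Both the associated graded ring and the quotient ring are treated in this way.\<close>

lemma F_pure_image:
  assumes S: "cring S" and p: "Factorial_Ring.prime p"
    and p0: "[p] \<cdot>\<^bsub>S\<^esub> \<one>\<^bsub>S\<^esub> = \<zero>\<^bsub>S\<^esub>" and splitting: "frobenius_splitting p S \<sigma>"
    and carr: "carrier T = \<rho> ` carrier S"
    and h_add: "\<And>x y. x \<in> carrier S \<Longrightarrow> y \<in> carrier S \<Longrightarrow> \<rho> (x \<oplus>\<^bsub>S\<^esub> y) = \<rho> x \<oplus>\<^bsub>T\<^esub> \<rho> y"
    and h_mult: "\<And>x y. x \<in> carrier S \<Longrightarrow> y \<in> carrier S \<Longrightarrow> \<rho> (x \<otimes>\<^bsub>S\<^esub> y) = \<rho> x \<otimes>\<^bsub>T\<^esub> \<rho> y"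
    and h_one: "\<rho> \<one>\<^bsub>S\<^esub> = \<one>\<^bsub>T\<^esub>" and h_zero: "\<rho> \<zero>\<^bsub>S\<^esub> = \<zero>\<^bsub>T\<^esub>"
    and compat: "\<And>x y. x \<in> carrier S \<Longrightarrow> y \<in> carrier S \<Longrightarrow> \<rho> x = \<rho> y \<Longrightarrow> \<rho> (\<sigma> x) = \<rho> (\<sigma> y)"
    and ne: "\<one>\<^bsub>T\<^esub> \<noteq> \<zero>\<^bsub>T\<^esub>"
  shows "F_pure TYPE('m) p T"
proof -
  interpret cring S by fact
  have T: "cring T" by (rule cring_image[OF S carr h_add h_mult h_one h_zero])
  interpret T: cring T by fact
  have s: "\<sigma> \<in> carrier S \<rightarrow> carrier S"
    and sadd: "\<And>x y. x \<in> carrier S \<Longrightarrow> y \<in> carrier S \<Longrightarrow> \<sigma> (x \<oplus>\<^bsub>S\<^esub> y) = \<sigma> x \<oplus>\<^bsub>S\<^esub> \<sigma> y"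
    and smul: "\<And>s x. s \<in> carrier S \<Longrightarrow> x \<in> carrier S \<Longrightarrow> \<sigma> ((s [^]\<^bsub>S\<^esub> p) \<otimes>\<^bsub>S\<^esub> x) = s \<otimes>\<^bsub>S\<^esub> \<sigma> x"
    and s1: "\<sigma> \<one>\<^bsub>S\<^esub> = \<one>\<^bsub>S\<^esub>" using splitting unfolding frobenius_splitting_def by blast+
  have h_pow: "\<rho> (x [^]\<^bsub>S\<^esub> n) = \<rho> x [^]\<^bsub>T\<^esub> n" if "x \<in> carrier S" for x and n :: nat
    by (induction n) (simp_all add: h_one h_mult that)
  define \<tau> where "\<tau> y = \<rho> (\<sigma> (SOME x. x \<in> carrier S \<and> \<rho> x = y))" for y
  have \<tau>: "\<tau> (\<rho> x) = \<rho> (\<sigma> x)" if "x \<in> carrier S" for x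
  proof -
    let ?x = "SOME x'. x' \<in> carrier S \<and> \<rho> x' = \<rho> x"
    have "?x \<in> carrier S \<and> \<rho> ?x = \<rho> x"
      by (rule someI[of _ x]) (use that in auto)
    then show ?thesis unfolding \<tau>_def using compat that by blast
  qed
  have sc: "x \<in> carrier S \<Longrightarrow> \<sigma> x \<in> carrier S" for x using s by auto
  have "frobenius_splitting p T \<tau>"
    unfolding frobenius_splitting_def
  proof (intro conjI ballI)
    show "\<tau> \<in> carrier T \<rightarrow> carrier T" by (auto simp: carr \<tau> sc)
    show "\<tau> \<one>\<^bsub>T\<^esub> = \<one>\<^bsub>T\<^esub>" using \<tau>[of "\<one>\<^bsub>S\<^esub>"] by (simp add: h_one s1)
  next
    fix x y assume "x \<in> carrier T" "y \<in> carrier T"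
    then obtain x' y' where xy: "x' \<in> carrier S" "y' \<in> carrier S" "x = \<rho> x'" "y = \<rho> y'" by (auto simp: carr)
    show "\<tau> (x \<oplus>\<^bsub>T\<^esub> y) = \<tau> x \<oplus>\<^bsub>T\<^esub> \<tau> y"
      using xy \<tau>[of "x' \<oplus>\<^bsub>S\<^esub> y'"] \<tau> by (simp add: h_add sadd sc)
    have "(x [^]\<^bsub>T\<^esub> p) \<otimes>\<^bsub>T\<^esub> y = \<rho> ((x' [^]\<^bsub>S\<^esub> p) \<otimes>\<^bsub>S\<^esub> y')"
      using xy by (simp add: h_pow h_mult)
    then show "\<tau> ((x [^]\<^bsub>T\<^esub> p) \<otimes>\<^bsub>T\<^esub> y) = x \<otimes>\<^bsub>T\<^esub> \<tau> y"
      using xy \<tau>[of "(x' [^]\<^bsub>S\<^esub> p) \<otimes>\<^bsub>S\<^esub> y'"] \<tau>[of y'] by (simp add: h_mult smul sc)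
  qed
  moreover have "[p] \<cdot>\<^bsub>T\<^esub> \<one>\<^bsub>T\<^esub> = \<zero>\<^bsub>T\<^esub>"
  proof -
    have "\<rho> ([n] \<cdot>\<^bsub>S\<^esub> \<one>\<^bsub>S\<^esub>) = [n] \<cdot>\<^bsub>T\<^esub> \<one>\<^bsub>T\<^esub>" for n :: nat
      by (induction n) (simp_all add: h_one h_zero h_add)
    from this[of p] show ?thesis by (simp add: p0 h_zero)
  qed
  ultimately show ?thesis
    using F_pure_if_splitting[OF T p ne] by blast
qed

text \<open>Freshman's dream, applied to the expansion of \<open>F\<close> into monomials.\<close>

lemma coeff_power_CHAR:
  fixes F :: "'a :: comm_ring_1 poly"
  assumes "Factorial_Ring.prime p" "p = CHAR('a)"
  shows "Polynomial.coeff (F ^ p) n = (if p dvd n then Polynomial.coeff F (n div p) ^ p else 0)"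
proof -
  have "p > 0" using assms(1) by (simp add: prime_gt_0_nat)
  have "F ^ p = (\<Sum>i\<le>Polynomial.degree F. Polynomial.monom (Polynomial.coeff F i) i) ^ p"
    by (simp add: poly_as_sum_of_monoms)
  also have "\<dots> = (\<Sum>i\<le>Polynomial.degree F. Polynomial.monom (Polynomial.coeff F i) i ^ p)"
    by (rule freshmans_dream_sum) (use assms in simp_all)
  also have "\<dots> = (\<Sum>i\<le>Polynomial.degree F. Polynomial.monom (Polynomial.coeff F i ^ p) (i * p))"
    by (simp add: Polynomial.monom_power mult.commute)
  finally have "Polynomial.coeff (F ^ p) n =
      (\<Sum>i\<le>Polynomial.degree F. if i * p = n then Polynomial.coeff F i ^ p else 0)"
    by (simp add: Polynomial.coeff_sum)
  also have "\<dots> = (\<Sum>i\<le>Polynomial.degree F. if i = n div p \<and> p dvd n then Polynomial.coeff F i ^ p else 0)"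
    by (rule sum.cong) (use \<open>p > 0\<close> in auto)
  also have "\<dots> = (if p dvd n then Polynomial.coeff F (n div p) ^ p else 0)"
    using \<open>p > 0\<close> by (auto simp: Polynomial.coeff_eq_0 not_le zero_power)
  finally show ?thesis .
qed

text \<open>For the Rees algebra it would be enough that \<open>\<phi>\<close> maps
  \<open>J (n * p)\<close> into \<open>J n\<close>. The sharper \<open>\<phi>_J\<close> is what
  makes the induced map on the associated graded ring well defined.\<close>

locale split_filtration =
  fixes A :: "'a :: comm_ring_1 set" and J :: "nat \<Rightarrow> 'a set" and \<phi> :: "'a \<Rightarrow> 'a" and p :: nat
    and R :: "'a ring"
  defines R_def: "R \<equiv> ring_of_type_algebra\<lparr>carrier := A\<rparr>"
  assumes prime_p: "Factorial_Ring.prime p" and p_CHAR: "p = CHAR('a)"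
    and A1: "1 \<in> A" and Aadd: "\<And>x y. x \<in> A \<Longrightarrow> y \<in> A \<Longrightarrow> x + y \<in> A"
    and Amult: "\<And>x y. x \<in> A \<Longrightarrow> y \<in> A \<Longrightarrow> x * y \<in> A" and Auminus: "\<And>x. x \<in> A \<Longrightarrow> - x \<in> A"
    and J0: "J 0 = A" and Jdecr: "\<And>n. J (Suc n) \<subseteq> J n"
    and Jzero: "\<And>n. 0 \<in> J n" and Jadd: "\<And>n x y. x \<in> J n \<Longrightarrow> y \<in> J n \<Longrightarrow> x + y \<in> J n"
    and Jmult: "\<And>m n x y. x \<in> J m \<Longrightarrow> y \<in> J n \<Longrightarrow> x * y \<in> J (m + n)"
    and Jproper: "1 \<notin> J 1"
    and \<phi>_closed: "\<And>x. x \<in> A \<Longrightarrow> \<phi> x \<in> A"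
    and \<phi>_add: "\<And>x y. x \<in> A \<Longrightarrow> y \<in> A \<Longrightarrow> \<phi> (x + y) = \<phi> x + \<phi> y"
    and \<phi>_mult: "\<And>a x. a \<in> A \<Longrightarrow> x \<in> A \<Longrightarrow> \<phi> (a ^ p * x) = a * \<phi> x"
    and \<phi>_one: "\<phi> 1 = 1"
    and \<phi>_J: "\<And>n x. x \<in> J (n * p + 1) \<Longrightarrow> \<phi> x \<in> J (Suc n)"
begin

lemma R_sel [simp]:
  "carrier R = A" "x \<otimes>\<^bsub>R\<^esub> y = x * y" "\<one>\<^bsub>R\<^esub> = 1" "\<zero>\<^bsub>R\<^esub> = 0" "x \<oplus>\<^bsub>R\<^esub> y = x + y"
  by (simp_all add: R_def)

lemma Jsub: "J n \<subseteq> A"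
  using J0 Jdecr by (induction n) auto

lemma Jmem: "x \<in> J n \<Longrightarrow> x \<in> A" using Jsub by blast

lemma Jidl: "a \<in> A \<Longrightarrow> x \<in> J n \<Longrightarrow> a * x \<in> J n"
  using Jmult[of a 0 x n] J0 by simp

lemma Juminus: "x \<in> J n \<Longrightarrow> - x \<in> J n"
  using Jidl[of "-1" x n] Auminus[OF A1] by simp

lemma Azero: "0 \<in> A" using Jzero[of 0] J0 by simp

lemma Jsum: "(\<And>i. i \<in> S \<Longrightarrow> f i \<in> J n) \<Longrightarrow> sum f S \<in> J n"
  by (induction S rule: infinite_finite_induct) (auto simp: Jzero Jadd)

lemma R_cring: "cring R"
proof (rule cringI)
  show "abelian_group R"
    by (rule abelian_groupI) (auto simp: algebra_simps Azero Aadd intro!: bexI[of _ "- _"] Auminus)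
  show "comm_monoid R"
    by (rule comm_monoidI) (auto simp: algebra_simps A1 Amult)
qed (auto simp: algebra_simps)

sublocale R: cring R by (rule R_cring)

lemma R_finsum: "(\<And>i. i \<in> S \<Longrightarrow> f i \<in> A) \<Longrightarrow> finsum R f S = sum f S"
proof (induction S rule: infinite_finite_induct)
  case (insert x S)
  then show ?case by (subst R.finsum_insert) auto
qed (use R.finsum_infinite in auto)

lemma \<phi>_zero: "\<phi> 0 = 0" using \<phi>_add[of 0 0] Azero by simp

lemma \<phi>_sum: "(\<And>i. i \<in> S \<Longrightarrow> f i \<in> A) \<Longrightarrow> \<phi> (sum f S) = (\<Sum>i\<in>S. \<phi> (f i))"
proof (induction S rule: infinite_finite_induct)
  case (insert x S)
  have "sum f S \<in> A" using Jsum[of S f 0] insert J0 by auto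
  with insert show ?case by (simp add: \<phi>_add)
qed (auto simp: \<phi>_zero)

text \<open>For n > 0 this follows from \<open>\<phi>_J\<close> at n - 1, because n p \<ge> (n - 1)
  p + 1 and \<open>J\<close> decreases.\<close>

lemma \<phi>_Jp: "x \<in> J (n * p) \<Longrightarrow> \<phi> x \<in> J n"
proof (cases n)
  case 0
  then show "x \<in> J (n * p) \<Longrightarrow> \<phi> x \<in> J n" using J0 \<phi>_closed by simp
next
  case (Suc m)
  have mono: "J b \<subseteq> J a" if "a \<le> b" for a b
    using that using lift_Suc_antimono_le[of J a b] Jdecr by blast
  have "m * p + 1 \<le> n * p" using prime_gt_0_nat[OF prime_p] by (simp add: Suc)
  then show "x \<in> J (n * p) \<Longrightarrow> \<phi> x \<in> J n" using mono \<phi>_J[of x m] Suc by blast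
qed

lemma R_ideal: "ideal (J n) R"
proof (rule idealI[OF R.ring_axioms])
  show "subgroup (J n) (add_monoid R)"
  proof (rule R.add.subgroupI)
    fix a assume a: "a \<in> J n"
    have "\<ominus>\<^bsub>R\<^esub> a = - a"
      using a Auminus by (intro R.minus_equality) (auto simp: Jmem)
    then show "\<ominus>\<^bsub>R\<^esub> a \<in> J n" using a Juminus by simp
  next
    show "J n \<noteq> {}" using Jzero by blast
  qed (use Jsub Jadd in auto)
qed (use Jidl in \<open>simp_all, metis mult.commute\<close>)

lemma R_coset: "J n +>\<^bsub>R\<^esub> x = (\<lambda>h. h + x) ` J n"
  by (auto simp: a_r_coset_def' image_def)

lemma R_coset_eq: "J n +>\<^bsub>R\<^esub> x = J n +>\<^bsub>R\<^esub> y \<longleftrightarrow> x - y \<in> J n"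
proof
  assume "J n +>\<^bsub>R\<^esub> x = J n +>\<^bsub>R\<^esub> y"
  moreover have "x \<in> J n +>\<^bsub>R\<^esub> x" unfolding R_coset using Jzero[of n] by force
  ultimately have "x \<in> J n +>\<^bsub>R\<^esub> y" by simp
  then show "x - y \<in> J n" by (auto simp: R_coset)
next
  have sub: "J n +>\<^bsub>R\<^esub> x \<subseteq> J n +>\<^bsub>R\<^esub> y" if "x - y \<in> J n" for x y
  proof
    fix z assume "z \<in> J n +>\<^bsub>R\<^esub> x"
    then obtain h where "h \<in> J n" "z = h + x" by (auto simp: R_coset)
    then have "h + (x - y) \<in> J n" "z = (h + (x - y)) + y" using that Jadd by auto
    then show "z \<in> J n +>\<^bsub>R\<^esub> y" unfolding R_coset by blast
  qed
  assume "x - y \<in> J n"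
  moreover from Juminus[OF this] have "y - x \<in> J n" by simp
  ultimately show "J n +>\<^bsub>R\<^esub> x = J n +>\<^bsub>R\<^esub> y" using sub by blast
qed

section \<open>The Rees algebra of the filtration\<close>

definition rees where "rees = UP R\<lparr>carrier := {f \<in> up R. \<forall>n. f n \<in> J n}\<rparr>"

lemma up_iff: "f \<in> up R \<longleftrightarrow> (\<forall>n. f n \<in> A) \<and> finite {n. f n \<noteq> 0}"
proof -
  have "(\<exists>n. bound 0 n f) \<longleftrightarrow> finite {n. f n \<noteq> 0}"
  proof
    assume "\<exists>n. bound 0 n f"
    then obtain n where "\<And>m. n < m \<Longrightarrow> f m = 0" by (auto simp: bound_def)
    then have "{n. f n \<noteq> 0} \<subseteq> {..n}" by (auto simp: not_less[symmetric])
    then show "finite {n. f n \<noteq> 0}" using finite_subset by blast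
  next
    assume "finite {n. f n \<noteq> 0}"
    then obtain n where "\<And>m. f m \<noteq> 0 \<Longrightarrow> m \<le> n" using finite_nat_set_iff_bounded_le by auto
    then show "\<exists>n. bound 0 n f" by (intro exI[of _ n]) (force simp: bound_def)
  qed
  then show ?thesis by (auto simp: up_def Pi_def)
qed

lemma rees_carrier: "f \<in> carrier rees \<longleftrightarrow> (\<forall>n. f n \<in> J n) \<and> finite {n. f n \<noteq> 0}"
  using Jmem by (auto simp: rees_def up_iff)

lemma rees_up: "f \<in> carrier rees \<Longrightarrow> f \<in> up R"
  by (simp add: rees_def)

lemma UP_cring: "cring (UP R)"
  by (rule UP_cring.UP_cring[OF UP_cring.intro[OF R_cring]])

lemma rees_sel:
  "f \<in> up R \<Longrightarrow> g \<in> up R \<Longrightarrow> f \<otimes>\<^bsub>rees\<^esub> g = (\<lambda>n. \<Sum>i\<le>n. f i * g (n - i))"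
  "f \<in> up R \<Longrightarrow> g \<in> up R \<Longrightarrow> f \<oplus>\<^bsub>rees\<^esub> g = (\<lambda>n. f n + g n)"
  "\<one>\<^bsub>rees\<^esub> = (\<lambda>n. if n = 0 then 1 else 0)"
  "\<zero>\<^bsub>rees\<^esub> = (\<lambda>n. 0)"
  by (auto simp: rees_def UP_def fun_eq_iff R_finsum up_iff Amult)

lemma rees_cring: "cring rees"
proof -
  interpret U: cring "UP R" by (rule UP_cring)
  let ?K = "{f \<in> up R. \<forall>n. f n \<in> J n}"
  have Kc: "?K = carrier rees" by (simp add: rees_def)
  have "subring ?K (UP R)"
  proof (rule U.subringI)
    show "?K \<subseteq> carrier (UP R)" by (auto simp: UP_def)
    show "\<one>\<^bsub>UP R\<^esub> \<in> ?K" using A1 Jzero Azero J0 by (auto simp: UP_def up_iff)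
  next
    fix f assume f: "f \<in> ?K"
    then have f': "(\<lambda>n. - f n) \<in> ?K" using Juminus Auminus by (auto simp: up_iff)
    have "\<ominus>\<^bsub>UP R\<^esub> f = (\<lambda>n. - f n)"
      by (rule U.minus_equality) (use f f' in \<open>auto simp: UP_def\<close>)
    with f' show "\<ominus>\<^bsub>UP R\<^esub> f \<in> ?K" by simp
  next
    fix f g assume fg: "f \<in> ?K" "g \<in> ?K"
    then have fg': "f \<in> up R" "g \<in> up R" by auto
    have upc: "up R = carrier (UP R)" by (simp add: UP_def)
    have c: "f \<otimes>\<^bsub>UP R\<^esub> g \<in> up R" "f \<oplus>\<^bsub>UP R\<^esub> g \<in> up R"
      using U.m_closed[of f g] U.a_closed[of f g] fg' unfolding upc by blast+
    have "(\<Sum>i\<le>n. f i * g (n - i)) \<in> J n" for n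
    proof (rule Jsum)
      fix i assume "i \<in> {..n}"
      then show "f i * g (n - i) \<in> J n" using fg Jmult[of "f i" i "g (n - i)" "n - i"] by simp
    qed
    then show "f \<otimes>\<^bsub>UP R\<^esub> g \<in> ?K"
      using c rees_sel(1)[OF fg'] by (auto simp: rees_def)
    show "f \<oplus>\<^bsub>UP R\<^esub> g \<in> ?K"
      using c rees_sel(2)[OF fg'] fg Jadd by (auto simp: rees_def)
  qed
  then show ?thesis
    unfolding rees_def by (intro U.subcring_iff[THEN iffD1] U.subcringI') (auto simp: UP_def)
qed

sublocale rees: cring rees by (rule rees_cring)

lemma rees_coeff_closed: "f \<in> carrier rees \<Longrightarrow> f n \<in> A" using rees_carrier Jmem by blast

text \<open>With T as the grading variable, x T^(n p) goes to \<phi>(x) T^n, and x T^m goes to 0 if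
  p does not divide m.\<close>

definition \<sigma> where "\<sigma> f = (\<lambda>n. \<phi> (f (n * p)))"

text \<open>The Rees algebra sits inside the polynomials over the type \<open>'a\<close>, whose
  characteristic is p; this makes \<open>coeff_power_CHAR\<close> applicable to its p-th
  powers.\<close>

definition to_poly where "to_poly f = Abs_poly f"

lemma coeff_to_poly: "f \<in> up R \<Longrightarrow> Polynomial.coeff (to_poly f) = f"
  unfolding to_poly_def by (rule Abs_poly_inverse) (auto simp: up_iff MOST_iff_cofinite)

lemma to_poly_power:
  assumes f: "f \<in> carrier rees"
  shows "to_poly (f [^]\<^bsub>rees\<^esub> (n::nat)) = to_poly f ^ n"
proof (induction n)
  case 0
  show ?case
    using rees.one_closed
    by (intro poly_eqI) (simp add: coeff_to_poly rees_up, simp add: rees_sel Polynomial.coeff_1)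
next
  case (Suc n)
  let ?g = "f [^]\<^bsub>rees\<^esub> n"
  have g: "?g \<in> carrier rees" using f by simp
  have "to_poly (?g \<otimes>\<^bsub>rees\<^esub> f) = to_poly ?g * to_poly f"
  proof (rule poly_eqI)
    fix m
    have "Polynomial.coeff (to_poly (?g \<otimes>\<^bsub>rees\<^esub> f)) m = (?g \<otimes>\<^bsub>rees\<^esub> f) m"
      using f g by (simp add: coeff_to_poly rees_up)
    also have "\<dots> = (\<Sum>i\<le>m. ?g i * f (m - i))"
      using rees_sel(1)[OF rees_up[OF g] rees_up[OF f]] by simp
    also have "\<dots> = Polynomial.coeff (to_poly ?g * to_poly f) m"
      using f g by (simp add: Polynomial.coeff_mult coeff_to_poly rees_up)
    finally show "Polynomial.coeff (to_poly (?g \<otimes>\<^bsub>rees\<^esub> f)) m = Polynomial.coeff (to_poly ?g * to_poly f) m" .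
  qed
  with Suc show ?case by (simp add: mult.commute)
qed

lemma rees_power_p:
  assumes f: "f \<in> carrier rees"
  shows "(f [^]\<^bsub>rees\<^esub> p) n = (if p dvd n then f (n div p) ^ p else 0)"
proof -
  have "(f [^]\<^bsub>rees\<^esub> p) n = Polynomial.coeff (to_poly f ^ p) n"
    using f by (simp add: to_poly_power[symmetric] coeff_to_poly rees_up)
  also have "\<dots> = (if p dvd n then f (n div p) ^ p else 0)"
    using coeff_power_CHAR[OF prime_p p_CHAR, of "to_poly f" n] f by (simp add: coeff_to_poly rees_up)
  finally show ?thesis .
qed

lemma rees_splitting: "frobenius_splitting p rees \<sigma>"
  unfolding frobenius_splitting_def
proof (intro conjI ballI)
  have p0: "p > 0" using prime_p by (simp add: prime_gt_0_nat)
  show c: "\<sigma> \<in> carrier rees \<rightarrow> carrier rees"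
  proof
    fix f assume f: "f \<in> carrier rees"
    have "{n. \<sigma> f n \<noteq> 0} \<subseteq> {n. f (n * p) \<noteq> 0}" by (auto simp: \<sigma>_def \<phi>_zero)
    also have "\<dots> = (\<lambda>n. n * p) -` {n. f n \<noteq> 0}" by auto
    finally have "finite {n. \<sigma> f n \<noteq> 0}"
      using finite_vimageI[of "{n. f n \<noteq> 0}" "\<lambda>n. n * p"] f p0 rees_carrier
      by (auto simp: inj_on_def intro: finite_subset)
    then show "\<sigma> f \<in> carrier rees"
      using f \<phi>_Jp by (simp add: rees_carrier \<sigma>_def)
  qed
  show "\<sigma> \<one>\<^bsub>rees\<^esub> = \<one>\<^bsub>rees\<^esub>" using p0 by (auto simp: \<sigma>_def rees_sel \<phi>_zero \<phi>_one)
  fix f g assume f: "f \<in> carrier rees" and g: "g \<in> carrier rees"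
  show "\<sigma> (f \<oplus>\<^bsub>rees\<^esub> g) = \<sigma> f \<oplus>\<^bsub>rees\<^esub> \<sigma> g"
  proof -
    have "\<sigma> f \<in> up R" "\<sigma> g \<in> up R" using c f g rees_up by auto
    then show ?thesis
      using f g by (simp only: rees_sel rees_up) (simp add: \<sigma>_def \<phi>_add rees_coeff_closed)
  qed
  show "\<sigma> ((f [^]\<^bsub>rees\<^esub> p) \<otimes>\<^bsub>rees\<^esub> g) = f \<otimes>\<^bsub>rees\<^esub> \<sigma> g"
  proof
    fix n
    have sg: "\<sigma> g \<in> carrier rees" using c g by auto
    have fp: "f [^]\<^bsub>rees\<^esub> p \<in> carrier rees" using f by simp
    have Apow: "f j ^ m \<in> A" for j m
      by (induction m) (auto simp: A1 Amult rees_coeff_closed[OF f])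
    have "((f [^]\<^bsub>rees\<^esub> p) \<otimes>\<^bsub>rees\<^esub> g) (n * p) = (\<Sum>i\<le>n * p. (f [^]\<^bsub>rees\<^esub> p) i * g (n * p - i))"
      using rees_sel(1)[OF rees_up[OF fp] rees_up[OF g]] by simp
    \<comment> \<open>The p-th power of \<open>f\<close> is supported in degrees divisible by p, so
      only these indices contribute.\<close>
    also have "\<dots> = (\<Sum>i\<in>(\<lambda>j. j * p) ` {..n}. (f [^]\<^bsub>rees\<^esub> p) i * g (n * p - i))"
    proof (rule sum.mono_neutral_right)
      show "\<forall>i\<in>{..n * p} - (\<lambda>j. j * p) ` {..n}. (f [^]\<^bsub>rees\<^esub> p) i * g (n * p - i) = 0"
      proof
        fix i assume i: "i \<in> {..n * p} - (\<lambda>j. j * p) ` {..n}"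
        have "\<not> p dvd i"
        proof
          assume "p dvd i"
          then obtain j where "i = j * p" by (metis dvd_div_mult_self)
          with i p0 show False by auto
        qed
        then show "(f [^]\<^bsub>rees\<^esub> p) i * g (n * p - i) = 0" by (simp add: rees_power_p[OF f])
      qed
    qed auto
    also have "\<dots> = (\<Sum>j\<le>n. (f [^]\<^bsub>rees\<^esub> p) (j * p) * g (n * p - j * p))"
      using p0 by (subst sum.reindex) (auto simp: inj_on_def)
    also have "\<dots> = (\<Sum>j\<le>n. f j ^ p * g ((n - j) * p))"
      using p0 by (simp add: rees_power_p[OF f] diff_mult_distrib)
    finally have "\<sigma> ((f [^]\<^bsub>rees\<^esub> p) \<otimes>\<^bsub>rees\<^esub> g) n = \<phi> (\<Sum>j\<le>n. f j ^ p * g ((n - j) * p))"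
      by (simp add: \<sigma>_def)
    also have "\<dots> = (\<Sum>j\<le>n. f j * \<phi> (g ((n - j) * p)))"
      using f g by (subst \<phi>_sum) (auto simp: \<phi>_mult rees_coeff_closed Amult Apow)
    also have "\<dots> = (f \<otimes>\<^bsub>rees\<^esub> \<sigma> g) n"
      using rees_sel(1)[OF rees_up[OF f] rees_up[OF sg]] by (simp add: \<sigma>_def)
    finally show "\<sigma> ((f [^]\<^bsub>rees\<^esub> p) \<otimes>\<^bsub>rees\<^esub> g) n = (f \<otimes>\<^bsub>rees\<^esub> \<sigma> g) n" .
  qed
qed

lemma rees_p: "[p] \<cdot>\<^bsub>rees\<^esub> \<one>\<^bsub>rees\<^esub> = \<zero>\<^bsub>rees\<^esub>"
proof -
  have "[k] \<cdot>\<^bsub>rees\<^esub> \<one>\<^bsub>rees\<^esub> = (\<lambda>n. if n = 0 then of_nat k else 0)" for k :: nat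
  proof (induction k)
    case 0
    then show ?case by (auto simp: rees_sel)
  next
    case (Suc k)
    have "[k] \<cdot>\<^bsub>rees\<^esub> \<one>\<^bsub>rees\<^esub> \<in> up R" "\<one>\<^bsub>rees\<^esub> \<in> up R" by (auto intro: rees_up)
    from rees_sel(2)[OF this] Suc show ?case by (auto simp: rees_sel fun_eq_iff)
  qed
  from this[of p] show ?thesis by (auto simp: rees_sel p_CHAR)
qed

lemma rees_F_pure: "F_pure TYPE('m) p rees"
proof (rule F_pure_if_splitting[OF rees_cring prime_p _ rees_p rees_splitting])
  have "(1::'a) \<noteq> 0" using Jproper Jzero[of 1] by metis
  then show "\<one>\<^bsub>rees\<^esub> \<noteq> \<zero>\<^bsub>rees\<^esub>" by (auto simp: rees_sel fun_eq_iff)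
qed

section \<open>The associated graded ring of the filtration\<close>

definition gr where "gr =
     \<lparr>carrier = {B. (\<forall>n. B n \<in> (\<lambda>x. J (Suc n) +>\<^bsub>R\<^esub> x) ` J n) \<and> finite {n. B n \<noteq> J (Suc n)}},
      monoid.mult = (\<lambda>B C n. \<Oplus>\<^bsub>R Quot J (Suc n)\<^esub>i\<in>{..n}. rcoset_mult R (J (Suc n)) (B i) (C (n - i))),
      one = (\<lambda>n. if n = 0 then J 1 +>\<^bsub>R\<^esub> \<one>\<^bsub>R\<^esub> else J (Suc n)),
      ring.zero = (\<lambda>n. J (Suc n)),
      add = (\<lambda>B C n. B n <+>\<^bsub>R\<^esub> C n)\<rparr>"

lemma coset_zero: "J n +>\<^bsub>R\<^esub> 0 = J n"
  by (simp add: R_coset)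

lemma coset_eq_J: "J n +>\<^bsub>R\<^esub> x = J n \<longleftrightarrow> x \<in> J n"
  using R_coset_eq[of n x 0] by (simp add: coset_zero)

lemma coset_add: "(J n +>\<^bsub>R\<^esub> x) <+>\<^bsub>R\<^esub> (J n +>\<^bsub>R\<^esub> y) = J n +>\<^bsub>R\<^esub> (x + y)" if "x \<in> A" "y \<in> A"
proof -
  interpret I: ideal "J n" R by (rule R_ideal)
  show ?thesis using I.a_rcos_sum[of x y] that by simp
qed

text \<open>Changing x by h in \<open>J (Suc m)\<close> and y by k in \<open>J (Suc n)\<close>
  changes the product by h (k + y) + x k, which lies in \<open>J (Suc (m + n))\<close>. Hence all
  representatives contribute the same coset to the union in \<open>rcoset_mult\<close>.\<close>

lemma coset_mult:
  assumes x: "x \<in> J m" and y: "y \<in> J n"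
  shows "rcoset_mult R (J (Suc (m + n))) (J (Suc m) +>\<^bsub>R\<^esub> x) (J (Suc n) +>\<^bsub>R\<^esub> y) = J (Suc (m + n)) +>\<^bsub>R\<^esub> (x * y)"
proof -
  have "J (Suc (m + n)) +>\<^bsub>R\<^esub> ((h + x) * (k + y)) = J (Suc (m + n)) +>\<^bsub>R\<^esub> (x * y)"
    if "h \<in> J (Suc m)" "k \<in> J (Suc n)" for h k
  proof -
    have "h * (k + y) \<in> J (Suc m + n)"
      using that y Jdecr[of n] by (intro Jmult Jadd) auto
    moreover have "x * k \<in> J (m + Suc n)" using that x by (intro Jmult)
    ultimately have "h * (k + y) + x * k \<in> J (Suc (m + n))" by (simp add: Jadd)
    then show ?thesis unfolding R_coset_eq by (simp add: algebra_simps)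
  qed
  then show ?thesis
    unfolding rcoset_mult_def R_coset[of "Suc m"] R_coset[of "Suc n"]
    using Jzero[of "Suc m"] Jzero[of "Suc n"] by fastforce
qed

lemma coset_finsum:
  assumes "finite S" "\<And>i. i \<in> S \<Longrightarrow> f i \<in> A"
  shows "(\<Oplus>\<^bsub>R Quot J n\<^esub>i\<in>S. J n +>\<^bsub>R\<^esub> f i) = J n +>\<^bsub>R\<^esub> (\<Sum>i\<in>S. f i)"
proof -
  interpret I: ideal "J n" R by (rule R_ideal)
  interpret h: ring_hom_cring R "R Quot J n" "(+>\<^bsub>R\<^esub>) (J n)" by (rule I.rcos_ring_hom_cring[OF R_cring])
  have "J n +>\<^bsub>R\<^esub> finsum R f S = (\<Oplus>\<^bsub>R Quot J n\<^esub>i\<in>S. J n +>\<^bsub>R\<^esub> f i)"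
    using h.hom_finsum[of f S] assms by (simp add: o_def Pi_iff)
  then show ?thesis using assms by (simp add: R_finsum)
qed

definition \<rho> where "\<rho> f = (\<lambda>n. J (Suc n) +>\<^bsub>R\<^esub> f n)"

lemma \<rho>_carrier: "carrier gr = \<rho> ` carrier rees"
proof (intro equalityI subsetI)
  fix B assume "B \<in> carrier gr"
  then have B: "\<And>n. B n \<in> (\<lambda>x. J (Suc n) +>\<^bsub>R\<^esub> x) ` J n" "finite {n. B n \<noteq> J (Suc n)}"
    by (auto simp: gr_def)
  \<comment> \<open>Trivial cosets get the representative 0, which keeps the lifted sequence
    finitely supported.\<close>
  have "\<exists>x. x \<in> J n \<and> B n = J (Suc n) +>\<^bsub>R\<^esub> x \<and> (B n = J (Suc n) \<longrightarrow> x = 0)" for n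
    using B(1)[of n] Jzero[of n] coset_zero[of "Suc n"] by (cases "B n = J (Suc n)") auto
  then obtain f where f: "\<And>n. f n \<in> J n \<and> B n = J (Suc n) +>\<^bsub>R\<^esub> f n \<and> (B n = J (Suc n) \<longrightarrow> f n = 0)" by metis
  have "{n. f n \<noteq> 0} \<subseteq> {n. B n \<noteq> J (Suc n)}" using f by auto
  with B(2) have "finite {n. f n \<noteq> 0}" by (rule rev_finite_subset)
  with f have "f \<in> carrier rees" "B = \<rho> f" by (auto simp: rees_carrier \<rho>_def)
  then show "B \<in> \<rho> ` carrier rees" by blast
next
  fix B assume "B \<in> \<rho> ` carrier rees"
  then obtain f where f: "f \<in> carrier rees" "B = \<rho> f" by auto
  have "{n. \<rho> f n \<noteq> J (Suc n)} \<subseteq> {n. f n \<noteq> 0}" by (auto simp: \<rho>_def coset_zero)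
  then have "finite {n. \<rho> f n \<noteq> J (Suc n)}" using f(1) rees_carrier finite_subset by blast
  then show "B \<in> carrier gr" using f by (auto simp: gr_def rees_carrier \<rho>_def)
qed

lemma gr_F_pure: "F_pure TYPE('m) p gr"
proof (rule F_pure_image[OF rees_cring prime_p rees_p rees_splitting \<rho>_carrier])
  fix f g assume fg: "f \<in> carrier rees" "g \<in> carrier rees"
  show "\<rho> (f \<oplus>\<^bsub>rees\<^esub> g) = \<rho> f \<oplus>\<^bsub>gr\<^esub> \<rho> g"
    using fg by (simp add: rees_sel rees_up \<rho>_def gr_def coset_add rees_coeff_closed)
  show "\<rho> (f \<otimes>\<^bsub>rees\<^esub> g) = \<rho> f \<otimes>\<^bsub>gr\<^esub> \<rho> g"
  proof
    fix n
    have J: "f n \<in> J n" "g n \<in> J n" for n using fg by (auto simp: rees_carrier)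
    have "(\<rho> f \<otimes>\<^bsub>gr\<^esub> \<rho> g) n = (\<Oplus>\<^bsub>R Quot J (Suc n)\<^esub>i\<in>{..n}. J (Suc n) +>\<^bsub>R\<^esub> (f i * g (n - i)))"
    proof -
      have e: "rcoset_mult R (J (Suc n)) (\<rho> f i) (\<rho> g (n - i)) = J (Suc n) +>\<^bsub>R\<^esub> (f i * g (n - i))" if "i \<le> n" for i
        using coset_mult[OF J(1)[of i] J(2)[of "n - i"]] that by (simp add: \<rho>_def)
      interpret I: ideal "J (Suc n)" R by (rule R_ideal)
      interpret Q: ring "R Quot J (Suc n)" by (rule I.quotient_is_ring)
      interpret h: ring_hom_cring R "R Quot J (Suc n)" "(+>\<^bsub>R\<^esub>) (J (Suc n))" by (rule I.rcos_ring_hom_cring[OF R_cring])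
      have "J (Suc n) +>\<^bsub>R\<^esub> (f i * g (n - i)) \<in> carrier (R Quot J (Suc n))" for i
        using h.hom_closed[of "f i * g (n - i)"] fg by (simp add: Amult rees_coeff_closed)
      then show ?thesis
        unfolding gr_def monoid.simps by (intro Q.finsum_cong') (simp_all add: e)
    qed
    also have "\<dots> = J (Suc n) +>\<^bsub>R\<^esub> (\<Sum>i\<le>n. f i * g (n - i))"
      by (rule coset_finsum) (use fg in \<open>auto simp: Amult rees_coeff_closed\<close>)
    also have "\<dots> = \<rho> (f \<otimes>\<^bsub>rees\<^esub> g) n"
      using fg by (simp add: rees_sel rees_up \<rho>_def)
    finally show "\<rho> (f \<otimes>\<^bsub>rees\<^esub> g) n = (\<rho> f \<otimes>\<^bsub>gr\<^esub> \<rho> g) n" ..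
  qed
  assume "\<rho> f = \<rho> g"
  then have eq: "J (Suc n) +>\<^bsub>R\<^esub> f n = J (Suc n) +>\<^bsub>R\<^esub> g n" for n by (simp add: \<rho>_def fun_eq_iff)
  \<comment> \<open>Degree n of the image reads degree n p of the argument, where \<open>f\<close>
    and \<open>g\<close> agree modulo \<open>J (n * p + 1)\<close>; this is exactly the input of
    \<open>\<phi>_J\<close>.\<close>
  have "\<phi> (f (n * p)) - \<phi> (g (n * p)) \<in> J (Suc n)" for n
  proof -
    have d: "f (n * p) - g (n * p) \<in> J (n * p + 1)" using eq[of "n * p"] by (simp add: R_coset_eq)
    then have "\<phi> (f (n * p) - g (n * p)) \<in> J (Suc n)" by (rule \<phi>_J)
    moreover have "\<phi> (f (n * p)) = \<phi> (f (n * p) - g (n * p)) + \<phi> (g (n * p))"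
      using \<phi>_add[of "f (n * p) - g (n * p)" "g (n * p)"] d fg by (simp add: Jmem rees_coeff_closed)
    ultimately show ?thesis by simp
  qed
  then show "\<rho> (\<sigma> f) = \<rho> (\<sigma> g)" by (simp add: \<rho>_def \<sigma>_def R_coset_eq fun_eq_iff)
next
  show "\<rho> \<one>\<^bsub>rees\<^esub> = \<one>\<^bsub>gr\<^esub>" by (auto simp: \<rho>_def rees_sel gr_def coset_zero fun_eq_iff)
  show "\<rho> \<zero>\<^bsub>rees\<^esub> = \<zero>\<^bsub>gr\<^esub>" by (simp add: \<rho>_def rees_sel gr_def coset_zero fun_eq_iff)
  show "\<one>\<^bsub>gr\<^esub> \<noteq> \<zero>\<^bsub>gr\<^esub>"
  proof
    assume "\<one>\<^bsub>gr\<^esub> = \<zero>\<^bsub>gr\<^esub>"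
    then have "\<one>\<^bsub>gr\<^esub> 0 = \<zero>\<^bsub>gr\<^esub> 0" by simp
    then have "J 1 +>\<^bsub>R\<^esub> 1 = J 1" by (simp add: gr_def)
    with Jproper show False using coset_eq_J[of 1 1] by simp
  qed
qed

section \<open>The quotient by the first filtration ideal\<close>

lemma Quot_F_pure: "F_pure TYPE('m) p (R Quot J 1)"
proof (rule F_pure_image[OF R_cring prime_p])
  interpret I: ideal "J 1" R by (rule R_ideal)
  have pow: "x [^]\<^bsub>R\<^esub> n = x ^ n" for x and n :: nat
    by (induction n) (simp_all add: mult.commute)
  have npow: "[n] \<cdot>\<^bsub>R\<^esub> \<one>\<^bsub>R\<^esub> = of_nat n" for n :: nat
    by (induction n) (simp_all add: add.commute)
  show "[p] \<cdot>\<^bsub>R\<^esub> \<one>\<^bsub>R\<^esub> = \<zero>\<^bsub>R\<^esub>" unfolding npow by (simp add: p_CHAR)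
  show "frobenius_splitting p R \<phi>"
    by (auto simp: frobenius_splitting_def pow \<phi>_add \<phi>_mult \<phi>_one \<phi>_closed)
  show "carrier (R Quot J 1) = (\<lambda>x. J 1 +>\<^bsub>R\<^esub> x) ` carrier R"
    by (auto simp: FactRing_def A_RCOSETS_def' a_r_coset_def')
  show "\<one>\<^bsub>R Quot J 1\<^esub> \<noteq> \<zero>\<^bsub>R Quot J 1\<^esub>"
    using Jproper coset_eq_J[of 1 1] by (simp add: FactRing_def)
  show "J 1 +>\<^bsub>R\<^esub> \<one>\<^bsub>R\<^esub> = \<one>\<^bsub>R Quot J 1\<^esub>" "J 1 +>\<^bsub>R\<^esub> \<zero>\<^bsub>R\<^esub> = \<zero>\<^bsub>R Quot J 1\<^esub>"
    by (simp_all add: FactRing_def coset_zero)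
  fix x y assume xy: "x \<in> carrier R" "y \<in> carrier R"
  show "J 1 +>\<^bsub>R\<^esub> (x \<oplus>\<^bsub>R\<^esub> y) = (J 1 +>\<^bsub>R\<^esub> x) \<oplus>\<^bsub>R Quot J 1\<^esub> (J 1 +>\<^bsub>R\<^esub> y)"
    using xy by (simp add: FactRing_def coset_add)
  show "J 1 +>\<^bsub>R\<^esub> (x \<otimes>\<^bsub>R\<^esub> y) = (J 1 +>\<^bsub>R\<^esub> x) \<otimes>\<^bsub>R Quot J 1\<^esub> (J 1 +>\<^bsub>R\<^esub> y)"
    using xy I.rcoset_mult_add[of x y] by (simp add: FactRing_def)
  assume "J 1 +>\<^bsub>R\<^esub> x = J 1 +>\<^bsub>R\<^esub> y"
  \<comment> \<open>Written so as to be the case n = 0 of \<open>\<phi>_J\<close>.\<close>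
  then have d: "x - y \<in> J (0 * p + 1)" by (simp add: R_coset_eq)
  have "\<phi> x = \<phi> (x - y) + \<phi> y" using \<phi>_add[of "x - y" y] Jmem[OF d] xy by simp
  then have "\<phi> x - \<phi> y \<in> J 1" using \<phi>_J[OF d] by simp
  then show "J 1 +>\<^bsub>R\<^esub> \<phi> x = J 1 +>\<^bsub>R\<^esub> \<phi> y" by (simp add: R_coset_eq)
qed

end

section \<open>Polynomials and substitution\<close>

abbreviation keys :: "('a \<Rightarrow>\<^sub>0 'b::zero) \<Rightarrow> 'a set" where
  "keys \<equiv> Poly_Mapping.keys"

abbreviation lookup :: "('a \<Rightarrow>\<^sub>0 'b::zero) \<Rightarrow> 'a \<Rightarrow> 'b" where
  "lookup \<equiv> Poly_Mapping.lookup"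

abbreviation single :: "'a \<Rightarrow> 'b::zero \<Rightarrow> 'a \<Rightarrow>\<^sub>0 'b" where
  "single \<equiv> Poly_Mapping.single"

type_synonym ('v, 'k) mpoly = "('v \<Rightarrow>\<^sub>0 nat) \<Rightarrow>\<^sub>0 'k"

abbreviation Const :: "'k::zero \<Rightarrow> ('v, 'k) mpoly" where
  "Const c \<equiv> single 0 c"

definition Var :: "'v \<Rightarrow> ('v, 'k::zero_neq_one) mpoly" where
  "Var x = single (single x 1) 1"

definition polys :: "'v set \<Rightarrow> ('v, 'k::zero) mpoly set" where
  "polys V = {f. \<forall>m\<in>keys f. keys m \<subseteq> V}"

definition mon :: "'v list \<Rightarrow> 'v \<Rightarrow>\<^sub>0 nat" where
  "mon xs = sum_list (map (\<lambda>x. single x 1) xs)"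

definition wt :: "('v \<Rightarrow> nat) \<Rightarrow> ('v \<Rightarrow>\<^sub>0 nat) \<Rightarrow> nat" where
  "wt w m = (\<Sum>x\<in>keys m. lookup m x * w x)"

lemma mon_simps [simp]:
  "mon [] = 0" "mon (x # xs) = single x 1 + mon xs" "mon (xs @ ys) = mon xs + mon ys"
  by (simp_all add: mon_def)

lemma poly_mapping_expand:
  "f = (\<Sum>m\<in>keys f. single m (lookup f m))"
proof (rule poly_mapping_eqI)
  fix m
  show "lookup f m =
      lookup (\<Sum>m\<in>keys f. single m (lookup f m)) m"
    by (simp add: lookup_sum lookup_single when_def in_keys_iff)
qed

lemma poly_mapping_add_induct [case_names zero single add]:
  fixes f :: "'a \<Rightarrow>\<^sub>0 'b::comm_monoid_add"
  assumes "P 0" "\<And>m c. m \<in> keys f \<Longrightarrow> P (single m c)" "\<And>f g. P f \<Longrightarrow> P g \<Longrightarrow> P (f + g)"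
  shows "P f"
proof -
  have "P (\<Sum>m\<in>S. single m (lookup f m))" if "finite S" "S \<subseteq> keys f" for S
    using that by (induction S rule: finite_induct) (auto intro: assms)
  then show ?thesis using poly_mapping_expand[of f] by (metis finite_keys order_refl)
qed

lemma keys_plus_nat: "keys (m + n) = keys m \<union> keys (n :: 'v \<Rightarrow>\<^sub>0 nat)"
  by (auto simp: in_keys_iff lookup_add)

lemma keys_mon: "keys (mon xs) = set xs"
  by (induction xs) (auto simp: keys_plus_nat)

lemma lookup_mon: "lookup (mon xs) x = count_list xs x"
  by (induction xs) (auto simp: lookup_add lookup_single when_def)

lemma mon_eq_iff: "mon xs = mon ys \<longleftrightarrow> mset xs = mset ys"
proof
  assume "mon xs = mon ys"
  then have "count_list xs x = count_list ys x" for x using lookup_mon by metis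
  then show "mset xs = mset ys" by (intro multiset_eqI) (simp add: count_mset)
next
  assume "mset xs = mset ys"
  then have "sum_mset (image_mset (\<lambda>x. single x 1) (mset xs)) = sum_mset (image_mset (\<lambda>x. single x 1) (mset ys))" by simp
  then show "mon xs = mon ys" unfolding mon_def sum_mset_sum_list[symmetric] mset_map .
qed

lemma ex_mon: "\<exists>xs. m = mon xs"
proof (induction m rule: poly_mapping_add_induct)
  case zero
  show ?case by (rule exI[of _ "[]"]) simp
next
  case (single x n)
  have "single x n = mon (replicate n x)" 
  proof (induction n)
    case (Suc n)
    have "single x (Suc n) = single x 1 + single x n"
      by (simp flip: single_add)
    with Suc show ?case by simp
  qed simp
  then show ?case by blast
next
  case (add f g)
  then show ?case by (metis mon_simps(3))
qed

lemma wt_superset: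
  assumes "finite S" "keys m \<subseteq> S"
  shows "wt w m = (\<Sum>x\<in>S. lookup m x * w x)"
  unfolding wt_def by (rule sum.mono_neutral_left) (use assms in \<open>auto simp: in_keys_iff\<close>)

lemma wt_zero [simp]: "wt w 0 = 0"
  by (simp add: wt_def)

lemma wt_plus: "wt w (m + n) = wt w m + wt w n"
proof -
  let ?S = "keys m \<union> keys n"
  have "wt w (m + n) = (\<Sum>x\<in>?S. lookup (m + n) x * w x)"
    by (rule wt_superset) (auto simp: keys_plus_nat)
  also have "\<dots> = wt w m + wt w n"
    by (subst (1 2) wt_superset[of ?S]) (auto simp: lookup_add algebra_simps sum.distrib)
  finally show ?thesis .
qed

lemma wt_single: "wt w (single x n) = n * w x"
  by (simp add: wt_def)

lemma wt_mon: "wt w (mon xs) = sum_list (map w xs)"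
  by (induction xs) (simp_all add: wt_plus wt_single)

lemma wt_le:
  assumes "\<And>x. x \<in> keys m \<Longrightarrow> w x \<le> b * w' x"
  shows "wt w m \<le> b * wt w' m"
  unfolding wt_def sum_distrib_left by (rule sum_mono) (use assms in \<open>simp add: mult.left_commute\<close>)

lemma polys_Const [simp]: "Const c \<in> polys V"
  by (auto simp: polys_def)

lemma polys_0 [simp]: "0 \<in> polys V" and polys_1 [simp]: "(1 :: ('v, 'k::zero_neq_one) mpoly) \<in> polys V"
  by (auto simp: polys_def)

lemma polys_single: "keys m \<subseteq> V \<Longrightarrow> single m c \<in> polys V"
  by (auto simp: polys_def)

lemma polys_Var [simp]: "x \<in> V \<Longrightarrow> Var x \<in> polys V"
  by (auto simp: polys_def Var_def)

lemma polys_add: "f \<in> polys V \<Longrightarrow> g \<in> polys V \<Longrightarrow> f + g \<in> polys V"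
  unfolding polys_def using keys_add[of f g] by blast

lemma polys_uminus: "f \<in> polys V \<Longrightarrow> - f \<in> polys V"
  for f :: "('v, 'k::ab_group_add) mpoly"
  unfolding polys_def by (simp add: in_keys_iff)

lemma polys_diff: "f \<in> polys V \<Longrightarrow> g \<in> polys V \<Longrightarrow> f - g \<in> polys V"
  for f :: "('v, 'k::ab_group_add) mpoly"
  using polys_add[of f V "- g"] polys_uminus[of g V] by simp

lemma polys_mult: "f \<in> polys V \<Longrightarrow> g \<in> polys V \<Longrightarrow> f * g \<in> polys V"
  for f :: "('v, 'k::semiring_0) mpoly"
  unfolding polys_def using keys_mult[of f g] by (fastforce simp: keys_plus_nat)

lemma polys_sum: "(\<And>i. i \<in> S \<Longrightarrow> f i \<in> polys V) \<Longrightarrow> sum f S \<in> polys V"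
  by (induction S rule: infinite_finite_induct) (auto intro: polys_add)

lemma polys_prod: "(\<And>i. i \<in> S \<Longrightarrow> f i \<in> polys V) \<Longrightarrow> prod f S \<in> polys V"
  for f :: "'i \<Rightarrow> ('v, 'k::comm_semiring_1) mpoly"
  by (induction S rule: infinite_finite_induct) (auto intro: polys_mult)

lemma polys_power: "f \<in> polys V \<Longrightarrow> f ^ n \<in> polys V"
  for f :: "('v, 'k::comm_semiring_1) mpoly"
  by (induction n) (auto intro: polys_mult)

lemma polys_det:
  fixes A :: "('v, 'k::comm_ring_1) mpoly mat"
  assumes "A \<in> carrier_mat n n" "\<And>i j. i < n \<Longrightarrow> j < n \<Longrightarrow> A $$ (i, j) \<in> polys V"
  shows "det A \<in> polys V"
proof -
  have "\<sigma> i < n" if "\<sigma> permutes {0..<n}" "i < n" for \<sigma> i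
    using permutes_in_image[OF that(1), of i] that(2) by simp
  then show ?thesis
    unfolding det_def'[OF assms(1)]
    by (auto intro!: polys_sum polys_mult polys_prod assms(2) simp: sign_def polys_uminus)
qed

lemma polys_mono: "V \<subseteq> V' \<Longrightarrow> polys V \<subseteq> polys V'"
  unfolding polys_def by blast

lemma polys_induct [consumes 1, case_names Const Var add mult]:
  fixes f :: "('v, 'k::comm_semiring_1) mpoly"
  assumes f: "f \<in> polys V" and const: "\<And>c. P (Const c)" and var: "\<And>x. x \<in> V \<Longrightarrow> P (Var x)"
    and add: "\<And>f g. P f \<Longrightarrow> P g \<Longrightarrow> P (f + g)" and mult: "\<And>f g. P f \<Longrightarrow> P g \<Longrightarrow> P (f * g)"
  shows "P f"
proof (induction f rule: poly_mapping_add_induct)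
  case zero
  show ?case using const[of 0] by simp
next
  case (single m c)
  obtain xs where xs: "m = mon xs" using ex_mon by blast
  have "keys m \<subseteq> V" using single f unfolding polys_def by blast
  then have "set xs \<subseteq> V" by (simp add: xs keys_mon)
  then have "P (single (mon xs) c)"
  proof (induction xs)
    case Nil
    then show ?case using const by simp
  next
    case (Cons x xs)
    have "single (mon (x # xs)) c = Var x * single (mon xs) c"
      by (simp add: mult_single Var_def)
    with Cons show ?case by (auto intro!: mult var)
  qed
  then show ?case by (simp add: xs)
next
  case (add f g)
  then show ?case using assms(4) by blast
qed

definition subst :: "('v \<Rightarrow> ('w, 'k) mpoly) \<Rightarrow> ('v, 'k::comm_ring_1) mpoly \<Rightarrow> ('w, 'k) mpoly" where
  "subst s f = (\<Sum>m\<in>keys f. Const (lookup f m) *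
     (\<Prod>x\<in>keys m. s x ^ lookup m x))"

lemma prod_keys_superset:
  fixes s :: "'v \<Rightarrow> 'a::comm_monoid_mult"
  assumes "finite S" "keys m \<subseteq> S"
  shows "(\<Prod>x\<in>keys m. s x ^ lookup m x) = (\<Prod>x\<in>S. s x ^ lookup m x)"
  by (rule prod.mono_neutral_left) (use assms in \<open>auto simp: in_keys_iff\<close>)

lemma prod_keys_plus:
  fixes s :: "'v \<Rightarrow> 'a::comm_monoid_mult"
  shows "(\<Prod>x\<in>keys (m + n). s x ^ lookup (m + n) x) =
    (\<Prod>x\<in>keys m. s x ^ lookup m x) * (\<Prod>x\<in>keys n. s x ^ lookup n x)"
proof -
  let ?S = "keys m \<union> keys n"
  have "(\<Prod>x\<in>keys (m + n). s x ^ lookup (m + n) x) = (\<Prod>x\<in>?S. s x ^ lookup (m + n) x)"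
    by (rule prod_keys_superset) (auto simp: keys_plus_nat)
  also have "\<dots> = (\<Prod>x\<in>?S. s x ^ lookup m x) * (\<Prod>x\<in>?S. s x ^ lookup n x)"
    by (simp add: lookup_add power_add prod.distrib)
  finally show ?thesis by (simp add: prod_keys_superset[of ?S])
qed

lemma subst_add: "subst s (f + g) = subst s f + subst s g"
  unfolding subst_def
  by (rule setsum_keys_plus_distrib[where f = "\<lambda>m c. Const c * (\<Prod>x\<in>keys m. s x ^ lookup m x)"])
    (simp_all add: single_add distrib_right)

lemma subst_single: "subst s (single m c) = Const c * (\<Prod>x\<in>keys m. s x ^ lookup m x)"
  by (simp add: subst_def)

lemma subst_zero [simp]: "subst s 0 = 0"
  by (simp add: subst_def)

lemma const_mult: "Const (a * b) = Const a * (Const b :: ('v, 'k::semiring_0) mpoly)"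
  by (simp add: mult_single)

lemma subst_mult: "subst s (f * g) = subst s f * subst s g"
proof (induction f rule: poly_mapping_add_induct)
  case (single m c)
  show ?case
  proof (induction g rule: poly_mapping_add_induct)
    case (single m' c')
    show ?case
      unfolding mult_single subst_single prod_keys_plus
      unfolding const_mult by (simp only: mult_ac)
  next
    case (add f g)
    then show ?case by (simp add: distrib_left subst_add)
  qed simp
next
  case (add f g)
  then show ?case by (simp add: distrib_right subst_add)
qed simp

lemma subst_one [simp]: "subst s 1 = 1"
  using subst_single[of s 0 1] by simp

lemma subst_hom: "comm_ring_hom (subst s)"
  by unfold_locales (simp_all add: subst_add subst_mult)

lemma subst_Var [simp]: "subst s (Var x) = s x"
  by (simp add: subst_single Var_def)

lemma subst_mon:
  fixes s :: "'v \<Rightarrow> ('w, 'k::comm_ring_1) mpoly"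
  shows "subst s (single (mon xs) 1) = prod_list (map s xs)"
proof (induction xs)
  case (Cons x xs)
  have "single (mon (x # xs)) (1::'k) = Var x * single (mon xs) 1"
    by (simp add: mult_single Var_def)
  then have "subst s (single (mon (x # xs)) 1) = s x * subst s (single (mon xs) 1)"
    by (simp only: subst_mult subst_Var)
  with Cons show ?case by simp
qed simp

lemma subst_expand: "subst s f = (\<Sum>m\<in>keys f. Const (lookup f m) * subst s (single m 1))"
  unfolding subst_def[of s f] by (simp add: subst_single)

section \<open>Contents and antichains\<close>

text \<open>Rows are numbered downwards, so \<open>x\<close> lies strictly north-east of
  \<open>y\<close>. Antidiagonals are chains for this relation.\<close>

definition ne :: "nat \<times> nat \<Rightarrow> nat \<times> nat \<Rightarrow> bool" where
  "ne x y \<longleftrightarrow> fst x < fst y \<and> snd y < snd x"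

text \<open>This is the number of pairs (a, b) of naturals with a \<le> i and b \<le> j, which links
  it to the counts \<open>cnt\<close>.\<close>

definition weight :: "nat \<times> nat \<Rightarrow> nat" where
  "weight x = Suc (fst x) * Suc (snd x)"

text \<open>The first component of a list element is a colour, later the piece to which an entry is
  assigned. Only entries weakly south-east of (a, b) are counted; putting a or b to 0 drops the row
  or the column condition.\<close>

definition cnt :: "'c \<Rightarrow> nat \<Rightarrow> nat \<Rightarrow> ('c \<times> nat \<times> nat) list \<Rightarrow> nat" where
  "cnt c a b ys = length (filter (\<lambda>(c', i, j). c' = c \<and> a \<le> i \<and> b \<le> j) ys)"

lemma cnt_simps [simp]:
  "cnt c a b [] = 0"
  "cnt c a b ((c', i, j) # ys) = (if c' = c \<and> a \<le> i \<and> b \<le> j then 1 else 0) + cnt c a b ys"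
  by (simp_all add: cnt_def)

lemma sum_if_le: "(\<Sum>b\<le>B. if b \<le> j then x else 0) = Suc j * x" if "j \<le> B" for x :: nat
proof -
  have "(\<Sum>b\<le>B. if b \<le> j then x else 0) = (\<Sum>b\<in>{..j}. x)"
    by (rule sum.mono_neutral_cong_right) (use that in auto)
  then show ?thesis by simp
qed

text \<open>Double counting: an entry (i, j) is seen from exactly \<open>weight (i, j)\<close> of
  the positions (a, b).\<close>

lemma sum_weight_eq_cnt:
  assumes "finite C" "\<And>c i j. (c, i, j) \<in> set ys \<Longrightarrow> c \<in> C \<and> i \<le> B \<and> j \<le> B"
  shows "sum_list (map (\<lambda>y. weight (snd y)) ys) = (\<Sum>c\<in>C. \<Sum>a\<le>B. \<Sum>b\<le>B. cnt c a b ys)"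
  using assms(2)
proof (induction ys)
  case (Cons y ys)
  obtain c' i j where y: "y = (c', i, j)" by (cases y)
  have b: "c' \<in> C" "i \<le> B" "j \<le> B" using Cons.prems[of c' i j] y by auto
  have "(\<Sum>c\<in>C. \<Sum>a\<le>B. \<Sum>b\<le>B. if c' = c \<and> a \<le> i \<and> b \<le> j then 1 else (0::nat)) =
      (\<Sum>c\<in>C. \<Sum>a\<le>B. if a \<le> i then (\<Sum>b\<le>B. if b \<le> j then (if c' = c then 1 else 0) else 0) else 0)"
    by (intro sum.cong refl) (auto intro!: sum.neutral)
  also have "\<dots> = (\<Sum>c\<in>C. if c' = c then Suc i * Suc j else 0)"
    using b by (intro sum.cong refl) (simp add: sum_if_le)
  also have "\<dots> = weight (i, j)" using b assms(1) by (simp add: weight_def)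
  finally have "(\<Sum>c\<in>C. \<Sum>a\<le>B. \<Sum>b\<le>B. if c' = c \<and> a \<le> i \<and> b \<le> j then 1 else (0::nat)) = weight (i, j)" .
  moreover have "sum_list (map (\<lambda>y. weight (snd y)) ys) = (\<Sum>c\<in>C. \<Sum>a\<le>B. \<Sum>b\<le>B. cnt c a b ys)"
    by (rule Cons.IH) (use Cons.prems in auto)
  ultimately show ?case by (simp add: y sum.distrib)
qed simp

lemma cnt_le: "cnt c a b ys \<le> cnt c a 0 ys" "cnt c a b ys \<le> cnt c 0 b ys"
  by (induction ys) auto

lemma cnt_antichain:
  assumes "\<And>x y. (c, x) \<in> set zs \<Longrightarrow> (c, y) \<in> set zs \<Longrightarrow> \<not> ne x y"
  shows "cnt c a b zs = cnt c a 0 zs \<or> cnt c a b zs = cnt c 0 b zs"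
proof (cases "\<exists>i j. (c, i, j) \<in> set zs \<and> a \<le> i \<and> j < b")
  case True
  then obtain i j where ij: "(c, i, j) \<in> set zs" "a \<le> i" "j < b" by blast
  have "a \<le> i'" if "(c, i', j') \<in> set zs" "b \<le> j'" for i' j'
    using assms[OF that(1) ij(1)] ij that by (auto simp: ne_def)
  then have "cnt c a b zs = cnt c 0 b zs"
    unfolding cnt_def by (intro arg_cong[where f = length] filter_cong) auto
  then show ?thesis ..
next
  case False
  then have "cnt c a b zs = cnt c a 0 zs"
    unfolding cnt_def by (intro arg_cong[where f = length] filter_cong) (auto simp: not_less)
  then show ?thesis ..
qed

text \<open>Inclusion-exclusion over four neighbouring quadrants, arranged without subtraction. It
  recovers multiplicities from the counts.\<close>

lemma count_list_cnt:
  "count_list ys (c, i, j) + cnt c (Suc i) j ys + cnt c i (Suc j) ys = cnt c i j ys + cnt c (Suc i) (Suc j) ys"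
proof (induction ys)
  case (Cons y ys)
  obtain c' i' j' where "y = (c', i', j')" by (cases y)
  then show ?case
    using Cons by (cases "i' < i"; cases "i' = i"; cases "j' < j"; cases "j' = j") auto
qed simp

lemma mset_eq_if_cnt:
  fixes ys zs :: "('c \<times> nat \<times> nat) list"
  assumes "\<And>c a b. cnt c a b ys = cnt c a b zs"
  shows "mset ys = mset zs"
proof (rule multiset_eqI)
  fix y :: "'c \<times> nat \<times> nat"
  obtain c i j where "y = (c, i, j)" by (cases y)
  then show "count (mset ys) y = count (mset zs) y"
    using count_list_cnt[of ys c i j] count_list_cnt[of zs c i j] assms by (simp add: count_mset)
qed

text \<open>On antichains the counts attain the bound \<open>min (cnt c a 0) (cnt c 0 b)\<close>, and the weight is the sum
  of all counts.\<close>

lemma weight_le_antichain: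
  fixes ys zs :: "('c \<times> nat \<times> nat) list"
  assumes rows: "\<And>c a. cnt c a 0 ys = cnt c a 0 zs" and cols: "\<And>c b. cnt c 0 b ys = cnt c 0 b zs"
    and anti: "\<And>c x y. (c, x) \<in> set zs \<Longrightarrow> (c, y) \<in> set zs \<Longrightarrow> \<not> ne x y"
  shows "sum_list (map (\<lambda>y. weight (snd y)) ys) \<le> sum_list (map (\<lambda>y. weight (snd y)) zs)"
    and "sum_list (map (\<lambda>y. weight (snd y)) ys) = sum_list (map (\<lambda>y. weight (snd y)) zs) \<Longrightarrow> mset ys = mset zs"
proof -
  define C where "C = fst ` (set ys \<union> set zs)"
  define B where "B = Max ((\<lambda>y. fst (snd y) + snd (snd y)) ` (set ys \<union> set zs))"
  have B: "fst (snd y) + snd (snd y) \<le> B" if "y \<in> set ys \<union> set zs" for y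
    unfolding B_def by (rule Max_ge) (use that in auto)
  have bound: "c \<in> C \<and> i \<le> B \<and> j \<le> B" if "(c, i, j) \<in> set ys \<union> set zs" for c i j
    using B[OF that] that by (force simp: C_def)
  have fin: "finite C" by (simp add: C_def)
  have le: "cnt c a b ys \<le> cnt c a b zs" for c a b
    using cnt_antichain[of c zs a b] anti cnt_le[of c a b ys] rows cols by metis
  have eq_ys: "sum_list (map (\<lambda>y. weight (snd y)) ys) = (\<Sum>c\<in>C. \<Sum>a\<le>B. \<Sum>b\<le>B. cnt c a b ys)"
    and eq_zs: "sum_list (map (\<lambda>y. weight (snd y)) zs) = (\<Sum>c\<in>C. \<Sum>a\<le>B. \<Sum>b\<le>B. cnt c a b zs)"
    by (rule sum_weight_eq_cnt[OF fin]; use bound in blast)+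
  show "sum_list (map (\<lambda>y. weight (snd y)) ys) \<le> sum_list (map (\<lambda>y. weight (snd y)) zs)"
    unfolding eq_ys eq_zs by (intro sum_mono le)
  assume "sum_list (map (\<lambda>y. weight (snd y)) ys) = sum_list (map (\<lambda>y. weight (snd y)) zs)"
  then have E: "(\<Sum>c\<in>C. \<Sum>a\<le>B. \<Sum>b\<le>B. cnt c a b ys) = (\<Sum>c\<in>C. \<Sum>a\<le>B. \<Sum>b\<le>B. cnt c a b zs)"
    using eq_ys eq_zs by simp
  have *: "cnt c a b ys = cnt c a b zs" if "c \<in> C" "a \<le> B" "b \<le> B" for c a b
  proof -
    have 1: "(\<Sum>a\<le>B. \<Sum>b\<le>B. cnt c a b ys) = (\<Sum>a\<le>B. \<Sum>b\<le>B. cnt c a b zs)"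
      by (rule sum_mono_inv[OF E _ that(1) fin]) (intro sum_mono le)
    have 2: "(\<Sum>b\<le>B. cnt c a b ys) = (\<Sum>b\<le>B. cnt c a b zs)"
      by (rule sum_mono_inv[OF 1]) (use that in \<open>auto intro: sum_mono le\<close>)
    show ?thesis by (rule sum_mono_inv[OF 2]) (use that le in auto)
  qed
  have zero: "cnt c a b ws = 0" if "\<not> (c \<in> C \<and> a \<le> B \<and> b \<le> B)" "set ws \<subseteq> set ys \<union> set zs" for c a b ws
    unfolding cnt_def using that bound by (force simp: filter_empty_conv)
  show "mset ys = mset zs"
  proof (rule mset_eq_if_cnt)
    fix c a b
    show "cnt c a b ys = cnt c a b zs"
    proof (cases "c \<in> C \<and> a \<le> B \<and> b \<le> B")
      case True
      then show ?thesis using * by blast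
    next
      case False
      then show ?thesis using zero[OF False, of ys] zero[OF False, of zs] by simp
    qed
  qed
qed

section \<open>Substitution of sums of generic rank one matrices\<close>

definition row_var :: "nat \<times> nat \<Rightarrow> nat \<Rightarrow> nat" where "row_var c i = to_nat (True, c, i)"
definition col_var :: "nat \<times> nat \<Rightarrow> nat \<Rightarrow> nat" where "col_var c j = to_nat (False, c, j)"

lemma row_col_var_eq [simp]:
  "row_var c i = row_var c' i' \<longleftrightarrow> c = c' \<and> i = i'"
  "col_var c i = col_var c' i' \<longleftrightarrow> c = c' \<and> i = i'"
  "row_var c i \<noteq> col_var c' i'" "col_var c i \<noteq> row_var c' i'"
  by (simp_all add: row_var_def col_var_def)

text \<open>The term obtained by choosing, in the image of each variable, the summand of the given
  colour. It records the rows and columns used by each colour, but not how they are paired.\<close>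

definition content :: "((nat \<times> nat) \<times> nat \<times> nat) list \<Rightarrow> nat \<Rightarrow>\<^sub>0 nat" where
  "content ys = mon (concat (map (\<lambda>(c, i, j). [row_var c i, col_var c j]) ys))"

lemma content_simps [simp]:
  "content [] = 0"
  "content ((c, i, j) # ys) = mon [row_var c i, col_var c j] + content ys"
  "content (xs @ ys) = content xs + content ys"
  by (simp_all add: content_def add.assoc)

lemma content_Cons: "content (y # ys) = content [y] + content ys"
  by (cases y) (simp del: mon_simps)

text \<open>The counts with a single condition are functions of the content alone, so any two
  colourings with the same content share them.\<close>

lemma cnt_rows: "cnt c a 0 ys = wt (\<lambda>w. if \<exists>i\<ge>a. w = row_var c i then 1 else 0) (content ys)"
  by (induction ys) (auto simp: wt_plus wt_single)

lemma cnt_cols: "cnt c 0 b ys = wt (\<lambda>w. if \<exists>j\<ge>b. w = col_var c j then 1 else 0) (content ys)"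
  by (induction ys) (auto simp: wt_plus wt_single)

text \<open>The entry at \<open>x\<close> of a sum, over the colours, of products of an
  indeterminate column vector and an indeterminate row vector, each cut down to the entries allowed
  by \<open>act\<close>.\<close>

definition generic_entry :: "(nat \<times> nat) set \<Rightarrow> (nat \<times> nat \<Rightarrow> nat \<times> nat \<Rightarrow> bool) \<Rightarrow> nat \<times> nat \<Rightarrow> (nat, 'k::comm_ring_1) mpoly" where
  "generic_entry C act x = (\<Sum>c | c \<in> C \<and> act c x. Var (row_var c (fst x)) * Var (col_var c (snd x)))"

lemma Var_row_col: "Var (row_var c (fst x)) * Var (col_var c (snd x)) = single (content [(c, x)]) (1::'k::comm_ring_1)"
  by (cases x) (simp add: Var_def mult_single)

lemma keys_sum_subset:
  "(\<And>i. i \<in> S \<Longrightarrow> keys (f i) \<subseteq> T) \<Longrightarrow> keys (sum f S) \<subseteq> T"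
  for f :: "'i \<Rightarrow> 'a \<Rightarrow>\<^sub>0 'b::comm_monoid_add"
proof (induction S rule: infinite_finite_induct)
  case (insert x F)
  then show ?case using keys_add[of "f x" "sum f F"] by auto
qed auto

lemma keys_generic_entry: "keys (generic_entry C act x) \<subseteq> {content [(c, x)] | c. True}"
  unfolding generic_entry_def Var_row_col
  by (rule keys_sum_subset) auto

lemma generic_entry_leading:
  assumes "finite C" "c0 \<in> C" "act c0 x"
  shows "\<exists>G. generic_entry C act x = single (content [(c0, x)]) (1::'k::comm_ring_1) + G \<and>
    keys G \<subseteq> {content [(c, x)] | c. c \<noteq> c0}"
proof (intro exI conjI)
  let ?G = "(\<Sum>c\<in>{c. c \<in> C \<and> act c x} - {c0}. single (content [(c, x)]) (1::'k))"
  show "generic_entry C act x = single (content [(c0, x)]) (1::'k) + ?G"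
    unfolding generic_entry_def Var_row_col using assms by (intro sum.remove) auto
  show "keys ?G \<subseteq> {content [(c, x)] | c. c \<noteq> c0}"
    by (rule keys_sum_subset) auto
qed

lemma keys_prod_generic_entry:
  "keys (prod_list (map (generic_entry C act) xs) :: (nat, 'k::comm_ring_1) mpoly) \<subseteq> {content ys | ys. map snd ys = xs}"
proof (induction xs)
  case (Cons x xs)
  show ?case
  proof
    fix m assume "m \<in> keys (prod_list (map (generic_entry C act) (x # xs)) :: (nat, 'k) mpoly)"
    then obtain m1 m2 where m: "m = m1 + m2" and "m1 \<in> keys (generic_entry C act x :: (nat, 'k) mpoly)"
      "m2 \<in> keys (prod_list (map (generic_entry C act) xs) :: (nat, 'k) mpoly)"
      using keys_mult[of "generic_entry C act x :: (nat, 'k) mpoly" "prod_list (map (generic_entry C act) xs)"] by auto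
    then obtain c ys where "m1 = content [(c, x)]" "m2 = content ys" "map snd ys = xs"
      using keys_generic_entry[of C act x] Cons by blast
    then have "m = content ((c, x) # ys)" "map snd ((c, x) # ys) = x # xs"
      unfolding m using content_Cons[of "(c, x)" ys] by simp_all
    then show "m \<in> {content ys | ys. map snd ys = x # xs}"
      by (intro CollectI exI[of _ "(c, x) # ys"] conjI)
  qed
qed simp

text \<open>The remainder is described by the other colourings and not by other monomials: that
  these have a different content is only true for antichains, and is shown where this is
  used.\<close>

lemma prod_generic_entry_leading:
  assumes "finite C" "\<And>x. x \<in> set xs \<Longrightarrow> cl x \<in> C \<and> act (cl x) x"
  shows "\<exists>G. prod_list (map (generic_entry C act) xs) =
      single (content (map (\<lambda>x. (cl x, x)) xs)) (1::'k::comm_ring_1) + G \<and>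
    keys G \<subseteq> {content ys | ys. map snd ys = xs \<and> ys \<noteq> map (\<lambda>x. (cl x, x)) xs}"
  using assms(2)
proof (induction xs)
  case Nil
  show ?case by (rule exI[of _ 0]) simp
next
  case (Cons x xs)
  let ?z = "map (\<lambda>x. (cl x, x))"
  let ?s = "\<lambda>ys. single (content ys) (1::'k)"
  obtain G where G: "prod_list (map (generic_entry C act) xs) = ?s (?z xs) + G"
    "keys G \<subseteq> {content ys | ys. map snd ys = xs \<and> ys \<noteq> ?z xs}"
    using Cons by fastforce
  obtain H where H: "generic_entry C act x = ?s [(cl x, x)] + H"
    "keys H \<subseteq> {content [(c, x)] | c. c \<noteq> cl x}"
    using generic_entry_leading[OF assms(1), of "cl x" act x] Cons.prems by auto
  let ?P = "prod_list (map (generic_entry C act) xs) :: (nat, 'k) mpoly"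
  let ?K = "?s [(cl x, x)] * G + H * ?P"
  have "prod_list (map (generic_entry C act) (x # xs)) = ?s (?z (x # xs)) + ?K"
  proof -
    have "?s [(cl x, x)] * ?s (?z xs) = ?s (?z (x # xs))" by (cases x) (simp add: mult_single)
    then show ?thesis by (simp add: G(1) H(1) algebra_simps)
  qed
  moreover have "keys ?K \<subseteq> {content ys | ys. map snd ys = x # xs \<and> ys \<noteq> ?z (x # xs)}"
  proof
    fix m assume "m \<in> keys ?K"
    then consider "m \<in> keys (?s [(cl x, x)] * G)" | "m \<in> keys (H * ?P)"
      by (meson UnE keys_add subsetD)
    then show "m \<in> {content ys | ys. map snd ys = x # xs \<and> ys \<noteq> ?z (x # xs)}"
    proof cases
      case 1
      then obtain m2 where m: "m = content [(cl x, x)] + m2" "m2 \<in> keys G"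
        using keys_mult[of "?s [(cl x, x)]" G] by auto
      then obtain ys where "m2 = content ys" "map snd ys = xs" "ys \<noteq> ?z xs" using G(2) by blast
      then show ?thesis using m(1) by (intro CollectI exI[of _ "(cl x, x) # ys"]) (use content_Cons[of "(cl x, x)" ys] in simp)
    next
      case 2
      then obtain m1 m2 where m: "m = m1 + m2" "m1 \<in> keys H" "m2 \<in> keys ?P"
        using keys_mult[of H ?P] by blast
      obtain c where "m1 = content [(c, x)]" "c \<noteq> cl x" using m(2) H(2) by blast
      moreover obtain ys where "m2 = content ys" "map snd ys = xs"
        using m(3) keys_prod_generic_entry[of C act xs] by blast
      ultimately show ?thesis using m(1) by (intro CollectI exI[of _ "(c, x) # ys"]) (use content_Cons[of "(c, x)" ys] in simp)
    qed
  qed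
  ultimately show ?case by blast
qed

text \<open>The antichain condition makes the coefficient of the content of \<open>m0\<close> in the substituted
  polynomial equal to that of \<open>m0\<close>: a heavier monomial cannot be rearranged into this content.\<close>

lemma subst_generic_nonzero:
  fixes F :: "'k::comm_ring_1 mat_poly"
  assumes C: "finite C" and m0: "m0 \<in> keys F"
    and min: "\<And>m. m \<in> keys F \<Longrightarrow> wt weight m0 \<le> wt weight m"
    and cl: "\<And>x. x \<in> keys m0 \<Longrightarrow> cl x \<in> C \<and> act (cl x) x"
    and anti: "\<And>x y. x \<in> keys m0 \<Longrightarrow> y \<in> keys m0 \<Longrightarrow> cl x = cl y \<Longrightarrow> \<not> ne x y"
  shows "subst (generic_entry C act) F \<noteq> 0"
proof
  assume zero: "subst (generic_entry C act) F = 0"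
  obtain xs where xs: "m0 = mon xs" using ex_mon by blast
  let ?zs = "map (\<lambda>x. (cl x, x)) xs"
  let ?\<mu> = "content ?zs"
  let ?\<psi> = "\<lambda>m. subst (generic_entry C act) (single m (1::'k))"
  have sx: "set xs = keys m0" by (simp add: xs keys_mon)
  have az: "(c, x) \<in> set ?zs \<Longrightarrow> (c, y) \<in> set ?zs \<Longrightarrow> \<not> ne x y" for c x y
    using anti sx by auto
  have wz: "sum_list (map (\<lambda>y. weight (snd y)) ?zs) = wt weight m0"
    by (simp add: xs wt_mon o_def)
  have key: "mset ys = mset ?zs" if "content ys = ?\<mu>" "wt weight m0 \<le> sum_list (map (\<lambda>y. weight (snd y)) ys)" for ys
  proof -
    have r: "cnt c a 0 ys = cnt c a 0 ?zs" "cnt c 0 b ys = cnt c 0 b ?zs" for c a b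
      by (simp_all only: cnt_rows cnt_cols that(1))
    have "sum_list (map (\<lambda>y. weight (snd y)) ys) = sum_list (map (\<lambda>y. weight (snd y)) ?zs)"
      using weight_le_antichain(1)[of ys ?zs, OF r az] that(2) wz by simp
    from weight_le_antichain(2)[of ys ?zs, OF r az this] show ?thesis .
  qed
  have other: "lookup (?\<psi> m) ?\<mu> = 0" if "m \<in> keys F" "m \<noteq> m0" for m
  proof (rule ccontr)
    assume "lookup (?\<psi> m) ?\<mu> \<noteq> 0"
    then have k: "?\<mu> \<in> keys (?\<psi> m)" by (simp add: in_keys_iff)
    obtain ws where ws: "m = mon ws" using ex_mon by blast
    have "?\<mu> \<in> {content ys | ys. map snd ys = ws}"
      by (rule subsetD[OF keys_prod_generic_entry]) (use k in \<open>simp only: ws subst_mon\<close>)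
    then have "\<exists>ys. ?\<mu> = content ys \<and> map snd ys = ws" by (rule CollectD)
    then obtain ys where ys: "?\<mu> = content ys" "map snd ys = ws" by (elim exE conjE)
    have "sum_list (map (\<lambda>y. weight (snd y)) ys) = wt weight m"
      by (simp add: ws wt_mon ys(2)[symmetric] o_def)
    then have "wt weight m0 \<le> sum_list (map (\<lambda>y. weight (snd y)) ys)"
      using min[OF that(1)] by simp
    then have "mset ys = mset ?zs" by (rule key[OF ys(1)[symmetric]])
    then have "image_mset snd (mset ys) = image_mset snd (mset ?zs)" by (rule arg_cong)
    then have "mset (map snd ys) = mset (map snd ?zs)" unfolding mset_map .
    then have "m = m0" by (simp add: ws xs mon_eq_iff ys(2) o_def)
    with that show False by simp
  qed
  have self: "lookup (?\<psi> m0) ?\<mu> = 1"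
  proof -
    obtain G where G: "prod_list (map (generic_entry C act) xs) = single ?\<mu> (1::'k) + G"
      "keys G \<subseteq> {content ys | ys. map snd ys = xs \<and> ys \<noteq> ?zs}"
      using prod_generic_entry_leading[OF C, of xs cl act] cl sx by blast
    have "?\<mu> \<notin> keys G"
    proof
      assume "?\<mu> \<in> keys G"
      then have "?\<mu> \<in> {content ys | ys. map snd ys = xs \<and> ys \<noteq> ?zs}" by (rule subsetD[OF G(2)])
      then have "\<exists>ys. ?\<mu> = content ys \<and> map snd ys = xs \<and> ys \<noteq> ?zs" by (rule CollectD)
      then obtain ys where ys: "?\<mu> = content ys" "map snd ys = xs" "ys \<noteq> ?zs" by (elim exE conjE)
      have "sum_list (map (\<lambda>y. weight (snd y)) ys) = wt weight m0"
        by (simp add: xs wt_mon ys(2)[symmetric] o_def)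
      then have "mset ys = mset ?zs" by (intro key[OF ys(1)[symmetric]]) simp
      \<comment> \<open>Equal multisets suffice: each element of \<open>ys\<close> then carries the
        colour \<open>cl\<close> of its entry, and the entries themselves come in the order of
        \<open>xs\<close>, so the two lists agree.\<close>
      then have "set ys = set ?zs" by (rule mset_eq_setD)
      then have "y = (cl (snd y), snd y)" if "y \<in> set ys" for y using that by auto
      then have "map (\<lambda>y. (cl (snd y), snd y)) ys = ys" by (intro map_idI) simp
      moreover have "map (\<lambda>y. (cl (snd y), snd y)) ys = ?zs" by (simp add: ys(2)[symmetric] o_def)
      ultimately show False using ys(3) by simp
    qed
    then show ?thesis by (simp add: xs subst_mon G(1) lookup_add in_keys_iff)
  qed
  have lc: "lookup (Const c * f) m = c * lookup f m" for c :: 'k and f :: "(nat, 'k) mpoly" and m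
    by (simp flip: mult_map_scale_conv_mult add: map.rep_eq when_def)
  have "0 = lookup (subst (generic_entry C act) F) ?\<mu>" using zero by simp
  also have "\<dots> = (\<Sum>m\<in>keys F. lookup F m * lookup (?\<psi> m) ?\<mu>)"
    by (subst subst_expand) (simp add: lookup_sum lc)
  also have "\<dots> = (\<Sum>m\<in>{m0}. lookup F m * lookup (?\<psi> m) ?\<mu>)"
    by (rule sum.mono_neutral_right) (use m0 other in auto)
  also have "\<dots> = lookup F m0" by (simp add: self)
  finally show False using m0 by (simp add: in_keys_iff)
qed

section \<open>Leading terms of minors\<close>

text \<open>The matrix factors through a space of dimension \<open>card Q\<close>. Padding both
  factors with zeros to size n leaves the second one with a vanishing last row.\<close>

lemma det_low_rank:
  fixes f g :: "'q \<Rightarrow> nat \<Rightarrow> 'a::comm_ring_1"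
  assumes Q: "finite Q" "card Q < n"
  shows "det (mat n n (\<lambda>(a, b). \<Sum>q\<in>Q. f q a * g q b)) = 0"
proof -
  obtain e where e: "bij_betw e {0..<card Q} Q" using ex_bij_betw_nat_finite[OF Q(1)] by blast
  define A where "A = mat n n (\<lambda>(a, i). if i < card Q then f (e i) a else 0)"
  define B where "B = mat n n (\<lambda>(i, b). if i < card Q then g (e i) b else 0)"
  have AB: "A \<in> carrier_mat n n" "B \<in> carrier_mat n n" by (auto simp: A_def B_def)
  have "mat n n (\<lambda>(a, b). \<Sum>q\<in>Q. f q a * g q b) = A * B"
  proof (rule eq_matI)
    fix a b assume "a < dim_row (A * B)" "b < dim_col (A * B)"
    then have ab: "a < n" "b < n" using AB by auto
    have "(\<Sum>q\<in>Q. f q a * g q b) = (\<Sum>i\<in>{0..<card Q}. f (e i) a * g (e i) b)"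
      by (rule sum.reindex_bij_betw[OF e, symmetric])
    also have "\<dots> = (\<Sum>i\<in>{0..<n}. (if i < card Q then f (e i) a else 0) * (if i < card Q then g (e i) b else 0))"
      by (rule sum.mono_neutral_cong_left) (use Q in auto)
    finally show "mat n n (\<lambda>(a, b). \<Sum>q\<in>Q. f q a * g q b) $$ (a, b) = (A * B) $$ (a, b)"
      using ab by (simp add: A_def B_def scalar_prod_def)
  qed (use AB in auto)
  moreover have "det B = 0"
    unfolding det_def'[OF AB(2)]
  proof (rule sum.neutral, intro ballI)
    fix p assume "p \<in> {p. p permutes {0..<n}}"
    then have "p (n - 1) < n" using Q(2) permutes_in_image[of p "{0..<n}" "n - 1"] by simp
    then have "\<exists>i\<in>{0..<n}. B $$ (i, p i) = 0"
      using Q(2) by (intro bexI[of _ "n - 1"]) (auto simp: B_def)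
    then show "signof p * (\<Prod>i = 0..<n. B $$ (i, p i)) = 0" by (simp add: prod_zero)
  qed
  ultimately show ?thesis using det_mult[OF AB] by simp
qed

text \<open>The index functions need not increase. With increasing \<open>r\<close> and decreasing
  \<open>s\<close>, the diagonal of this matrix is the antidiagonal of the submatrix of X.\<close>

definition minor :: "nat \<Rightarrow> (nat \<Rightarrow> nat) \<Rightarrow> (nat \<Rightarrow> nat) \<Rightarrow> 'k::comm_ring_1 mat_poly" where
  "minor n r s = det (mat n n (\<lambda>(a, b). Var (r a, s b)))"

lemma minor_polys:
  assumes "\<And>a b. a < n \<Longrightarrow> b < n \<Longrightarrow> (r a, s b) \<in> V"
  shows "minor n r s \<in> polys V"
  unfolding minor_def by (rule polys_det[of _ n]) (use assms in auto)

lemma permutes_lt: "p permutes {0..<n} \<Longrightarrow> a < n \<Longrightarrow> p a < n" for n :: nat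
  using permutes_in_image[of p "{0..<n}" a] by simp

lemma minor_expand:
  "minor n r s = (\<Sum>p | p permutes {0..<n}. single (mon (map (\<lambda>a. (r a, s (p a))) [0..<n])) (signof p :: 'k::comm_ring_1))"
proof -
  have pr: "(\<Prod>a = 0..<m. Var (r a, s (p a))) = single (mon (map (\<lambda>a. (r a, s (p a))) [0..<m])) (1::'k)" for m p
    by (induction m) (simp_all add: Var_def mult_single)
  have sg: "signof p * single m (1::'k) = single m (signof p)" for p m
    by (simp add: sign_def single_uminus)
  have "minor n r s = (\<Sum>p | p permutes {0..<n}. signof p * (\<Prod>a = 0..<n. Var (r a, s (p a)) :: 'k mat_poly))"
    unfolding minor_def
    by (subst det_def'[of _ n]) (auto intro!: sum.cong prod.cong simp: permutes_lt)
  then show ?thesis by (simp only: pr sg)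
qed

text \<open>Let a be the least index moved by p, and b the index with p b = a. Exchanging the two
  values lowers the sum by (R b - R a) (S a - S (p a)) > 0, so the induction can run on the value of
  the sum.\<close>

lemma rearrangement_strict:
  fixes R S :: "nat \<Rightarrow> nat"
  assumes R: "strict_mono_on {..<n} R" and S: "\<And>a b. a < b \<Longrightarrow> b < n \<Longrightarrow> S b < S a"
    and p: "p permutes {0..<n}" and ne: "p \<noteq> id"
  shows "(\<Sum>a<n. R a * S a) < (\<Sum>a<n. R a * S (p a))"
  using p ne
proof (induction "\<Sum>a<n. R a * S (p a)" arbitrary: p rule: less_induct)
  case less
  note p = less.prems(1)
  have "\<exists>a. p a \<noteq> a" using less.prems(2) by (auto simp: fun_eq_iff)
  define a where "a = (LEAST a. p a \<noteq> a)"
  have pa: "p a \<noteq> a" unfolding a_def by (rule LeastI_ex) fact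
  have min: "p a' = a'" if "a' < a" for a' using that not_less_Least unfolding a_def by blast
  have an: "a < n" using pa p by (meson atLeastLessThan_iff not_le permutes_not_in zero_le)
  have inj: "inj p" using p permutes_inj by blast
  have a_less: "a < p a"
  proof (rule ccontr)
    assume "\<not> a < p a"
    then have "p a < a" using pa by simp
    from min[OF this] have "p a = a" using inj by (simp add: inj_eq)
    with pa show False ..
  qed
  obtain b where b: "p b = a" using p permutes_surj by (metis surjD)
  have "b \<noteq> a" using b pa by metis
  moreover have "\<not> b < a" using min[of b] b by auto
  ultimately have ab: "a < b" by simp
  have bn: "b < n" using p b an permutes_in_image[OF p, of b] by simp
  have pan: "p a < n" using p an permutes_in_image[OF p, of a] by simp
  define q where "q = p \<circ> transpose a b"
  have q: "q permutes {0..<n}"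
    unfolding q_def by (intro permutes_compose permutes_swap_id p) (use an bn in auto)
  have split: "(\<Sum>x<n. f x) = f a + f b + (\<Sum>x\<in>{..<n} - {a, b}. f x)" for f :: "nat \<Rightarrow> nat"
  proof -
    have "(\<Sum>x<n. f x) = f a + (\<Sum>x\<in>{..<n} - {a}. f x)" using an by (intro sum.remove) auto
    also have "(\<Sum>x\<in>{..<n} - {a}. f x) = f b + (\<Sum>x\<in>{..<n} - {a} - {b}. f x)" using bn ab by (intro sum.remove) auto
    also have "{..<n} - {a} - {b} = {..<n} - {a, b}" by auto
    finally show ?thesis by simp
  qed
  have rest: "(\<Sum>x\<in>{..<n} - {a, b}. R x * S (q x)) = (\<Sum>x\<in>{..<n} - {a, b}. R x * S (p x))"
    by (rule sum.cong) (auto simp: q_def)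
  have "R a < R b" using R ab bn an by (auto simp: strict_mono_on_def)
  then have "\<exists>x>0. R a + x = R b" by (rule less_imp_add_positive)
  then obtain x where x: "R b = R a + x" "x > 0" by metis
  have "S (p a) < S a" using S[OF a_less pan] .
  then have "\<exists>y>0. S (p a) + y = S a" by (rule less_imp_add_positive)
  then obtain y where y: "S a = S (p a) + y" "y > 0" by metis
  have "q a = a" "q b = p a" using b by (simp_all add: q_def)
  then have less_q: "(\<Sum>x<n. R x * S (q x)) < (\<Sum>x<n. R x * S (p x))"
    using split[of "\<lambda>x. R x * S (q x)"] split[of "\<lambda>x. R x * S (p x)"] rest b x y by (simp add: algebra_simps)
  show ?case
  proof (cases "q = id")
    case True
    then show ?thesis using less_q by simp
  next
    case False
    then show ?thesis using less.hyps[OF less_q q False] less_q by simp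
  qed
qed

text \<open>Homogeneity is recorded along with the lightest term since both pass to products. It
  bounds the rewriting of monomials and later makes the trace of a power of g equal to 1.\<close>

definition lead :: "'k::comm_ring_1 mat_poly \<Rightarrow> (nat \<times> nat \<Rightarrow>\<^sub>0 nat) \<Rightarrow> bool" where
  "lead F m \<longleftrightarrow> lookup F m = 1 \<and>
     (\<forall>m'\<in>keys F. wt (\<lambda>_. 1) m' = wt (\<lambda>_. 1) m \<and> (m' \<noteq> m \<longrightarrow> wt weight m < wt weight m'))"

lemma lead_Var: "lead (Var x) (single x 1)"
  by (auto simp: lead_def Var_def split: if_splits)

lemma lead_one: "lead 1 0"
  by (auto simp: lead_def)

lemma lead_tail:
  assumes F: "lead F m" and m': "m' \<in> keys (F - single m 1)"
  shows "wt (\<lambda>_. 1) m' = wt (\<lambda>_. 1) m \<and> wt weight m < wt weight m'"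
proof -
  have ne: "m' \<noteq> m" using F m' by (auto simp: lead_def in_keys_iff lookup_minus)
  then have "m' \<in> keys F" using m' by (simp add: in_keys_iff lookup_minus lookup_single)
  then show ?thesis using F ne by (simp add: lead_def)
qed

lemma lead_mult:
  fixes F G :: "'k::comm_ring_1 mat_poly"
  assumes F: "lead F m" and G: "lead G n"
  shows "lead (F * G) (m + n)"
proof -
  define F' where "F' = F - single m 1"
  define G' where "G' = G - single n 1"
  have F': "wt (\<lambda>_. 1) m' = wt (\<lambda>_. 1) m \<and> wt weight m < wt weight m'" if "m' \<in> keys F'" for m'
    by (rule lead_tail[OF F that[unfolded F'_def]])
  have G': "wt (\<lambda>_. 1) m' = wt (\<lambda>_. 1) n \<and> wt weight n < wt weight m'" if "m' \<in> keys G'" for m'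
    by (rule lead_tail[OF G that[unfolded G'_def]])
  have eq: "F * G = single (m + n) 1 + (single m 1 * G' + F' * G)"
    by (simp add: F'_def G'_def algebra_simps mult_single)
  let ?H = "single m 1 * G' + F' * G"
  have H: "wt (\<lambda>_. 1) m' = wt (\<lambda>_. 1) (m + n) \<and> wt weight (m + n) < wt weight m'" if m': "m' \<in> keys ?H" for m'
  proof -
    from m' consider "m' \<in> keys (single m (1::'k) * G')" | "m' \<in> keys (F' * G)"
      by (meson UnE keys_add subsetD)
    then show ?thesis
    proof cases
      case 1
      then obtain b where "m' = m + b" "b \<in> keys G'"
        using keys_mult[of "single m (1::'k)" G'] by auto
      then show ?thesis using G'[of b] by (simp add: wt_plus)
    next
      case 2
      then obtain a b where "m' = a + b" "a \<in> keys F'" "b \<in> keys G"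
        using keys_mult[of F' G] by auto
      moreover from this(3) have "wt (\<lambda>_. 1) b = wt (\<lambda>_. 1) n" "b \<noteq> n \<longrightarrow> wt weight n < wt weight b"
        using G unfolding lead_def by blast+
      moreover from this(2) have "wt weight n \<le> wt weight b" by (cases "b = n") simp_all
      ultimately show ?thesis using F'[of a] by (simp add: wt_plus)
    qed
  qed
  have "m + n \<notin> keys ?H" using H by blast
  then have "lookup (F * G) (m + n) = 1"
    unfolding eq by (simp add: lookup_add in_keys_iff)
  moreover have "m' = m + n \<or> m' \<in> keys ?H" if "m' \<in> keys (F * G)" for m'
    using that unfolding eq in_keys_iff by (auto simp: lookup_add lookup_single when_def split: if_splits)
  ultimately show ?thesis using H unfolding lead_def by blast
qed

lemma lead_prod: "(\<And>i. i \<in> S \<Longrightarrow> lead (F i) (m i)) \<Longrightarrow> lead (prod F S) (sum m S)"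
  by (induction S rule: infinite_finite_induct) (auto intro: lead_mult lead_one)

lemma lead_power: "lead F m \<Longrightarrow> lead (F ^ n) (\<Sum>i<n. m)"
  using lead_prod[of "{..<n}" "\<lambda>_. F" "\<lambda>_. m"] by simp

text \<open>The term of a permutation p has weight \<Sum> (r a + 1) (s (p a) + 1), so the strict
  rearrangement inequality singles out the identity.\<close>

lemma lead_minor:
  assumes r: "strict_mono_on {..<n} r" and s: "\<And>a b. a < b \<Longrightarrow> b < n \<Longrightarrow> s b < s a"
  shows "lead (minor n r s :: 'k::comm_ring_1 mat_poly) (mon (map (\<lambda>a. (r a, s a)) [0..<n]))"
proof -
  define M where "M p = mon (map (\<lambda>a. (r a, s (p a))) [0..<n])" for p
  let ?P = "{p. p permutes {0..<n}}"
  have deg: "wt (\<lambda>_. 1) (M p) = n" for p by (simp add: M_def wt_mon o_def sum_list_triv)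
  have wM: "wt weight (M p) = (\<Sum>a<n. Suc (r a) * Suc (s (p a)))" for p
    by (simp add: M_def wt_mon o_def weight_def interv_sum_list_conv_sum_set_nat atLeast0LessThan del: mult_Suc mult_Suc_right)
  have less: "wt weight (M id) < wt weight (M p)" if "p \<in> ?P" "p \<noteq> id" for p
    unfolding wM using rearrangement_strict[of n "\<lambda>a. Suc (r a)" "\<lambda>a. Suc (s a)" p] r s that
    by (simp add: strict_mono_on_def)
  have min: "minor n r s = (\<Sum>p\<in>?P. single (M p) (signof p :: 'k))"
    unfolding M_def by (rule minor_expand)
  have fin: "finite ?P" by (simp add: finite_permutations)
  have "lookup (minor n r s :: 'k mat_poly) (M id) = (\<Sum>p\<in>?P. if M p = M id then signof p else 0)"
    by (simp add: min lookup_sum lookup_single when_def)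
  also have "\<dots> = (\<Sum>p\<in>{id}. signof p)"
  proof (rule sum.mono_neutral_cong_right[OF fin])
    show "\<forall>p\<in>?P - {id}. (if M p = M id then signof p else (0::'k)) = 0"
      using less by (metis DiffE insertI1 less_irrefl)
  qed (auto simp: permutes_id)
  finally have one: "lookup (minor n r s :: 'k mat_poly) (M id) = 1" by (simp add: sign_id)
  have "keys (minor n r s :: 'k mat_poly) \<subseteq> M ` ?P"
    unfolding min by (rule keys_sum_subset) auto
  moreover have "wt (\<lambda>_. 1) m' = wt (\<lambda>_. 1) (M id) \<and> (m' \<noteq> M id \<longrightarrow> wt weight (M id) < wt weight m')"
    if "m' \<in> M ` ?P" for m'
  proof -
    from that obtain p where p: "p \<in> ?P" "m' = M p" by (rule imageE)
    show ?thesis using less[OF p(1)] unfolding p(2) deg by metis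
  qed
  ultimately have "lead (minor n r s :: 'k mat_poly) (M id)"
    unfolding lead_def using one by (meson subsetD)
  then show ?thesis by (simp add: M_def)
qed

text \<open>Connects the generators of the ideal, whose columns are listed in increasing order, with
  the minors whose diagonal is an antidiagonal of X. The sign does not affect membership in
  ideals.\<close>

lemma minor_reverse:
  "minor n r (\<lambda>b. s (n - 1 - b)) = (minor n r s :: 'k::comm_ring_1 mat_poly) \<or> minor n r (\<lambda>b. s (n - 1 - b)) = - (minor n r s :: 'k mat_poly)"
proof -
  define p where "p i = (if i < n then n - 1 - i else i)" for i
  have p: "p permutes {0..<n}"
    by (rule bij_imp_permutes, rule bij_betw_byWitness[where f' = p]) (auto simp: p_def)
  define A where "A = mat n n (\<lambda>(a, b). Var (r a, s b) :: 'k mat_poly)"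
  define B where "B = transpose_mat A"
  have AB: "A \<in> carrier_mat n n" "B \<in> carrier_mat n n" by (auto simp: A_def B_def)
  have "minor n r (\<lambda>b. s (n - 1 - b)) = det (transpose_mat (mat n n (\<lambda>(i, j). B $$ (p i, j))))"
    unfolding minor_def by (rule arg_cong[where f = det], rule eq_matI) (auto simp: A_def B_def p_def)
  also have "\<dots> = det (mat n n (\<lambda>(i, j). B $$ (p i, j)))" by (rule det_transpose[of _ n]) simp
  also have "\<dots> = signof p * det B" by (rule det_permute_rows[OF AB(2) p])
  also have "det B = minor n r s" unfolding B_def minor_def using det_transpose[OF AB(1)] by (simp add: A_def)
  finally show ?thesis by (cases "evenperm p") (simp_all add: sign_def)
qed

section \<open>A prime ideal of rank conditions\<close>

locale mixed_ladder =
  fixes k l v :: nat and L :: "(nat \<times> nat) set" and d c t :: "nat \<Rightarrow> nat"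
  assumes lad: "ladder k l L"
    and corner: "\<And>h. h \<in> {1..v} \<Longrightarrow> (d h, c h) \<in> L"
    and d_mono: "mono_on {1..v} d" and c_mono: "mono_on {1..v} c"
    and t_pos: "\<And>h. h \<in> {1..v} \<Longrightarrow> 0 < t h"
begin

definition region :: "nat \<Rightarrow> (nat \<times> nat) set" where
  "region h = {x \<in> L. fst x \<le> d h \<and> c h \<le> snd x}"

lemma L_bounds: "x \<in> L \<Longrightarrow> 1 \<le> fst x \<and> fst x \<le> k \<and> 1 \<le> snd x \<and> snd x \<le> l"
proof -
  assume "x \<in> L"
  then have "x \<in> {1..k} \<times> {1..l}" using lad unfolding ladder_def by (blast dest: subsetD)
  then show ?thesis by (cases x) auto
qed

lemma finite_L: "finite L"
proof -
  have "L \<subseteq> {1..k} \<times> {1..l}" using lad unfolding ladder_def by (rule conjunct1)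
  then show ?thesis by (rule finite_subset) simp
qed

lemma L_rect: "(i, j) \<in> L \<Longrightarrow> (i', j') \<in> L \<Longrightarrow> i \<le> u \<Longrightarrow> u \<le> i' \<Longrightarrow> j' \<le> w \<Longrightarrow> w \<le> j \<Longrightarrow> (u, w) \<in> L"
proof -
  assume a: "(i, j) \<in> L" "(i', j') \<in> L" "i \<le> u" "u \<le> i'" "j' \<le> w" "w \<le> j"
  have "\<forall>i j i' j'. (i, j) \<in> L \<and> (i', j') \<in> L \<and> i \<le> i' \<and> j' \<le> j \<longrightarrow>
        (\<forall>u w. i \<le> u \<and> u \<le> i' \<and> j' \<le> w \<and> w \<le> j \<longrightarrow> (u, w) \<in> L)"
    using lad unfolding ladder_def by (rule conjunct2)
  from this[rule_format, of i j i' j' u w] a show "(u, w) \<in> L" by linarith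
qed

lemma region_rect:
  "(i, j) \<in> region h \<Longrightarrow> (i', j') \<in> region h \<Longrightarrow> i \<le> u \<Longrightarrow> u \<le> i' \<Longrightarrow> j' \<le> w \<Longrightarrow> w \<le> j \<Longrightarrow> (u, w) \<in> region h"
  using L_rect[of i j i' j' u w] unfolding region_def by simp

lemma d_le: "h \<in> {1..v} \<Longrightarrow> h' \<in> {1..v} \<Longrightarrow> h \<le> h' \<Longrightarrow> d h \<le> d h'"
  using d_mono by (simp add: mono_on_def)

lemma c_le: "h \<in> {1..v} \<Longrightarrow> h' \<in> {1..v} \<Longrightarrow> h \<le> h' \<Longrightarrow> c h \<le> c h'"
  using c_mono by (simp add: mono_on_def)

text \<open>A piece \<open>(\<kappa>, j)\<close> stands for a generic rank one matrix supported on the rows below \<open>d\<^sub>j\<close> and the columns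
  left of \<open>c\<^sub>h\<close>, where \<open>j < h\<close> are consecutive among the indices with \<open>t \<le> \<kappa>\<close> (all rows if \<open>j = 0\<close>, all columns if
  there is no \<open>h\<close>). Hence for each level \<open>\<kappa> < t\<^sub>i\<close> exactly one piece, and for \<open>\<kappa> \<ge> t\<^sub>i\<close> no piece, can meet
  region \<open>i\<close>, so that the sum of all pieces has rank less than \<open>t\<^sub>i\<close> there.\<close>

definition row_ok :: "nat \<times> nat \<Rightarrow> nat \<Rightarrow> bool" where
  "row_ok q i \<longleftrightarrow> snd q = 0 \<or> snd q \<in> {1..v} \<and> t (snd q) \<le> fst q \<and> d (snd q) < i"

definition col_ok :: "nat \<times> nat \<Rightarrow> nat \<Rightarrow> bool" where
  "col_ok q j \<longleftrightarrow> (\<forall>h\<in>{1..v}. snd q < h \<and> t h \<le> fst q \<longrightarrow> j < c h)"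

definition act :: "nat \<times> nat \<Rightarrow> nat \<times> nat \<Rightarrow> bool" where
  "act q x \<longleftrightarrow> row_ok q (fst x) \<and> col_ok q (snd x)"

definition pieces :: "(nat \<times> nat) set" where
  "pieces = {1..k} \<times> {0..v}"

definition psi :: "'k::comm_ring_1 mat_poly \<Rightarrow> (nat, 'k) mpoly" where
  "psi = subst (generic_entry pieces act)"

text \<open>Let q = (\<kappa>, j) with t h \<le> \<kappa>. If j < h, the column condition keeps the
  piece to the left of column c h; otherwise its row condition keeps it below row d j \<ge> d h. In
  both cases it misses region h.\<close>

lemma act_level:
  assumes h: "h \<in> {1..v}" and x: "x \<in> region h" and a: "act q x"
  shows "fst q < t h"
proof (rule ccontr)
  assume n: "\<not> fst q < t h"
  have x': "fst x \<le> d h" "c h \<le> snd x" using x by (auto simp: region_def)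
  show False
  proof (cases "snd q < h")
    case True
    then show False using a n h x' by (force simp: act_def col_ok_def)
  next
    case False
    then have "snd q \<in> {1..v}" "d (snd q) < fst x" using a h by (auto simp: act_def row_ok_def)
    then show False using d_le[of h "snd q"] False h x' by auto
  qed
qed

text \<open>Two pieces (\<kappa>, j) and (\<kappa>, j') with j < j' cannot meet the same region,
  even at different entries: meeting it below d j' forces j' < h, hence c j' \<le> c h, while the
  first piece stays to the left of column c j'.\<close>

lemma act_unique:
  assumes h: "h \<in> {1..v}" and x: "x \<in> region h" "y \<in> region h" and a: "act q x" "act q' y"
    and f: "fst q = fst q'" and less: "snd q < snd q'"
  shows False
proof -
  have x': "c h \<le> snd x" "fst y \<le> d h" using x by (auto simp: region_def)
  have q': "snd q' \<in> {1..v}" "t (snd q') \<le> fst q'" "d (snd q') < fst y" using a(2) less by (auto simp: act_def row_ok_def)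
  then have "snd x < c (snd q')" using a(1) less f by (auto simp: act_def col_ok_def)
  moreover have "snd q' < h" using d_le[of h "snd q'"] h q' x' by force
  then have "c (snd q') \<le> c h" using c_le q' h by simp
  ultimately show False using x' by simp
qed

lemma card_active:
  assumes h: "h \<in> {1..v}"
  shows "card {q \<in> pieces. \<exists>x\<in>region h. act q x} < t h"
proof -
  let ?Q = "{q \<in> pieces. \<exists>x\<in>region h. act q x}"
  have "inj_on fst ?Q"
  proof (rule inj_onI)
    fix q q' assume "q \<in> ?Q" "q' \<in> ?Q" and "fst q = fst q'"
    then obtain x y where xy: "x \<in> region h" "act q x" "y \<in> region h" "act q' y" by blast
    have "snd q = snd q'"
      using act_unique[OF h xy(1,3,2,4)] act_unique[OF h xy(3,1,4,2)] \<open>fst q = fst q'\<close>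
      by (metis linorder_neqE_nat)
    with \<open>fst q = fst q'\<close> show "q = q'" by (simp add: prod_eq_iff)
  qed
  then have "card ?Q = card (fst ` ?Q)" by (simp add: card_image)
  also have "fst ` ?Q \<subseteq> {1..<t h}" using act_level[OF h] by (fastforce simp: pieces_def)
  then have "card (fst ` ?Q) \<le> card {1..<t h}" by (intro card_mono) auto
  finally show ?thesis using t_pos[OF h] by simp
qed

text \<open>The row and column conditions of a piece are independent, so the truncated matrix still
  has rank at most one, and only the fewer than t h pieces that meet the region contribute.\<close>

lemma psi_minor:
  assumes h: "h \<in> {1..v}" and n: "t h \<le> n" and ent: "\<And>a b. a < n \<Longrightarrow> b < n \<Longrightarrow> (r a, s b) \<in> region h"
  shows "psi (minor n r s :: 'k::comm_ring_1 mat_poly) = 0"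
proof -
  interpret comm_ring_hom "psi :: 'k mat_poly \<Rightarrow> _" unfolding psi_def by (rule subst_hom)
  define Q where "Q = {q \<in> pieces. \<exists>x\<in>region h. act q x}"
  let ?f = "\<lambda>q a. if row_ok q (r a) then Var (row_var q (r a)) else 0 :: (nat, 'k) mpoly"
  let ?g = "\<lambda>q b. if col_ok q (s b) then Var (col_var q (s b)) else 0 :: (nat, 'k) mpoly"
  have fin: "finite Q" by (simp add: Q_def pieces_def)
  have e: "psi (Var (r a, s b)) = (\<Sum>q\<in>Q. ?f q a * ?g q b)" if "a < n" "b < n" for a b
  proof -
    have "psi (Var (r a, s b)) = (\<Sum>q | q \<in> pieces \<and> act q (r a, s b). Var (row_var q (r a)) * Var (col_var q (s b)) :: (nat, 'k) mpoly)"
      by (simp add: psi_def generic_entry_def)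
    also have "\<dots> = (\<Sum>q\<in>Q. ?f q a * ?g q b)"
      by (rule sum.mono_neutral_cong_left[OF fin]) (use ent[OF that] in \<open>auto simp: Q_def act_def intro!: bexI[of _ "(r a, s b)"]\<close>)
    finally show ?thesis .
  qed
  have "psi (minor n r s) = det (map_mat psi (mat n n (\<lambda>(a, b). Var (r a, s b) :: 'k mat_poly)))"
    unfolding minor_def hom_det ..
  also have "map_mat psi (mat n n (\<lambda>(a, b). Var (r a, s b) :: 'k mat_poly)) = mat n n (\<lambda>(a, b). \<Sum>q\<in>Q. ?f q a * ?g q b)"
    by (rule eq_matI) (auto simp: e)
  also have "det \<dots> = 0"
    by (rule det_low_rank[OF fin]) (use card_active[OF h] n in \<open>simp add: Q_def\<close>)
  finally show ?thesis .
qed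

text \<open>Only the support of a monomial matters, as products of antidiagonals are squarefree. By
  the ladder property, a chain in a region is the antidiagonal of a minor with all entries in that
  region.\<close>

definition standard :: "(nat \<times> nat) set \<Rightarrow> bool" where
  "standard S \<longleftrightarrow> (\<forall>h\<in>{1..v}. \<forall>xs. sorted_wrt ne xs \<and> set xs \<subseteq> S \<inter> region h \<longrightarrow> length xs < t h)"

text \<open>The end \<open>x\<close> is left off, so that the empty chain always belongs and the
  maximum in \<open>level\<close> is taken over a nonempty set.\<close>

definition chains :: "(nat \<times> nat) set \<Rightarrow> nat \<times> nat \<Rightarrow> (nat \<times> nat) list set" where
  "chains S x = {xs. sorted_wrt ne (xs @ [x]) \<and> set xs \<subseteq> S}"

definition level :: "(nat \<times> nat) set \<Rightarrow> nat \<times> nat \<Rightarrow> nat" where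
  "level S x = Suc (Max (length ` chains S x))"

lemma length_chain:
  assumes "sorted_wrt ne (xs @ [x])" "set xs \<subseteq> L"
  shows "length xs < fst x \<or> xs = []"
  using assms
proof (induction xs arbitrary: x rule: rev_induct)
  case (snoc y ys)
  then have "sorted_wrt ne (ys @ [y])" "set ys \<subseteq> L" "ne y x" by (auto simp: sorted_wrt_append)
  with snoc.IH[of y] have "length ys < fst y \<or> ys = []" by blast
  moreover have "1 \<le> fst y" using snoc.prems L_bounds[of y] by simp
  ultimately show ?case using \<open>ne y x\<close> by (auto simp: ne_def)
qed simp

lemma finite_chain_lengths:
  assumes "S \<subseteq> L"
  shows "finite (length ` chains S x)"
proof (rule finite_subset)
  show "length ` chains S x \<subseteq> {0..fst x}"
    using length_chain assms by (fastforce simp: chains_def)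
qed simp

lemma Nil_chain: "[] \<in> chains S x"
  by (simp add: chains_def)

lemma level_chain:
  assumes "S \<subseteq> L"
  obtains xs where "xs \<in> chains S x" "Suc (length xs) = level S x"
proof -
  have "Max (length ` chains S x) \<in> length ` chains S x"
    using finite_chain_lengths[OF assms] Nil_chain[of S x] by (intro Max_in) blast+
  then show ?thesis using that unfolding level_def by auto
qed

lemma level_ge: "S \<subseteq> L \<Longrightarrow> xs \<in> chains S x \<Longrightarrow> Suc (length xs) \<le> level S x"
  unfolding level_def using finite_chain_lengths by simp

lemma ne_trans: "ne x y \<Longrightarrow> ne y z \<Longrightarrow> ne x z"
  by (auto simp: ne_def)

text \<open>A longest chain ending at \<open>x\<close> can be prolonged by \<open>x\<close>. Hence
  entries of equal level form an antichain.\<close>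

lemma level_less:
  assumes S: "S \<subseteq> L" and x: "x \<in> S" and xy: "ne x y"
  shows "level S x < level S y"
proof -
  obtain xs where xs: "xs \<in> chains S x" "Suc (length xs) = level S x" using level_chain[OF S] .
  then have "xs @ [x] \<in> chains S y"
    using x xy by (auto simp: chains_def sorted_wrt_append intro: ne_trans)
  from level_ge[OF S this] xs show ?thesis by simp
qed

lemma level_le:
  assumes S: "S \<subseteq> L" and x: "x \<in> S"
  shows "1 \<le> level S x \<and> level S x \<le> k"
proof -
  obtain xs where xs: "xs \<in> chains S x" "Suc (length xs) = level S x" using level_chain[OF S] .
  then have "length xs < fst x \<or> xs = []" using S by (intro length_chain) (auto simp: chains_def)
  then show ?thesis using xs L_bounds[of x] S x by auto
qed

lemma region_ne: "y \<in> region h \<Longrightarrow> x \<in> L \<Longrightarrow> ne x y \<Longrightarrow> x \<in> region h"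
  by (auto simp: region_def ne_def)

text \<open>A region is closed under moving north-east inside L, so a whole chain ending in it lies
  in it, and standardness bounds its length.\<close>

lemma level_region:
  assumes S: "S \<subseteq> L" and x: "x \<in> S" and std: "standard S" and h: "h \<in> {1..v}" and xh: "x \<in> region h"
  shows "level S x < t h"
proof -
  obtain xs where xs: "xs \<in> chains S x" "Suc (length xs) = level S x" using level_chain[OF S] .
  then have "set (xs @ [x]) \<subseteq> S \<inter> region h"
    using region_ne[OF xh] x xh S by (auto simp: chains_def sorted_wrt_append)
  then have "length (xs @ [x]) < t h" using std xs h unfolding standard_def chains_def by blast
  then show ?thesis using xs by simp
qed

text \<open>The second component is the largest index j with t j \<le> level whose region ends above
  \<open>x\<close>, or 0. For a later index h with t h \<le> level, \<open>x\<close> is not below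
  row d h and, by \<open>level_region\<close>, not in region h; so it lies to the left of column c
  h, as \<open>col_ok\<close> demands.\<close>

definition piece_of :: "(nat \<times> nat) set \<Rightarrow> nat \<times> nat \<Rightarrow> nat \<times> nat" where
  "piece_of S x = (level S x, Max (insert 0 {j \<in> {1..v}. t j \<le> level S x \<and> d j < fst x}))"

lemma piece_of:
  assumes S: "S \<subseteq> L" and x: "x \<in> S" and std: "standard S"
  shows "piece_of S x \<in> pieces \<and> act (piece_of S x) x"
proof -
  define T where "T = insert 0 {j \<in> {1..v}. t j \<le> level S x \<and> d j < fst x}"
  have fin: "finite T" "T \<noteq> {}" by (auto simp: T_def)
  have p: "piece_of S x = (level S x, Max T)" by (simp add: piece_of_def T_def)
  have mT: "Max T \<in> T" using fin by (rule Max_in)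
  then have "piece_of S x \<in> pieces" using level_le[OF S x] by (auto simp: p pieces_def T_def)
  moreover have "row_ok (piece_of S x) (fst x)" using mT by (auto simp: p row_ok_def T_def)
  moreover have "col_ok (piece_of S x) (snd x)"
    unfolding col_ok_def p
  proof (intro ballI impI)
    fix h assume h: "h \<in> {1..v}" and *: "snd (level S x, Max T) < h \<and> t h \<le> fst (level S x, Max T)"
    have "h \<notin> T" using Max_ge[OF fin(1), of h] * by auto
    then have "fst x \<le> d h" using h * by (auto simp: T_def)
    moreover have "x \<notin> region h" using level_region[OF S x std h] * by auto
    ultimately show "snd x < c h" using x S by (auto simp: region_def)
  qed
  ultimately show ?thesis by (simp add: act_def)
qed

lemma psi_nonzero:
  fixes F :: "'k::comm_ring_1 mat_poly"
  assumes F: "F \<in> polys L" and m: "m \<in> keys F" and std: "standard (keys m)"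
    and min: "\<And>m'. m' \<in> keys F \<Longrightarrow> wt weight m \<le> wt weight m'"
  shows "psi F \<noteq> 0"
proof -
  let ?S = "keys m"
  have S: "?S \<subseteq> L" using F m by (auto simp: polys_def)
  show ?thesis
    unfolding psi_def
  proof (rule subst_generic_nonzero[OF _ m min, of pieces "piece_of ?S"])
    show "finite pieces" by (simp add: pieces_def)
    show "piece_of ?S x \<in> pieces \<and> act (piece_of ?S x) x" if "x \<in> ?S" for x
      by (rule piece_of[OF S that std])
    show "\<not> ne x y" if "x \<in> ?S" "y \<in> ?S" "piece_of ?S x = piece_of ?S y" for x y
      using level_less[OF S that(1), of y] that(3) by (auto simp: piece_of_def)
  qed
qed

lemma psi_nonzero_standard:
  fixes F :: "'k::comm_ring_1 mat_poly"
  assumes F: "F \<in> polys L" and nz: "F \<noteq> 0" and std: "\<And>m. m \<in> keys F \<Longrightarrow> standard (keys m)"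
  shows "psi F \<noteq> 0"
proof -
  have "keys F \<noteq> {}" using nz by simp
  then obtain m where m: "m \<in> keys F" "\<And>m'. m' \<in> keys F \<Longrightarrow> wt weight m \<le> wt weight m'"
    using ex_min_if_finite[of "wt weight ` keys F"] by (metis arg_min_least arg_min_if_finite(1) finite_keys)
  show ?thesis by (rule psi_nonzero[OF F m(1) std[OF m(1)] m(2)])
qed

lemma psi_nonzero_lead:
  fixes F :: "'k::comm_ring_1 mat_poly"
  assumes F: "F \<in> polys L" and "lead F m" and std: "standard (keys m)"
  shows "psi F \<noteq> 0"
proof (rule psi_nonzero[OF F _ std])
  show "m \<in> keys F" using assms(2) by (simp add: lead_def in_keys_iff)
  show "wt weight m \<le> wt weight m'" if "m' \<in> keys F" for m'
    using assms(2) that unfolding lead_def by (cases "m' = m") auto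
qed

section \<open>Rewriting monomials into standard ones\<close>

definition sub_ideal :: "'k::comm_ring_1 mat_poly set \<Rightarrow> bool" where
  "sub_ideal K \<longleftrightarrow> 0 \<in> K \<and> (\<forall>f\<in>K. \<forall>g\<in>K. f + g \<in> K) \<and> (\<forall>f\<in>polys L. \<forall>g\<in>K. f * g \<in> K)"

definition reducible :: "'k::comm_ring_1 mat_poly set \<Rightarrow> 'k mat_poly \<Rightarrow> bool" where
  "reducible K F \<longleftrightarrow> (\<exists>G\<in>polys L. (\<forall>m\<in>keys G. standard (keys m)) \<and> F - G \<in> K)"

lemma reducible_add:
  assumes K: "sub_ideal K" and F: "reducible K F" "reducible K F'"
  shows "reducible K (F + F')"
proof -
  from F obtain G G' where G: "G \<in> polys L" "\<forall>m\<in>keys G. standard (keys m)" "F - G \<in> K"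
    and G': "G' \<in> polys L" "\<forall>m\<in>keys G'. standard (keys m)" "F' - G' \<in> K"
    unfolding reducible_def by blast
  have "F + F' - (G + G') = (F - G) + (F' - G')" by simp
  moreover have "(F - G) + (F' - G') \<in> K" using K G(3) G'(3) unfolding sub_ideal_def by blast
  ultimately have "F + F' - (G + G') \<in> K" by (simp only:)
  then show ?thesis
    unfolding reducible_def using G G' keys_add[of G G'] by (intro bexI[of _ "G + G'"]) (auto intro: polys_add)
qed

lemma reducible_in: "F \<in> K \<Longrightarrow> reducible K F"
  unfolding reducible_def by (intro bexI[of _ 0]) auto

lemma reducible_sum: "sub_ideal K \<Longrightarrow> (\<And>i. i \<in> S \<Longrightarrow> reducible K (F i)) \<Longrightarrow> reducible K (sum F S)"
  by (induction S rule: infinite_finite_induct) (auto intro: reducible_add reducible_in simp: sub_ideal_def)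

lemma reducible_scale:
  assumes K: "sub_ideal K" and F: "reducible K F"
  shows "reducible K (Const a * F)"
proof -
  from F obtain G where G: "G \<in> polys L" "\<forall>m\<in>keys G. standard (keys m)" "F - G \<in> K"
    unfolding reducible_def by blast
  have "Const a * F - Const a * G = Const a * (F - G)" by (simp add: algebra_simps)
  moreover have "Const a * (F - G) \<in> K" using G K unfolding sub_ideal_def by (metis polys_Const)
  moreover have "keys (Const a * G) \<subseteq> keys G" using keys_mult[of "Const a" G] by (auto split: if_splits)
  ultimately show ?thesis
    using G unfolding reducible_def by (intro bexI[of _ "Const a * G"]) (auto intro: polys_mult)
qed

lemma reducible_expand:
  fixes F :: "'k::comm_ring_1 mat_poly"
  assumes K: "sub_ideal K" and red: "\<And>m. m \<in> keys F \<Longrightarrow> reducible K (single (m + m2) 1)"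
  shows "reducible K (F * single m2 1)"
proof -
  have "F * single m2 1 = (\<Sum>m\<in>keys F. single m (lookup F m)) * single m2 1"
    using poly_mapping_expand[of F] by simp
  also have "\<dots> = (\<Sum>m\<in>keys F. Const (lookup F m) * single (m + m2) 1)"
    by (simp add: sum_distrib_right mult_single)
  finally show ?thesis using K red by (auto intro!: reducible_sum reducible_scale)
qed

text \<open>A minor is congruent to its lightest term up to heavier terms of the same degree, so rewriting
  non-standard monomials terminates.\<close>

lemma reduce_monomial:
  fixes K :: "'k::comm_ring_1 mat_poly set"
  assumes K: "sub_ideal K"
    and Kminor: "\<And>h r s. h \<in> {1..v} \<Longrightarrow> strict_mono_on {..<t h} r \<Longrightarrow> (\<And>a b. a < b \<Longrightarrow> b < t h \<Longrightarrow> s b < s a) \<Longrightarrow>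
      (\<And>a b. a < t h \<Longrightarrow> b < t h \<Longrightarrow> (r a, s b) \<in> region h) \<Longrightarrow> minor (t h) r s \<in> K"
    and m: "keys m \<subseteq> L"
  shows "reducible K (single m 1)"
  using m
\<comment> \<open>An entry of L weighs at most (k + 1)(l + 1), so the subtraction is not truncated.
  Rewriting keeps the degree and raises the weight, which makes the measure drop.\<close>
proof (induction "(Suc k * Suc l) * wt (\<lambda>_. 1) m - wt weight m" arbitrary: m rule: less_induct)
  case less
  show ?case
  proof (cases "standard (keys m)")
    case True
    then show ?thesis
      using less.prems K unfolding reducible_def sub_ideal_def
      by (intro bexI[of _ "single m 1"]) (auto simp: polys_single)
  next
    case False
    then obtain h xs where h: "h \<in> {1..v}" and xs: "sorted_wrt ne xs" "set xs \<subseteq> keys m \<inter> region h" "t h \<le> length xs"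
      unfolding standard_def by force
    define n where "n = t h"
    define r where "r a = fst (xs ! a)" for a
    define s where "s a = snd (xs ! a)" for a
    have ne': "ne (xs ! a) (xs ! b)" if "a < b" "b < n" for a b
      using sorted_wrt_nth_less[OF xs(1) that(1)] that(2) xs(3) by (simp add: n_def)
    have r: "strict_mono_on {..<n} r" and s: "\<And>a b. a < b \<Longrightarrow> b < n \<Longrightarrow> s b < s a"
      using ne' by (auto simp: strict_mono_on_def r_def s_def ne_def)
    have xr: "(r a, s a) \<in> keys m \<inter> region h" if "a < n" for a
      using xs(2,3) that nth_mem[of a xs] by (auto simp: r_def s_def n_def)
    \<comment> \<open>Off the chain, the entry lies in the rectangle spanned by the a-th and b-th
      chain entries, which the region contains.\<close>
    have ent: "(r a, s b) \<in> region h" if "a < n" "b < n" for a b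
    proof (cases a b rule: linorder_cases)
      case less
      then show ?thesis
        using region_rect[of "r a" "s a" h "r b" "s b" "r a" "s b"] xr[OF that(1)] xr[OF that(2)] ne'[OF less that(2)]
        by (auto simp: ne_def r_def s_def)
    next
      case equal
      then show ?thesis using xr[OF that(1)] by simp
    next
      case greater
      then show ?thesis
        using region_rect[of "r b" "s b" h "r a" "s a" "r a" "s b"] xr[OF that(1)] xr[OF that(2)] ne'[OF greater that(1)]
        by (auto simp: ne_def r_def s_def)
    qed
    let ?M = "minor n r s :: 'k mat_poly"
    define m1 where "m1 = mon (map (\<lambda>a. (r a, s a)) [0..<n])"
    have lead: "lead ?M m1" unfolding m1_def by (rule lead_minor[OF r s])
    have inj: "inj_on (\<lambda>a. (r a, s a)) {0..<n}"
      using r by (auto simp: inj_on_def strict_mono_on_def) (metis linorder_neqE_nat lessThan_iff less_irrefl)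
    define m2 where "m2 = m - m1"
    \<comment> \<open>The chain has no repetitions, so \<open>m1\<close> is squarefree with support
      in that of \<open>m\<close>, and \<open>m2\<close> is the true quotient.\<close>
    have le: "lookup m1 x \<le> lookup m x" for x
    proof -
      have "distinct (map (\<lambda>a. (r a, s a)) [0..<n])" using inj by (simp add: distinct_map)
      then have "lookup m1 x = (if x \<in> (\<lambda>a. (r a, s a)) ` {0..<n} then 1 else 0)"
        unfolding m1_def lookup_mon distinct_count_atmost_1 count_mset by (simp only: set_map set_upt)
      moreover have "x \<in> keys m" if "x \<in> (\<lambda>a. (r a, s a)) ` {0..<n}" using that xr by auto
      ultimately show ?thesis by (auto simp: in_keys_iff Suc_le_eq)
    qed
    have m: "m = m1 + m2"
      by (rule poly_mapping_eqI) (simp add: m2_def lookup_add lookup_minus le)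
    have minL: "?M \<in> polys L" by (rule minor_polys) (use ent in \<open>auto simp: region_def\<close>)
    have minK: "?M \<in> K" using Kminor[OF h, of r s] r s ent by (simp add: n_def)
    have m2L: "keys m2 \<subseteq> L" using less.prems unfolding m keys_plus_nat by simp
    define T where "T = ?M - single m1 1"
    have TL: "T \<in> polys L" unfolding T_def
      using minL less.prems unfolding m keys_plus_nat by (intro polys_diff polys_single) auto
    have Q1: "reducible K (single (m' + m2) 1)" if m': "m' \<in> keys T" for m'
    proof (rule less.hyps)
      have tail: "wt (\<lambda>_. 1) m' = wt (\<lambda>_. 1) m1" "wt weight m1 < wt weight m'"
        using lead_tail[OF lead m'[unfolded T_def]] by auto
      show kL: "keys (m' + m2) \<subseteq> L" using TL m' m2L by (auto simp: polys_def keys_plus_nat)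
      have "wt weight (m' + m2) \<le> (Suc k * Suc l) * wt (\<lambda>_. 1) (m' + m2)"
      proof (rule wt_le)
        fix x assume "x \<in> keys (m' + m2)"
        then have "fst x \<le> k" "snd x \<le> l" using kL L_bounds[of x] by blast+
        then show "weight x \<le> Suc k * Suc l * 1" unfolding weight_def by (simp only: mult_1_right) (intro mult_le_mono, auto)
      qed
      then show "(Suc k * Suc l) * wt (\<lambda>_. 1) (m' + m2) - wt weight (m' + m2) < (Suc k * Suc l) * wt (\<lambda>_. 1) m - wt weight m"
        unfolding m wt_plus tail(1) using tail(2) by simp
    qed
    \<comment> \<open>The monomial of \<open>m\<close> is that of \<open>m2\<close> times the minor,
      minus that of \<open>m2\<close> times the heavier tail \<open>T\<close>.\<close>
    have "reducible K (Const (- 1) * (T * single m2 1))"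
      by (intro reducible_scale reducible_expand K Q1)
    moreover have "reducible K (single m2 1 * ?M)"
      using K polys_single[OF m2L, of "1::'k"] minK by (auto intro!: reducible_in simp: sub_ideal_def)
    ultimately have "reducible K (Const (- 1) * (T * single m2 1) + single m2 1 * ?M)"
      by (rule reducible_add[OF K])
    also have "Const (- 1) * (T * single m2 1) + single m2 1 * ?M = single m 1"
      unfolding T_def m by (simp add: algebra_simps mult_single single_uminus)
    finally show ?thesis .
  qed
qed

text \<open>Modulo \<open>K\<close>, which lies in the kernel, F becomes a combination G of standard
  monomials. Then G is in the kernel as well, so G = 0.\<close>

lemma kernel_subset:
  fixes K :: "'k::comm_ring_1 mat_poly set"
  assumes K: "sub_ideal K"
    and Kminor: "\<And>h r s. h \<in> {1..v} \<Longrightarrow> strict_mono_on {..<t h} r \<Longrightarrow> (\<And>a b. a < b \<Longrightarrow> b < t h \<Longrightarrow> s b < s a) \<Longrightarrow>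
      (\<And>a b. a < t h \<Longrightarrow> b < t h \<Longrightarrow> (r a, s b) \<in> region h) \<Longrightarrow> minor (t h) r s \<in> K"
    and Kker: "\<And>f. f \<in> K \<Longrightarrow> psi f = 0"
    and F: "F \<in> polys L" "psi F = 0"
  shows "F \<in> K"
proof -
  interpret comm_ring_hom "psi :: 'k mat_poly \<Rightarrow> _" unfolding psi_def by (rule subst_hom)
  have "reducible K (F * single 0 1)"
    by (rule reducible_expand[OF K]) (use F(1) in \<open>auto intro!: reduce_monomial[OF K Kminor] simp: polys_def\<close>)
  then obtain G where G: "G \<in> polys L" "\<forall>m'\<in>keys G. standard (keys m')" "F - G \<in> K"
    unfolding reducible_def by auto
  have "psi F = psi (F - G) + psi G" by (simp flip: hom_add)
  then have "psi G = 0" using F Kker[OF G(3)] by simp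
  then have "G = 0" using psi_nonzero_standard[OF G(1)] G(2) by blast
  then show ?thesis using G by simp
qed

end

section \<open>Local generators\<close>

text \<open>A Schur complement with the denominator cleared by the adjugate. Multiplication on the
  right by a block triangular matrix of determinant (det E)^m removes the lower left block; no
  invertibility of \<open>E\<close> is involved.\<close>

lemma det_block_reduction:
  fixes E :: "'a::idom mat"
  assumes A: "A \<in> carrier_mat m m" and B: "B \<in> carrier_mat m q" and C: "C \<in> carrier_mat q m" and E: "E \<in> carrier_mat q q"
  shows "det (four_block_mat A B C E) * det E ^ m = det (det E \<cdot>\<^sub>m A - B * adj_mat E * C) * det E"
proof -
  let ?X = "four_block_mat (det E \<cdot>\<^sub>m 1\<^sub>m m) (0\<^sub>m m q) (- (adj_mat E * C)) (1\<^sub>m q)"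
  have aE: "adj_mat E \<in> carrier_mat q q" "E * adj_mat E = det E \<cdot>\<^sub>m 1\<^sub>m q" using adj_mat[OF E] by auto
  have M: "four_block_mat A B C E \<in> carrier_mat (m + q) (m + q)" using A E by auto
  have X: "?X \<in> carrier_mat (m + q) (m + q)" by auto
  have "four_block_mat A B C E * ?X = four_block_mat
      (A * (det E \<cdot>\<^sub>m 1\<^sub>m m) + B * (- (adj_mat E * C))) (A * 0\<^sub>m m q + B * 1\<^sub>m q)
      (C * (det E \<cdot>\<^sub>m 1\<^sub>m m) + E * (- (adj_mat E * C))) (C * 0\<^sub>m m q + E * 1\<^sub>m q)"
    by (rule mult_four_block_mat[of _ m m _ q _ q _ _ m _ q]) (use A B C E aE in auto)
  also have "A * (det E \<cdot>\<^sub>m 1\<^sub>m m) + B * (- (adj_mat E * C)) = det E \<cdot>\<^sub>m A - B * adj_mat E * C"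
  proof -
    have "A * (det E \<cdot>\<^sub>m 1\<^sub>m m) = det E \<cdot>\<^sub>m A"
      using mult_smult_distrib[of A m m "1\<^sub>m m" m "det E"] A by simp
    moreover have "B * (- (adj_mat E * C)) = - (B * adj_mat E * C)"
      using uminus_mult_right_mat[of B "adj_mat E * C"] assoc_mult_mat[OF B aE(1) C] B C aE by auto
    ultimately show ?thesis
      using A B C aE by (auto intro!: eq_matI)
  qed
  also have "A * 0\<^sub>m m q + B * 1\<^sub>m q = B" using A B by simp
  also have "C * (det E \<cdot>\<^sub>m 1\<^sub>m m) + E * (- (adj_mat E * C)) = 0\<^sub>m q m"
  proof -
    have "C * (det E \<cdot>\<^sub>m 1\<^sub>m m) = det E \<cdot>\<^sub>m C"
      using mult_smult_distrib[of C q m "1\<^sub>m m" m "det E"] C by simp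
    moreover have "E * (adj_mat E * C) = det E \<cdot>\<^sub>m C"
      using assoc_mult_mat[OF E aE(1) C] aE C by (simp add: mult_smult_assoc_mat[of _ q q])
    then have "E * (- (adj_mat E * C)) = - (det E \<cdot>\<^sub>m C)"
      using uminus_mult_right_mat[of E "adj_mat E * C"] E C aE by auto
    ultimately show ?thesis using C by (auto intro!: eq_matI)
  qed
  also have "C * 0\<^sub>m m q + E * 1\<^sub>m q = E" using C E by simp
  finally have MX: "four_block_mat A B C E * ?X = four_block_mat (det E \<cdot>\<^sub>m A - B * adj_mat E * C) B (0\<^sub>m q m) E" .
  have "det ?X = det (det E \<cdot>\<^sub>m 1\<^sub>m m) * det (1\<^sub>m q :: 'a mat)"
    by (rule det_four_block_mat_upper_right_zero[of _ m _ q]) (use aE C in auto)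
  then have dX: "det ?X = det E ^ m" by simp
  have "det (four_block_mat A B C E) * det ?X = det (four_block_mat A B C E * ?X)"
    using det_mult[OF M X] by simp
  also have "\<dots> = det (det E \<cdot>\<^sub>m A - B * adj_mat E * C) * det E"
    unfolding MX by (rule det_four_block_mat_lower_left_zero[of _ m _ q]) (use A B C E aE in auto)
  finally show ?thesis unfolding dX .
qed

lemma minor_four_block:
  "minor (m + q) r s = det (four_block_mat
     (mat m m (\<lambda>(a, b). Var (r a, s b))) (mat m q (\<lambda>(a, b). Var (r a, s (m + b))))
     (mat q m (\<lambda>(a, b). Var (r (m + a), s b))) (mat q q (\<lambda>(a, b). Var (r (m + a), s (m + b)))))"
  unfolding minor_def by (rule arg_cong[where f = det], rule eq_matI) auto

text \<open>Sylvester's identity, with a factor \<open>\<delta>\<close> left on both sides of each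
  equation so that nothing is divided by a possibly vanishing pivot.\<close>

lemma minor_bordered:
  fixes r s :: "nat \<Rightarrow> nat" and m q :: nat
  defines "\<delta> \<equiv> minor q (\<lambda>a. r (m + a)) (\<lambda>b. s (m + b)) :: 'k::field mat_poly"
  shows "\<exists>N\<in>carrier_mat m m. minor (m + q) r s * \<delta> ^ m = det N * \<delta> \<and>
    (\<forall>i<m. \<forall>j<m. N $$ (i, j) * \<delta> =
       minor (Suc q) (\<lambda>a. if a = 0 then r i else r (m + (a - 1))) (\<lambda>b. if b = 0 then s j else s (m + (b - 1))) * \<delta>)"
proof -
  define E where "E = mat q q (\<lambda>(a, b). Var (r (m + a), s (m + b)) :: 'k mat_poly)"
  define A where "A = mat m m (\<lambda>(a, b). Var (r a, s b) :: 'k mat_poly)"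
  define B where "B = mat m q (\<lambda>(a, b). Var (r a, s (m + b)) :: 'k mat_poly)"
  define C where "C = mat q m (\<lambda>(a, b). Var (r (m + a), s b) :: 'k mat_poly)"
  define N where "N = det E \<cdot>\<^sub>m A - B * adj_mat E * C"
  have \<delta>: "\<delta> = det E" by (simp add: \<delta>_def E_def minor_def)
  have car: "A \<in> carrier_mat m m" "B \<in> carrier_mat m q" "C \<in> carrier_mat q m" "E \<in> carrier_mat q q"
    by (auto simp: A_def B_def C_def E_def)
  have aE: "adj_mat E \<in> carrier_mat q q" using adj_mat[OF car(4)] by auto
  have N: "N \<in> carrier_mat m m" unfolding N_def using car aE by auto
  have "minor (m + q) r s * \<delta> ^ m = det N * \<delta>"
    unfolding \<delta> N_def minor_four_block A_def[symmetric] B_def[symmetric] C_def[symmetric] E_def[symmetric]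
    by (rule det_block_reduction[OF car])
  moreover have "N $$ (i, j) * \<delta> =
       minor (Suc q) (\<lambda>a. if a = 0 then r i else r (m + (a - 1))) (\<lambda>b. if b = 0 then s j else s (m + (b - 1))) * \<delta>"
    if ij: "i < m" "j < m" for i j
  proof -
    let ?r = "\<lambda>a. if a = 0 then r i else r (m + (a - 1))" and ?s = "\<lambda>b. if b = 0 then s j else s (m + (b - 1))"
    define A' where "A' = mat 1 1 (\<lambda>(a, b). Var (?r a, ?s b) :: 'k mat_poly)"
    define B' where "B' = mat 1 q (\<lambda>(a, b). Var (?r a, ?s (1 + b)) :: 'k mat_poly)"
    define C' where "C' = mat q 1 (\<lambda>(a, b). Var (?r (1 + a), ?s b) :: 'k mat_poly)"
    define N' where "N' = det E \<cdot>\<^sub>m A' - B' * adj_mat E * C'"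
    have car': "A' \<in> carrier_mat 1 1" "B' \<in> carrier_mat 1 q" "C' \<in> carrier_mat q 1"
      by (auto simp: A'_def B'_def C'_def)
    have E': "E = mat q q (\<lambda>(a, b). Var (?r (1 + a), ?s (1 + b)))" by (simp add: E_def)
    \<comment> \<open>The same reduction with a border of size one identifies the entries of
      \<open>N\<close>: entry (i, j) of the Schur complement only depends on row i, column j and the
      pivot block.\<close>
    have "minor (1 + q) ?r ?s * det E ^ 1 = det N' * det E"
      unfolding minor_four_block A'_def[symmetric] B'_def[symmetric] C'_def[symmetric] E'[symmetric] N'_def
      by (rule det_block_reduction[OF car' car(4)])
    moreover have "N' \<in> carrier_mat 1 1" unfolding N'_def using car' aE by auto
    then have "det N' = N' $$ (0, 0)" by (rule det_single)
    moreover have "N' $$ (0, 0) = N $$ (i, j)"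
    proof -
      have rows: "row B' 0 = row B i" and cols: "col C' 0 = col C j"
        using ij by (auto intro!: eq_vecI simp: B_def B'_def C_def C'_def)
      have "row (B' * adj_mat E) 0 = row (B * adj_mat E) i"
        using rows ij car car' aE by (auto intro!: eq_vecI)
      moreover have "(B' * adj_mat E * C') $$ (0, 0) = row (B' * adj_mat E) 0 \<bullet> col C' 0"
        by (rule index_mult_mat(1)) (use car' aE in auto)
      moreover have "(B * adj_mat E * C) $$ (i, j) = row (B * adj_mat E) i \<bullet> col C j"
        by (rule index_mult_mat(1)) (use ij car aE in auto)
      ultimately have "(B' * adj_mat E * C') $$ (0, 0) = (B * adj_mat E * C) $$ (i, j)"
        using cols by simp
      then show ?thesis using ij car car' aE by (simp add: N_def N'_def A_def A'_def)
    qed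
    ultimately show ?thesis by (auto simp: \<delta>)
  qed
  ultimately show ?thesis using N by blast
qed

context mixed_ladder
begin

definition ker :: "'k::field mat_poly set" where
  "ker = {F \<in> polys L. psi F = 0}"

lemma psi_hom: "comm_ring_hom (psi :: 'k::field mat_poly \<Rightarrow> _)"
  unfolding psi_def by (rule subst_hom)

lemma psi_mult: "psi (f * g) = psi f * psi (g :: 'k::field mat_poly)"
  and psi_add: "psi (f + g) = psi f + psi g" and psi_one: "psi (1 :: 'k mat_poly) = 1"
  and psi_zero: "psi (0 :: 'k mat_poly) = 0" and psi_uminus: "psi (- f) = - psi f"
  and psi_power: "psi (f ^ n) = psi f ^ n"
proof -
  interpret comm_ring_hom "psi :: 'k mat_poly \<Rightarrow> _" by (rule psi_hom)
  show "psi (f * g) = psi f * psi g" "psi (f + g) = psi f + psi g" "psi (1 :: 'k mat_poly) = 1"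
    "psi (0 :: 'k mat_poly) = 0" "psi (- f) = - psi f" "psi (f ^ n) = psi f ^ n"
    by (simp_all add: hom_distribs)
qed

text \<open>A contiguous square of size t h with north-east end \<open>x\<close> does not pass below
  row d h or to the left of column c h; the conditions are written without subtraction.
  \<open>H\<close> collects the special entries.\<close>

definition in_H :: "nat \<Rightarrow> nat \<times> nat \<Rightarrow> bool" where
  "in_H h x \<longleftrightarrow> fst x + t h \<le> d h + 1 \<and> c h + t h \<le> snd x + 1"

definition H :: "(nat \<times> nat) set" where
  "H = {x \<in> L. \<exists>h\<in>{1..v}. in_H h x}"

lemma sorted_ne_distinct: "sorted_wrt ne xs \<Longrightarrow> distinct xs"
  by (induction xs) (auto simp: ne_def)

lemma sorted_ne_nth: "sorted_wrt ne xs \<Longrightarrow> a < length xs \<Longrightarrow>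
    fst (xs ! 0) + a \<le> fst (xs ! a) \<and> snd (xs ! a) + a \<le> snd (xs ! 0)"
proof (induction a)
  case (Suc a)
  then have "ne (xs ! a) (xs ! Suc a)" by (intro sorted_wrt_nth_less) auto
  with Suc show ?case by (auto simp: ne_def)
qed simp

text \<open>The t h-th entry of a too long chain is still in the region and lies at least t h - 1
  rows below and t h - 1 columns to the left of the first entry, which is therefore special.\<close>

lemma not_standardE:
  assumes "\<not> standard S"
  obtains h xs where "h \<in> {1..v}" "sorted_wrt ne xs" "set xs \<subseteq> S \<inter> region h" "t h \<le> length xs" "in_H h (xs ! 0)" "xs ! 0 \<in> S"
proof -
  obtain h xs where h: "h \<in> {1..v}" "sorted_wrt ne xs" "set xs \<subseteq> S \<inter> region h" "t h \<le> length xs"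
    using assms unfolding standard_def by force
  have t: "t h - 1 < length xs" "0 < t h" using h t_pos[OF h(1)] by auto
  have "xs ! (t h - 1) \<in> region h" using h(3) t by auto
  moreover have "fst (xs ! 0) + (t h - 1) \<le> fst (xs ! (t h - 1)) \<and> snd (xs ! (t h - 1)) + (t h - 1) \<le> snd (xs ! 0)"
    by (rule sorted_ne_nth[OF h(2) t(1)])
  ultimately have "in_H h (xs ! 0)" using t(2) by (auto simp: in_H_def region_def)
  moreover have "xs ! 0 \<in> S" using h(3) t by (metis Int_iff length_greater_0_conv less_nat_zero_code list.size(3) nth_mem subsetD)
  ultimately show ?thesis using that h by blast
qed

lemma standard_off_H:
  assumes "S \<subseteq> L - H"
  shows "standard S"
proof (rule ccontr)
  assume "\<not> standard S"
  then obtain h xs where "h \<in> {1..v}" "in_H h (xs ! 0)" "xs ! 0 \<in> S" by (rule not_standardE)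
  then show False using assms unfolding H_def by blast
qed

lemma in_H_ne: "in_H h y \<Longrightarrow> fst x \<le> fst y \<Longrightarrow> snd y \<le> snd x \<Longrightarrow> in_H h x"
  by (auto simp: in_H_def)

text \<open>Minimality of the size is what makes the antidiagonal of the minor \<open>del x\<close> below standard.\<close>

definition hx :: "nat \<times> nat \<Rightarrow> nat" where
  "hx x = arg_min t (\<lambda>h. h \<in> {1..v} \<and> in_H h x)"

lemma hx:
  assumes "x \<in> H"
  shows "hx x \<in> {1..v}" "in_H (hx x) x" "\<And>h. h \<in> {1..v} \<Longrightarrow> in_H h x \<Longrightarrow> t (hx x) \<le> t h"
proof -
  obtain h where "h \<in> {1..v} \<and> in_H h x" using assms by (auto simp: H_def)
  from arg_min_nat_lemma[of "\<lambda>h. h \<in> {1..v} \<and> in_H h x", OF this, of t]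
  show "hx x \<in> {1..v}" "in_H (hx x) x" "\<And>h. h \<in> {1..v} \<Longrightarrow> in_H h x \<Longrightarrow> t (hx x) \<le> t h"
    unfolding hx_def by blast+
qed

text \<open>The corner of region h lies in L, so the ladder contains the whole rectangle between
  \<open>x\<close> and that corner.\<close>

lemma block_region:
  assumes h: "h \<in> {1..v}" and x: "x \<in> L" and y: "fst x \<le> fst y" "fst y \<le> d h" "c h \<le> snd y" "snd y \<le> snd x"
  shows "y \<in> region h"
  using L_rect[of "fst x" "snd x" "d h" "c h" "fst y" "snd y"] corner[OF h] x y by (simp add: region_def)

text \<open>\<open>gen x\<close> and \<open>del x\<close> are the minor attached to \<open>x\<close>
  and the cofactor of \<open>x\<close> in it. Columns run to the left, and for special
  \<open>x\<close> the subtractions are not truncated, by \<open>block_bounds\<close>.\<close>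

definition gen :: "nat \<times> nat \<Rightarrow> 'k::field mat_poly" where
  "gen x = minor (t (hx x)) (\<lambda>a. fst x + a) (\<lambda>b. snd x - b)"

definition del :: "nat \<times> nat \<Rightarrow> 'k::field mat_poly" where
  "del x = minor (t (hx x) - 1) (\<lambda>a. fst x + 1 + a) (\<lambda>b. snd x - 1 - b)"

definition block :: "nat \<times> nat \<Rightarrow> (nat \<times> nat) set" where
  "block x = {(fst x + a, snd x - b) | a b. a < t (hx x) \<and> b < t (hx x)}"

lemma block_bounds:
  assumes x: "x \<in> H" and b: "b < t (hx x)"
  shows "b < snd x"
  using hx(2)[OF x] b L_bounds[OF corner[OF hx(1)[OF x]]] by (auto simp: in_H_def)

lemma block_subset_region:
  assumes x: "x \<in> H"
  shows "block x \<subseteq> region (hx x)"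
proof
  fix y assume "y \<in> block x"
  then obtain a b where y: "y = (fst x + a, snd x - b)" "a < t (hx x)" "b < t (hx x)" by (auto simp: block_def)
  show "y \<in> region (hx x)"
    using hx(2)[OF x] x y by (intro block_region[OF hx(1)[OF x], of x]) (auto simp: in_H_def H_def)
qed

lemma region_L: "region h \<subseteq> L" by (auto simp: region_def)

lemma gen_in_ker: "x \<in> H \<Longrightarrow> gen x \<in> ker"
proof -
  assume x: "x \<in> H"
  have e: "(fst x + a, snd x - b) \<in> region (hx x)" if "a < t (hx x)" "b < t (hx x)" for a b
    using block_subset_region[OF x] that by (auto simp: block_def)
  have "gen x \<in> polys L"
    unfolding gen_def by (rule minor_polys) (rule subsetD[OF region_L e])
  moreover have "psi (gen x) = 0"
    unfolding gen_def by (rule psi_minor[OF hx(1)[OF x] order_refl e])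
  ultimately show ?thesis by (simp add: ker_def)
qed

lemma block_diff_memI:
  assumes x: "x \<in> H" and ab: "a < t (hx x)" "b < t (hx x)" and ne: "a \<noteq> 0 \<or> b \<noteq> 0"
  shows "(fst x + a, snd x - b) \<in> block x - {x}"
proof
  show "(fst x + a, snd x - b) \<in> block x" unfolding block_def using ab by blast
  show "(fst x + a, snd x - b) \<notin> {x}" using block_bounds[OF x ab(2)] ne by (cases x) auto
qed

lemma del_polys: "x \<in> H \<Longrightarrow> del x \<in> polys (block x - {x})"
  unfolding del_def
proof (rule minor_polys)
  fix a b assume x: "x \<in> H" and ab: "a < t (hx x) - 1" "b < t (hx x) - 1"
  then have "(fst x + 1 + a, snd x - 1 - b) = (fst x + Suc a, snd x - Suc b)" by simp
  also have "\<dots> \<in> block x - {x}" by (rule block_diff_memI[OF x]) (use ab in auto)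
  finally show "(fst x + 1 + a, snd x - 1 - b) \<in> block x - {x}" .
qed

text \<open>A chain of length t h on this antidiagonal would start at an entry with
  \<open>in_H h\<close> to the south-west of \<open>x\<close>. Then \<open>in_H h x\<close>, so t h
  \<ge> t (hx x) by minimality, but only t (hx x) - 1 entries are available.\<close>

lemma del_nonzero:
  assumes x: "x \<in> H"
  shows "psi (del x :: 'k::field mat_poly) \<noteq> 0"
proof (rule psi_nonzero_lead)
  let ?n = "t (hx x) - 1"
  let ?m = "mon (map (\<lambda>a. (fst x + 1 + a, snd x - 1 - a)) [0..<?n])"
  show "del x \<in> polys L"
    using del_polys[OF x] polys_mono[of "block x - {x}" L] block_subset_region[OF x] region_L by blast
  show "lead (del x :: 'k mat_poly) ?m"
    unfolding del_def
  proof (rule lead_minor)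
    show "snd x - 1 - b < snd x - 1 - a" if "a < b" "b < ?n" for a b
    proof -
      have "Suc b < snd x" by (rule block_bounds[OF x]) (use that in simp)
      then show ?thesis using that by simp
    qed
  qed (simp add: strict_mono_on_def)
  show "standard (keys ?m)"
  proof (rule ccontr)
    assume "\<not> ?thesis"
    then obtain h xs where h: "h \<in> {1..v}" "sorted_wrt ne xs" "set xs \<subseteq> keys ?m \<inter> region h" "t h \<le> length xs"
      "in_H h (xs ! 0)" "xs ! 0 \<in> keys ?m" by (rule not_standardE)
    obtain a where a: "xs ! 0 = (fst x + 1 + a, snd x - 1 - a)" using h(6) by (auto simp: keys_mon)
    have "in_H h x" by (rule in_H_ne[OF h(5)]) (use a in auto)
    then have "t (hx x) \<le> t h" using hx(3)[OF x h(1)] by blast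
    moreover have "distinct xs"
      using h(2) by (rule sorted_ne_distinct)
    then have "length xs = card (set xs)" by (simp add: distinct_card)
    moreover have "card (set xs) \<le> card (set (map (\<lambda>a. (fst x + 1 + a, snd x - 1 - a)) [0..<?n]))"
      using h(3) by (intro card_mono) (auto simp: keys_mon)
    moreover have "\<dots> \<le> ?n" using card_length[of "map (\<lambda>a. (fst x + 1 + a, snd x - 1 - a)) [0..<?n]"] by simp
    ultimately show False using h(4) t_pos[OF hx(1)[OF x]] by linarith
  qed
qed

text \<open>Laplace expansion along the first row, where \<open>x\<close> stands in the first
  position and so has a positive sign.\<close>

lemma gen_expand:
  assumes x: "x \<in> H"
  shows "\<exists>z\<in>polys (block x - {x}). gen x = Var x * del x + (z :: 'k::field mat_poly)"
proof -
  define n where "n = t (hx x)"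
  have n: "0 < n" using t_pos[OF hx(1)[OF x]] by (simp add: n_def)
  define A where "A = mat n n (\<lambda>(a, b). Var (fst x + a, snd x - b) :: 'k mat_poly)"
  have A: "A \<in> carrier_mat n n" by (simp add: A_def)
  have dl: "mat_delete A 0 j $$ (a, b) = A $$ (Suc a, if b < j then b else Suc b)" if "a < n - 1" "b < n - 1" for a b j
    using that by (simp add: mat_delete_def A_def)
  have d: "det (mat_delete A 0 j) \<in> polys (block x - {x})" if j: "j < n" for j
  proof (rule polys_det)
    show "mat_delete A 0 j \<in> carrier_mat (n - 1) (n - 1)" using A by (rule mat_delete_carrier)
    show "mat_delete A 0 j $$ (a, b) \<in> polys (block x - {x})" if "a < n - 1" "b < n - 1" for a b
    proof -
      define b' where "b' = (if b < j then b else Suc b)"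
      have "b' < n" using that j by (auto simp: b'_def)
      then have "(fst x + Suc a, snd x - b') \<in> block x - {x}"
        using that by (intro block_diff_memI[OF x]) (auto simp: n_def)
      then have "Var (fst x + Suc a, snd x - b') \<in> polys (block x - {x})" by (rule polys_Var)
      moreover have "A $$ (Suc a, b') = Var (fst x + Suc a, snd x - b')"
        using that \<open>b' < n\<close> by (simp add: A_def)
      ultimately show ?thesis using dl[OF that, of j] by (simp add: b'_def)
    qed
  qed
  have d0: "det (mat_delete A 0 0) = del x"
    unfolding del_def minor_def n_def[symmetric]
    by (rule arg_cong[where f = det], rule eq_matI) (auto simp: dl, auto simp: A_def)
  let ?z = "\<Sum>j\<in>{..<n} - {0}. A $$ (0, j) * cofactor A 0 j"
  have "gen x = (\<Sum>j<n. A $$ (0, j) * cofactor A 0 j)"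
    unfolding gen_def minor_def n_def[symmetric] A_def[symmetric] by (rule laplace_expansion_row[OF A n])
  also have "\<dots> = A $$ (0, 0) * cofactor A 0 0 + ?z"
    using n by (intro sum.remove) auto
  also have "A $$ (0, 0) * cofactor A 0 0 = Var x * del x"
    using n by (simp add: cofactor_def d0) (simp add: A_def)
  finally have "gen x = Var x * del x + ?z" .
  moreover have "?z \<in> polys (block x - {x})"
  proof (rule polys_sum, rule polys_mult)
    fix j assume j: "j \<in> {..<n} - {0}"
    have "(fst x + 0, snd x - j) \<in> block x - {x}"
      using j n by (intro block_diff_memI[OF x]) (auto simp: n_def)
    then show "A $$ (0, j) \<in> polys (block x - {x})" using j n by (simp add: A_def)
    have "((- 1) ^ (0 + j) :: 'k mat_poly) \<in> polys (block x - {x})"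
      by (intro polys_power polys_uminus polys_1)
    then show "cofactor A 0 j \<in> polys (block x - {x})"
      unfolding cofactor_def using d[of j] j by (intro polys_mult) auto
  qed
  ultimately show ?thesis by blast
qed

section \<open>Elimination of the special entries\<close>

definition gen_span :: "'k::field mat_poly set" where
  "gen_span = {\<Sum>x\<in>H. q x * gen x | q. \<forall>x\<in>H. q x \<in> polys L}"

lemma finite_H: "finite H"
  using finite_L by (rule rev_finite_subset) (auto simp: H_def)

lemma gen_span_gen: "x \<in> H \<Longrightarrow> gen x \<in> gen_span"
  unfolding gen_span_def using finite_H
  by (intro CollectI exI[of _ "\<lambda>y. if y = x then 1 else 0"]) (auto simp: if_distrib[of "\<lambda>u. u * _"] cong: if_cong)

lemma gen_span_zero: "0 \<in> gen_span"
  unfolding gen_span_def by (intro CollectI exI[of _ "\<lambda>_. 0"]) auto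

lemma gen_span_add: "f \<in> gen_span \<Longrightarrow> g \<in> gen_span \<Longrightarrow> f + g \<in> gen_span"
proof -
  assume "f \<in> gen_span" "g \<in> gen_span"
  then obtain q q' where "f = (\<Sum>x\<in>H. q x * gen x)" "\<forall>x\<in>H. q x \<in> polys L" "g = (\<Sum>x\<in>H. q' x * gen x)" "\<forall>x\<in>H. q' x \<in> polys L"
    unfolding gen_span_def by blast
  then show ?thesis
    unfolding gen_span_def by (intro CollectI exI[of _ "\<lambda>x. q x + q' x"]) (auto simp: distrib_right sum.distrib intro: polys_add)
qed

lemma gen_span_mult: "f \<in> polys L \<Longrightarrow> g \<in> gen_span \<Longrightarrow> f * g \<in> gen_span"
proof -
  assume f: "f \<in> polys L" and "g \<in> gen_span"
  then obtain q where "g = (\<Sum>x\<in>H. q x * gen x)" "\<forall>x\<in>H. q x \<in> polys L"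
    unfolding gen_span_def by blast
  then show ?thesis
    using f unfolding gen_span_def
    by (intro CollectI exI[of _ "\<lambda>x. f * q x"]) (auto simp: sum_distrib_left mult.assoc intro: polys_mult)
qed

lemma gen_span_psi: "f \<in> gen_span \<Longrightarrow> psi f = 0"
proof -
  assume "f \<in> gen_span"
  then obtain q where q: "f = (\<Sum>x\<in>H. q x * gen x)" unfolding gen_span_def by blast
  have "psi (\<Sum>x\<in>S. q x * gen x) = 0" if "S \<subseteq> H" for S
    using that by (induction S rule: infinite_finite_induct)
      (use gen_in_ker in \<open>auto simp: psi_zero psi_add psi_mult ker_def\<close>)
  then show ?thesis using q by blast
qed

text \<open>The special entries are eliminated from the north-east to the south-west, that is, by increasing
  \<open>i - j\<close>, which is shifted by \<open>l\<close> to make it a natural number.\<close>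

definition remaining :: "nat \<Rightarrow> (nat \<times> nat) set" where
  "remaining q = {x \<in> L. x \<notin> H \<or> q \<le> fst x + (l - snd x)}"

lemma remaining_L: "remaining q \<subseteq> L"
  by (auto simp: remaining_def)

text \<open>Moving south or west raises i - j strictly. Solving for a special entry thus never
  brings back one of the same or an earlier stage.\<close>

lemma block_remaining:
  assumes x: "x \<in> H" and q: "q = fst x + (l - snd x)"
  shows "block x - {x} \<subseteq> remaining (Suc q)"
proof
  fix y assume y: "y \<in> block x - {x}"
  then obtain a b where ab: "y = (fst x + a, snd x - b)" "a < t (hx x)" "b < t (hx x)" by (auto simp: block_def)
  have yL: "y \<in> L" using y block_subset_region[OF x] region_L by blast
  have "b < snd x" by (rule block_bounds[OF x ab(3)])
  moreover have "a \<noteq> 0 \<or> b \<noteq> 0" using y ab(1) by (cases x) auto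
  moreover have "snd x \<le> l" using x L_bounds[of x] by (simp add: H_def)
  ultimately have "Suc q \<le> fst y + (l - snd y)" unfolding q ab(1) by auto
  then show "y \<in> remaining (Suc q)" using yL by (simp add: remaining_def)
qed

text \<open>For a special entry of the current stage, \<open>del x * Var x\<close> is congruent to a
  polynomial in later variables, with \<open>del x\<close> outside the kernel. Sums and products
  only require multiplying the denominators.\<close>

lemma eliminate_step:
  fixes F :: "'k::field mat_poly"
  assumes "F \<in> polys (remaining q)"
  shows "\<exists>s\<in>polys (remaining (Suc q)). \<exists>G\<in>polys (remaining (Suc q)). psi s \<noteq> 0 \<and> s * F - G \<in> gen_span"
  using assms
proof (induction F rule: polys_induct)
  case (Const a)
  show ?case using gen_span_zero by (intro bexI[of _ 1] bexI[of _ "Const a"]) (auto simp: psi_one)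
next
  case (Var x)
  show ?case
  proof (cases "x \<in> remaining (Suc q)")
    case True
    then show ?thesis using gen_span_zero by (intro bexI[of _ 1] bexI[of _ "Var x"]) (auto simp: psi_one)
  next
    case False
    with Var have x: "x \<in> H" "q = fst x + (l - snd x)" by (auto simp: remaining_def)
    obtain z :: "'k mat_poly" where z: "z \<in> polys (block x - {x})" "gen x = Var x * del x + z" using gen_expand[OF x(1)] by blast
    have sub: "polys (block x - {x}) \<subseteq> (polys (remaining (Suc q)) :: 'k mat_poly set)"
      by (intro polys_mono block_remaining x)
    have "del x * Var x - (- z) = gen x" by (simp add: z(2) mult.commute)
    then show ?thesis
      using sub del_polys[OF x(1)] del_nonzero[OF x(1)] gen_span_gen[OF x(1)] z(1)
      by (intro bexI[of _ "del x"] bexI[of _ "- z"]) (auto intro: polys_uminus)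
  qed
next
  case (add F1 F2)
  then obtain s1 G1 s2 G2 where 1: "s1 \<in> polys (remaining (Suc q))" "G1 \<in> polys (remaining (Suc q))" "psi s1 \<noteq> 0" "s1 * F1 - G1 \<in> gen_span"
    and 2: "s2 \<in> polys (remaining (Suc q))" "G2 \<in> polys (remaining (Suc q))" "psi s2 \<noteq> 0" "s2 * F2 - G2 \<in> gen_span"
    by blast
  have L: "s1 \<in> polys L" "s2 \<in> polys L" using 1 2 polys_mono[OF remaining_L[of "Suc q"]] by blast+
  have "s1 * s2 * (F1 + F2) - (s2 * G1 + s1 * G2) = s2 * (s1 * F1 - G1) + s1 * (s2 * F2 - G2)"
    by (simp add: algebra_simps)
  also have "\<dots> \<in> gen_span" using 1 2 L by (intro gen_span_add gen_span_mult)
  finally show ?case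
    using 1 2 by (intro bexI[of _ "s1 * s2"] bexI[of _ "s2 * G1 + s1 * G2"]) (auto simp: psi_mult intro!: polys_mult polys_add)
next
  case (mult F1 F2)
  then obtain s1 G1 s2 G2 where 1: "s1 \<in> polys (remaining (Suc q))" "G1 \<in> polys (remaining (Suc q))" "psi s1 \<noteq> 0" "s1 * F1 - G1 \<in> gen_span"
    and 2: "s2 \<in> polys (remaining (Suc q))" "G2 \<in> polys (remaining (Suc q))" "psi s2 \<noteq> 0" "s2 * F2 - G2 \<in> gen_span"
    by blast
  have L: "G1 \<in> polys L" "G2 \<in> polys L" using 1 2 polys_mono[OF remaining_L[of "Suc q"]] by blast+
  \<comment> \<open>The induction does not carry along that \<open>F2\<close> lies in
    \<open>polys L\<close>; membership of the difference is read off from \<open>gen_span\<close>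
    instead.\<close>
  have Q: "s2 * F2 - G2 \<in> polys L"
  proof -
    obtain q where "s2 * F2 - G2 = (\<Sum>x\<in>H. q x * gen x)" "\<forall>x\<in>H. q x \<in> polys L" using 2(4) unfolding gen_span_def by blast
    then show ?thesis using gen_in_ker by (auto intro!: polys_sum polys_mult simp: ker_def)
  qed
  have "s1 * s2 * (F1 * F2) - G1 * G2 = (s2 * F2 - G2) * (s1 * F1 - G1) + (G2 * (s1 * F1 - G1) + G1 * (s2 * F2 - G2))"
    by (simp add: algebra_simps)
  also have "\<dots> \<in> gen_span" using 1 2 L Q by (intro gen_span_add gen_span_mult)
  finally show ?case
    using 1 2 by (intro bexI[of _ "s1 * s2"] bexI[of _ "G1 * G2"]) (auto simp: psi_mult intro!: polys_mult)
qed

lemma eliminate: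
  fixes F :: "'k::field mat_poly"
  assumes F: "F \<in> polys L"
  shows "\<exists>s\<in>polys L. \<exists>G\<in>polys (remaining q). psi s \<noteq> 0 \<and> s * F - G \<in> gen_span"
proof (induction q)
  case 0
  have "remaining 0 = L" by (auto simp: remaining_def)
  then show ?case using F gen_span_zero by (intro bexI[of _ 1] bexI[of _ F]) (auto simp: psi_one)
next
  case (Suc q)
  then obtain s G where s: "s \<in> polys L" "G \<in> polys (remaining q)" "psi s \<noteq> 0" "s * F - G \<in> gen_span" by blast
  obtain s' G' where s': "s' \<in> polys (remaining (Suc q))" "G' \<in> polys (remaining (Suc q))" "psi s' \<noteq> 0" "s' * G - G' \<in> gen_span"
    using eliminate_step[OF s(2)] by blast
  have sL: "s' \<in> polys L" using s' polys_mono[OF remaining_L[of "Suc q"]] by blast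
  have "s' * s * F - G' = s' * (s * F - G) + (s' * G - G')" by (simp add: algebra_simps)
  also have "\<dots> \<in> gen_span" using s s' sL by (intro gen_span_add gen_span_mult)
  finally show ?case
    using s s' sL by (intro bexI[of _ "s' * s"] bexI[of _ G']) (auto simp: psi_mult intro!: polys_mult)
qed

lemma ker_locally_generated:
  fixes F :: "'k::field mat_poly"
  assumes F: "F \<in> ker"
  shows "\<exists>s\<in>polys L. psi s \<noteq> 0 \<and> s * F \<in> gen_span"
proof -
  have F': "F \<in> polys L" "psi F = 0" using F by (auto simp: ker_def)
  \<comment> \<open>As i + (l - j) \<le> k + l on L, no special entry is left at this stage, so all
    terms of \<open>G\<close> are standard.\<close>
  obtain s G where s: "s \<in> polys L" "G \<in> polys (remaining (Suc (k + l)))" "psi s \<noteq> 0" "s * F - G \<in> gen_span"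
    using eliminate[OF F'(1)] by blast
  have rem: "remaining (Suc (k + l)) \<subseteq> L - H"
  proof
    fix x assume x: "x \<in> remaining (Suc (k + l))"
    then have "x \<in> L" "fst x \<le> k" using L_bounds[of x] by (auto simp: remaining_def)
    then show "x \<in> L - H" using x by (auto simp: remaining_def)
  qed
  have "psi (s * F) = psi (s * F - G) + psi G" by (simp flip: psi_add)
  then have "psi G = 0" using gen_span_psi[OF s(4)] F'(2) by (simp add: psi_mult)
  moreover have "G \<in> polys L" using s(2) polys_mono[OF remaining_L] by blast
  moreover have "standard (keys m)" if "m \<in> keys G" for m
    using s(2) that rem by (intro standard_off_H) (auto simp: polys_def)
  ultimately have "G = 0" using psi_nonzero_standard[of G] by blast
  then show ?thesis using s by auto
qed

end

section \<open>Splittings compatible with symbolic powers\<close>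

locale ideal_powers =
  fixes A :: "'a :: comm_ring_1 set" and I :: "'a set"
  assumes A1: "1 \<in> A" and Aadd: "\<And>x y. x \<in> A \<Longrightarrow> y \<in> A \<Longrightarrow> x + y \<in> A"
    and Amult: "\<And>x y. x \<in> A \<Longrightarrow> y \<in> A \<Longrightarrow> x * y \<in> A" and Auminus: "\<And>x. x \<in> A \<Longrightarrow> - x \<in> A"
    and IA: "I \<subseteq> A" and Izero: "0 \<in> I" and Iadd: "\<And>x y. x \<in> I \<Longrightarrow> y \<in> I \<Longrightarrow> x + y \<in> I"
    and Imult: "\<And>a x. a \<in> A \<Longrightarrow> x \<in> I \<Longrightarrow> a * x \<in> I"
begin

abbreviation R :: "'a ring" where "R \<equiv> ring_of_type_algebra\<lparr>carrier := A\<rparr>"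

primrec pw :: "nat \<Rightarrow> 'a set" where
  "pw 0 = A"
| "pw (Suc n) = ideal_prod R (pw n) I"

lemma pw_prodI: "x \<in> pw n \<Longrightarrow> y \<in> I \<Longrightarrow> x * y \<in> pw (Suc n)"
  using ideal_prod.prod[of x "pw n" y I R] by simp

lemma pw_add: "x \<in> pw n \<Longrightarrow> y \<in> pw n \<Longrightarrow> x + y \<in> pw n"
  using ideal_prod.sum[of x R _ I y] by (cases n) (simp_all add: Aadd)

lemma pw_induct [consumes 1, case_names prod add]:
  assumes "x \<in> pw (Suc n)" "\<And>i j. i \<in> pw n \<Longrightarrow> j \<in> I \<Longrightarrow> P (i * j)"
    "\<And>x y. x \<in> pw (Suc n) \<Longrightarrow> y \<in> pw (Suc n) \<Longrightarrow> P x \<Longrightarrow> P y \<Longrightarrow> P (x + y)"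
  shows "P x"
  using assms(1)[unfolded pw.simps]
  by (induction rule: ideal_prod.induct) (use assms(2,3) in auto)

lemma pw_zero: "0 \<in> pw n"
proof (induction n)
  case 0
  show ?case using Izero IA by auto
next
  case (Suc n)
  then show ?case using pw_prodI[OF Suc Izero] by simp
qed

lemma pw_A_mult: "a \<in> A \<Longrightarrow> x \<in> pw n \<Longrightarrow> a * x \<in> pw n"
proof (induction n arbitrary: x)
  case 0
  then show ?case by (simp add: Amult)
next
  case (Suc n)
  show ?case
    using Suc.prems(2)
  proof (induction rule: pw_induct)
    case (prod i j)
    then show ?case using pw_prodI[of "a * i" n j] Suc by (simp add: mult.assoc)
  next
    case (add x y)
    then show ?case by (simp add: distrib_left pw_add del: pw.simps)
  qed
qed

lemma pw_mult: "x \<in> pw m \<Longrightarrow> y \<in> pw n \<Longrightarrow> x * y \<in> pw (m + n)"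
proof (induction n arbitrary: y)
  case 0
  then show ?case using pw_A_mult[of y x m] by (simp add: mult.commute)
next
  case (Suc n)
  show ?case
    using Suc.prems(2)
  proof (induction rule: pw_induct)
    case (prod i j)
    then show ?case using pw_prodI[of "x * i" "m + n" j] Suc by (simp add: mult.assoc)
  next
    case (add y y')
    then show ?case using pw_add[of "x * y" "m + Suc n" "x * y'"] by (simp add: distrib_left)
  qed
qed

lemma pw_decr: "pw (Suc n) \<subseteq> pw n"
proof
  fix x assume "x \<in> pw (Suc n)"
  then show "x \<in> pw n"
  proof (induction rule: pw_induct)
    case (prod i j)
    then show ?case using pw_A_mult[of j i n] IA by (auto simp: mult.commute)
  next
    case (add x y)
    show ?case using add(3,4) by (rule pw_add)
  qed
qed

lemma pw_antimono: "m \<le> n \<Longrightarrow> pw n \<subseteq> pw m"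
  using lift_Suc_antimono_le[of pw m n] pw_decr by blast

lemma pw_1: "pw (Suc 0) = I"
proof (intro equalityI subsetI)
  fix x assume "x \<in> pw (Suc 0)"
  then show "x \<in> I" by (induction rule: pw_induct) (auto simp: Imult Iadd)
next
  fix x assume "x \<in> I"
  then show "x \<in> pw (Suc 0)" using pw_prodI[of 1 0 x] A1 by simp
qed

lemma pw_prod: "finite S \<Longrightarrow> (\<And>i. i \<in> S \<Longrightarrow> f i \<in> pw (e i)) \<Longrightarrow> prod f S \<in> pw (sum e S)"
  by (induction S rule: finite_induct) (auto simp: A1 intro: pw_mult)

lemma pw_power: "x \<in> pw m \<Longrightarrow> x ^ n \<in> pw (m * n)"
  using pw_prod[of "{..<n}" "\<lambda>_. x" "\<lambda>_. m"] by (simp add: mult.commute)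

lemma A_power: "x \<in> A \<Longrightarrow> x ^ n \<in> A"
  using pw_power[of x 0 n] by simp

lemma pw_sum: "(\<And>i. i \<in> S \<Longrightarrow> f i \<in> pw n) \<Longrightarrow> sum f S \<in> pw n"
  by (induction S rule: infinite_finite_induct) (auto simp: pw_zero intro: pw_add)

lemma pw_uminus: "x \<in> pw n \<Longrightarrow> - x \<in> pw n"
  using pw_A_mult[of "- 1" x n] Auminus[OF A1] by simp

lemma pw_det:
  assumes M: "M \<in> carrier_mat m m" and I: "\<And>i j. i < m \<Longrightarrow> j < m \<Longrightarrow> M $$ (i, j) \<in> I"
  shows "det M \<in> pw m"
  unfolding det_def'[OF M]
proof (rule pw_sum)
  fix q assume "q \<in> {q. q permutes {0..<m}}"
  then have "(\<Prod>i = 0..<m. M $$ (i, q i)) \<in> pw (\<Sum>i = 0..<m. Suc 0)"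
    by (intro pw_prod) (auto simp: pw_1 permutes_lt simp del: pw.simps intro!: I)
  then show "signof q * (\<Prod>i = 0..<m. M $$ (i, q i)) \<in> pw m"
    by (cases "evenperm q") (simp_all add: sign_def pw_uminus)
qed

lemma pw_eq_nat_pow: "I [^]\<^bsub>ideals_set R\<^esub> n = pw n"
  by (induction n) (simp_all add: ideals_set_def nat_pow_def)

end

text \<open>Locally at \<open>I\<close>, the ideal \<open>I\<close> is generated by \<open>card H\<close> elements and \<open>g\<close> lies in its \<open>card H\<close>-th power. By
  the pigeonhole principle, \<open>g\<^sup>p\<^sup>-\<^sup>1\<close> times the \<open>(n p + 1)\<close>-st power of \<open>I\<close> is locally contained in the ideal
  generated by the \<open>p\<close>-th powers of the products of \<open>n + 1\<close> generators.\<close>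

locale symbolic_splitting = ideal_powers A I
  for A :: "'a :: comm_ring_1 set" and I :: "'a set" +
  fixes H :: "'h set" and y :: "'h \<Rightarrow> 'a" and g :: 'a and \<Phi> :: "'a \<Rightarrow> 'a" and p :: nat
  assumes I_prime: "\<And>a b. a \<in> A \<Longrightarrow> b \<in> A \<Longrightarrow> a * b \<in> I \<Longrightarrow> a \<in> I \<or> b \<in> I" and I1: "1 \<notin> I"
    and finH: "finite H" and yI: "\<And>x. x \<in> H \<Longrightarrow> y x \<in> I"
    and gens: "\<And>F. F \<in> I \<Longrightarrow> \<exists>s\<in>A - I. \<exists>q. (\<forall>x\<in>H. q x \<in> A) \<and> s * F = (\<Sum>x\<in>H. q x * y x)"
    and gA: "g \<in> A" and g_pw: "\<exists>s\<in>A - I. s * g \<in> pw (card H)"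
    and prime_p: "Factorial_Ring.prime p" and p_CHAR: "p = CHAR('a)"
    and \<Phi>_closed: "\<And>x. x \<in> A \<Longrightarrow> \<Phi> x \<in> A"
    and \<Phi>_add: "\<And>x y. x \<in> A \<Longrightarrow> y \<in> A \<Longrightarrow> \<Phi> (x + y) = \<Phi> x + \<Phi> y"
    and \<Phi>_mult: "\<And>a x. a \<in> A \<Longrightarrow> x \<in> A \<Longrightarrow> \<Phi> (a ^ p * x) = a * \<Phi> x"
    and \<Phi>_g: "\<Phi> (g ^ (p - 1)) = 1"
begin

lemma complement_mult: "s \<in> A - I \<Longrightarrow> s' \<in> A - I \<Longrightarrow> s * s' \<in> A - I"
  using Amult I_prime by blast

lemma complement_power: "s \<in> A - I \<Longrightarrow> s ^ n \<in> A - I"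
  by (induction n) (simp_all only: power_0 power_Suc complement_mult, use A1 I1 in blast)

text \<open>The ideal generated by the monomials of degree \<open>q\<close> in the local generators.
  Elements of \<open>pw q\<close> get into it after multiplication by an element outside I.\<close>

inductive_set yspan :: "nat \<Rightarrow> 'a set" for q :: nat where
  zero: "0 \<in> yspan q"
| monomial: "r \<in> A \<Longrightarrow> sum \<alpha> H = q \<Longrightarrow> r * (\<Prod>x\<in>H. y x ^ \<alpha> x) \<in> yspan q"
| add: "u \<in> yspan q \<Longrightarrow> w \<in> yspan q \<Longrightarrow> u + w \<in> yspan q"

lemma yspan_A_mult:
  assumes "a \<in> A" "u \<in> yspan q"
  shows "a * u \<in> yspan q"
  using assms(2)
proof induction
  case (monomial r \<alpha>)
  then show ?case using yspan.monomial[of "a * r" \<alpha> q] assms(1) by (simp add: Amult mult.assoc)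
qed (auto simp: distrib_left intro: yspan.intros)

lemma yspan_mult:
  assumes "u \<in> yspan q" "w \<in> yspan q'"
  shows "u * w \<in> yspan (q + q')"
  using assms(1)
proof induction
  case (monomial r \<alpha>)
  show ?case
    using assms(2)
  proof induction
    case (monomial r' \<alpha>')
    have "r * r' * (\<Prod>x\<in>H. y x ^ (\<alpha> x + \<alpha>' x)) \<in> yspan (q + q')"
      by (rule yspan.monomial) (use monomial \<open>r \<in> A\<close> \<open>sum \<alpha> H = q\<close> in \<open>auto simp: Amult sum.distrib\<close>)
    then show ?case by (simp add: power_add prod.distrib mult_ac)
  qed (auto simp: distrib_left intro: yspan.intros)
qed (auto simp: distrib_right intro: yspan.intros)

lemma yspan_sum: "(\<And>i. i \<in> S \<Longrightarrow> f i \<in> yspan q) \<Longrightarrow> sum f S \<in> yspan q"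
  by (induction S rule: infinite_finite_induct) (auto intro: yspan.intros)

lemma yspan_1: "x \<in> H \<Longrightarrow> r \<in> A \<Longrightarrow> r * y x \<in> yspan 1"
proof -
  assume x: "x \<in> H" and r: "r \<in> A"
  have "r * (\<Prod>z\<in>H. y z ^ (if z = x then 1 else 0)) \<in> yspan 1"
    by (rule yspan.monomial[OF r]) (use x finH in simp)
  moreover have "(\<Prod>z\<in>H. y z ^ (if z = x then 1 else 0)) = (\<Prod>z\<in>H. if z = x then y z else 1)"
    by (rule prod.cong) auto
  ultimately show ?thesis using x finH by simp
qed

lemma pw_yspan: "r \<in> pw q \<Longrightarrow> \<exists>s\<in>A - I. s * r \<in> yspan q"
proof (induction q arbitrary: r)
  case 0
  then have "r * (\<Prod>x\<in>H. y x ^ 0) \<in> yspan 0" by (intro yspan.monomial) auto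
  then show ?case using A1 I1 by (intro bexI[of _ 1]) auto
next
  case (Suc q)
  show ?case
    using Suc.prems
  proof (induction rule: pw_induct)
    case (prod i j)
    obtain s where s: "s \<in> A - I" "s * i \<in> yspan q" using Suc.IH[OF prod(1)] by blast
    obtain s' r where s': "s' \<in> A - I" "\<forall>x\<in>H. r x \<in> A" "s' * j = (\<Sum>x\<in>H. r x * y x)" using gens[OF prod(2)] by blast
    have "s' * j \<in> yspan 1" unfolding s'(3) using s'(2) by (intro yspan_sum yspan_1) auto
    from yspan_mult[OF s(2) this] have "s * s' * (i * j) \<in> yspan (Suc q)" by (simp add: mult_ac)
    then show ?case using complement_mult[OF s(1) s'(1)] by blast
  next
    case (add u w)
    then obtain s s' where s: "s \<in> A - I" "s * u \<in> yspan (Suc q)" and s': "s' \<in> A - I" "s' * w \<in> yspan (Suc q)" by blast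
    have "s' * (s * u) + s * (s' * w) \<in> yspan (Suc q)"
      using yspan.add[OF yspan_A_mult[of s' "s * u"] yspan_A_mult[of s "s' * w"]] s s' by blast
    then have "s * s' * (u + w) \<in> yspan (Suc q)" by (simp add: algebra_simps)
    then show ?case using complement_mult[OF s(1) s'(1)] by blast
  qed
qed

lemma \<Phi>_zero: "\<Phi> 0 = 0"
  using \<Phi>_add[of 0 0] Izero IA by auto

lemma yspan_A: "u \<in> yspan q \<Longrightarrow> u \<in> A"
proof (induction rule: yspan.induct)
  case (monomial r \<alpha>)
  have "(\<Prod>x\<in>H. y x ^ \<alpha> x) \<in> pw (\<Sum>x\<in>H. 0)"
    using yI IA by (intro pw_prod finH) (auto intro!: A_power)
  with monomial show ?case by (simp add: Amult)
qed (use Izero IA Aadd in auto)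

text \<open>Write each exponent as \<beta> p + \<gamma> with \<gamma> < p. The \<gamma> add up to at
  most card H (p - 1), which leaves (\<Sum> \<beta>) p > n p and so \<Sum> \<beta> \<ge> n + 1. The
  factor with exponents \<beta> p leaves \<open>\<Phi>\<close> with exponents \<beta>.\<close>

lemma \<Phi>_yspan:
  assumes u: "u \<in> yspan (card H * (p - 1) + n * p + 1)"
  shows "\<Phi> u \<in> pw (Suc n)"
  using u
proof (induction rule: yspan.induct)
  case zero
  show ?case by (simp only: \<Phi>_zero pw_zero)
next
  case (monomial r \<alpha>)
  have p0: "p > 0" using prime_p by (simp add: prime_gt_0_nat)
  define \<beta> where "\<beta> x = \<alpha> x div p" for x
  define \<gamma> where "\<gamma> x = \<alpha> x mod p" for x
  have \<alpha>: "\<alpha> x = \<beta> x * p + \<gamma> x" for x by (simp add: \<beta>_def \<gamma>_def)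
  have "sum \<gamma> H \<le> card H * (p - 1)"
    using sum_bounded_above[of H \<gamma> "p - 1"] p0 by (simp add: \<gamma>_def less_eq_Suc_le[symmetric] Suc_leI flip: less_Suc_eq_le)
  moreover have "sum \<alpha> H = sum \<beta> H * p + sum \<gamma> H"
    unfolding \<alpha>[abs_def] by (simp add: sum.distrib sum_distrib_right)
  ultimately have "n * p + 1 \<le> sum \<beta> H * p" using monomial(2) by linarith
  then have "n * p < sum \<beta> H * p" by (simp only: Suc_eq_plus1[symmetric] Suc_le_eq)
  then have n: "Suc n \<le> sum \<beta> H" using mult_less_cancel2 Suc_leI by blast
  have yA: "y x ^ j \<in> A" if "x \<in> H" for x j using yI[OF that] IA by (intro A_power) auto
  have prodA: "(\<Prod>x\<in>H. y x ^ j x) \<in> A" for j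
    using pw_prod[OF finH, of "\<lambda>x. y x ^ j x" "\<lambda>_. 0"] yA by simp
  have "r * (\<Prod>x\<in>H. y x ^ \<alpha> x) = (\<Prod>x\<in>H. y x ^ \<beta> x) ^ p * (r * (\<Prod>x\<in>H. y x ^ \<gamma> x))"
  proof -
    have "y x ^ \<alpha> x = (y x ^ \<beta> x) ^ p * y x ^ \<gamma> x" for x by (simp add: \<alpha> power_add power_mult)
    then show ?thesis by (simp add: prod.distrib mult_ac flip: prod_power_distrib)
  qed
  then have "\<Phi> (r * (\<Prod>x\<in>H. y x ^ \<alpha> x)) = (\<Prod>x\<in>H. y x ^ \<beta> x) * \<Phi> (r * (\<Prod>x\<in>H. y x ^ \<gamma> x))"
    using prodA monomial(1) by (simp add: \<Phi>_mult Amult)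
  also have "\<dots> = \<Phi> (r * (\<Prod>x\<in>H. y x ^ \<gamma> x)) * (\<Prod>x\<in>H. y x ^ \<beta> x)" by (rule mult.commute)
  also have "\<dots> \<in> pw (sum \<beta> H)"
  proof (rule pw_A_mult)
    show "\<Phi> (r * (\<Prod>x\<in>H. y x ^ \<gamma> x)) \<in> A" using prodA monomial(1) by (intro \<Phi>_closed Amult)
    have "y x ^ \<beta> x \<in> pw (\<beta> x)" if "x \<in> H" for x
      using pw_power[of "y x" "Suc 0" "\<beta> x"] yI[OF that] by (simp add: pw_1 del: pw.simps)
    then show "(\<Prod>x\<in>H. y x ^ \<beta> x) \<in> pw (sum \<beta> H)" by (rule pw_prod[OF finH])
  qed
  finally show ?case using pw_antimono[OF n] by blast
next
  case (add u w)
  then show ?case using pw_add[of "\<Phi> u" "Suc n" "\<Phi> w"] \<Phi>_add[of u w] yspan_A by (simp del: pw.simps)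
qed

text \<open>Contractions of the powers of I from the localisation at I, that is, the symbolic powers
  of a prime ideal.\<close>

definition J where "J n = {r \<in> A. \<exists>s\<in>A - I. s * r \<in> pw n}"

lemma J_1: "J 1 = I"
proof (intro equalityI subsetI)
  fix r assume "r \<in> J 1"
  then obtain s where "r \<in> A" "s \<in> A - I" "s * r \<in> I" by (auto simp: J_def pw_1 simp del: pw.simps)
  then show "r \<in> I" using I_prime[of s r] by blast
next
  fix r assume "r \<in> I"
  then show "r \<in> J 1" using IA A1 I1 unfolding J_def by (auto simp: pw_1 simp del: pw.simps intro!: bexI[of _ 1])
qed

lemma split_filtration: "split_filtration A J (\<lambda>x. \<Phi> (g ^ (p - 1) * x)) p"
proof
  have gp: "g ^ (p - 1) \<in> A" using gA by (rule A_power)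
  show "J 0 = A" using A1 I1 Amult by (auto simp: J_def intro!: bexI[of _ 1])
  show "J (Suc n) \<subseteq> J n" for n using pw_decr[of n] unfolding J_def by blast
  show "0 \<in> J n" for n using pw_zero[of n] Izero IA A1 I1 by (auto simp: J_def intro!: bexI[of _ 1])
  show "x + y \<in> J n" if "x \<in> J n" "y \<in> J n" for n x y
  proof -
    from that obtain s s' where s: "s \<in> A - I" "s * x \<in> pw n" "s' \<in> A - I" "s' * y \<in> pw n" "x \<in> A" "y \<in> A"
      unfolding J_def by blast
    have "s * s' * (x + y) = s' * (s * x) + s * (s' * y)" by (simp add: algebra_simps)
    also have "\<dots> \<in> pw n" 
      using pw_add[OF pw_A_mult[of s' "s * x" n] pw_A_mult[of s "s' * y" n]] s by blast
    finally show ?thesis unfolding J_def using complement_mult[OF s(1,3)] s Aadd by blast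
  qed
  show "x * y \<in> J (m + n)" if "x \<in> J m" "y \<in> J n" for m n x y
  proof -
    from that obtain s s' where s: "s \<in> A - I" "s * x \<in> pw m" "s' \<in> A - I" "s' * y \<in> pw n" "x \<in> A" "y \<in> A"
      unfolding J_def by blast
    have "s * s' * (x * y) = (s * x) * (s' * y)" by (simp add: mult_ac)
    also have "\<dots> \<in> pw (m + n)" using s by (intro pw_mult) auto
    finally show ?thesis unfolding J_def using complement_mult[OF s(1,3)] s Amult by blast
  qed
  show "1 \<notin> J 1" using I1 J_1 by simp
  show "\<Phi> (g ^ (p - 1) * x) \<in> A" if "x \<in> A" for x using that gp by (intro \<Phi>_closed Amult)
  show "\<Phi> (g ^ (p - 1) * (x + y)) = \<Phi> (g ^ (p - 1) * x) + \<Phi> (g ^ (p - 1) * y)" if "x \<in> A" "y \<in> A" for x y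
    using that gp by (simp add: distrib_left \<Phi>_add Amult)
  show "\<Phi> (g ^ (p - 1) * (a ^ p * x)) = a * \<Phi> (g ^ (p - 1) * x)" if "a \<in> A" "x \<in> A" for a x
    using \<Phi>_mult[of a "g ^ (p - 1) * x"] that gp by (simp add: Amult mult_ac)
  show "\<Phi> (g ^ (p - 1) * 1) = 1" using \<Phi>_g by simp
  show "\<Phi> (g ^ (p - 1) * x) \<in> J (Suc n)" if x: "x \<in> J (n * p + 1)" for n x
  proof -
    let ?w = "g ^ (p - 1) * x"
    obtain s where s: "s \<in> A - I" "s * x \<in> pw (n * p + 1)" "x \<in> A" using x unfolding J_def by blast
    obtain s' where s': "s' \<in> A - I" "s' * g \<in> pw (card H)" using g_pw by blast
    have "(s' * g) ^ (p - 1) * (s * x) \<in> pw (card H * (p - 1) + (n * p + 1))"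
      using pw_mult[OF pw_power[OF s'(2), of "p - 1"] s(2)] .
    then obtain s'' where s'': "s'' \<in> A - I" "s'' * ((s' * g) ^ (p - 1) * (s * x)) \<in> yspan (card H * (p - 1) + (n * p + 1))"
      using pw_yspan by blast
    \<comment> \<open>\<open>S\<close> collects all denominators. A further factor S^(p-1) turns it
      into S^p, which comes out of \<open>\<Phi>\<close> as the factor S outside I.\<close>
    define S where "S = s'' * s' ^ (p - 1) * s"
    have S: "S \<in> A - I" unfolding S_def using s s' s'' by (intro complement_mult complement_power)
    have "S * ?w \<in> yspan (card H * (p - 1) + n * p + 1)"
      using s''(2) by (simp add: S_def power_mult_distrib mult_ac add.assoc)
    moreover have "S ^ (p - 1) \<in> A" using S by (intro A_power) simp
    ultimately have "S ^ (p - 1) * (S * ?w) \<in> yspan (card H * (p - 1) + n * p + 1)"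
      by (rule yspan_A_mult[rotated])
    moreover have "S ^ (p - 1) * (S * ?w) = S ^ p * ?w"
      using prime_gt_0_nat[OF prime_p] by (simp add: power_eq_if mult_ac)
    ultimately have "\<Phi> (S ^ p * ?w) \<in> pw (Suc n)" using \<Phi>_yspan by simp
    moreover have wA: "?w \<in> A" using gp s by (intro Amult)
    ultimately have "S * \<Phi> ?w \<in> pw (Suc n)" using S by (simp add: \<Phi>_mult del: pw.simps)
    then show ?thesis unfolding J_def using S \<Phi>_closed[OF wA] by blast
  qed
qed (use prime_p p_CHAR A1 Aadd Amult Auminus in auto)

end

section \<open>The splitting element\<close>

context mixed_ladder
begin

lemma ideal_powers_ker: "ideal_powers (polys L) (ker :: 'k::field mat_poly set)"
  by unfold_locales (auto simp: ker_def psi_zero psi_add psi_mult intro: polys_add polys_mult polys_uminus)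

text \<open>\<open>N\<close> numbers the antidiagonal lines \<open>i + j = N\<close>. The special entries of a line form an initial run of its
  entries, counted from the north-east; prolonged by \<open>t - 1\<close> entries beyond the last of them, this run
  becomes the antidiagonal of \<open>line_minor N\<close>. Longer minors need not vanish to the required order.\<close>

definition top_row :: "nat \<Rightarrow> nat" where
  "top_row N = Min (fst ` {x \<in> L. fst x + snd x = N})"

definition last_row :: "nat \<Rightarrow> nat" where
  "last_row N = Max (fst ` {x \<in> H. fst x + snd x = N})"

definition lines :: "nat set" where
  "lines = (\<lambda>x. fst x + snd x) ` H"

definition line_height :: "nat \<Rightarrow> nat" where
  "line_height N = Suc (last_row N - top_row N)"

definition line_length :: "nat \<Rightarrow> nat" where
  "line_length N = line_height N + (t (hx (last_row N, N - last_row N)) - 1)"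

definition line_minor :: "nat \<Rightarrow> 'k::field mat_poly" where
  "line_minor N = minor (line_length N) (\<lambda>a. top_row N + a) (\<lambda>b. N - top_row N - b)"

definition segment :: "nat \<Rightarrow> (nat \<times> nat) set" where
  "segment N = (\<lambda>a. (top_row N + a, N - top_row N - a)) ` {..<line_length N}"

lemma HL: "H \<subseteq> L" by (auto simp: H_def)

lemma line_ends:
  assumes N: "N \<in> lines"
  shows "(top_row N, N - top_row N) \<in> L" "(last_row N, N - last_row N) \<in> H"
    "top_row N \<le> last_row N" "last_row N \<le> N"
proof -
  let ?A = "{x \<in> L. fst x + snd x = N}" and ?B = "{x \<in> H. fst x + snd x = N}"
  have BA: "?B \<subseteq> ?A" using HL by blast
  have ne: "?B \<noteq> {}" using N unfolding lines_def by blast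
  have fin: "finite ?A" "finite ?B" using finite_L finite_H by auto
  have "top_row N \<in> fst ` ?A" unfolding top_row_def using fin ne BA by (intro Min_in finite_imageI) blast+
  then obtain x where x: "x \<in> L" "fst x + snd x = N" "top_row N = fst x" by auto
  then have "(top_row N, N - top_row N) = x" by (cases x) auto
  then show "(top_row N, N - top_row N) \<in> L" using x by simp
  have "last_row N \<in> fst ` ?B" unfolding last_row_def using fin ne by (intro Max_in finite_imageI) blast+
  then obtain y where y: "y \<in> H" "fst y + snd y = N" "last_row N = fst y" by auto
  then have "(last_row N, N - last_row N) = y" by (cases y) auto
  then show "(last_row N, N - last_row N) \<in> H" using y by simp
  show "last_row N \<le> N" using y by simp
  show "top_row N \<le> last_row N"
    unfolding top_row_def y(3) using fin y HL by (intro Min_le) auto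
qed

text \<open>Between the first entry of the line in L and its last special entry, all entries lie in
  L by the ladder property, and \<open>in_H\<close> is inherited when moving north-east.\<close>

lemma line_H:
  assumes N: "N \<in> lines"
  shows "{x \<in> H. fst x + snd x = N} = (\<lambda>i. (i, N - i)) ` {top_row N..last_row N}"
proof (intro equalityI subsetI)
  fix x assume x: "x \<in> {x \<in> H. fst x + snd x = N}"
  have "top_row N \<le> fst x" unfolding top_row_def using finite_L x HL by (intro Min_le) auto
  moreover have "fst x \<le> last_row N" unfolding last_row_def using finite_H x by (intro Max_ge) auto
  moreover have "x = (fst x, N - fst x)" using x by (cases x) auto
  ultimately show "x \<in> (\<lambda>i. (i, N - i)) ` {top_row N..last_row N}" by (metis atLeastAtMost_iff imageI)
next
  fix x assume "x \<in> (\<lambda>i. (i, N - i)) ` {top_row N..last_row N}"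
  then obtain i where i: "x = (i, N - i)" "top_row N \<le> i" "i \<le> last_row N" by auto
  note ends = line_ends[OF N]
  have "(last_row N, N - last_row N) \<in> L" using ends(2) HL by blast
  then have "(i, N - i) \<in> L"
    using L_rect[OF ends(1), of "last_row N" "N - last_row N" i "N - i"] i by simp
  moreover have "in_H (hx (last_row N, N - last_row N)) x"
    by (rule in_H_ne[OF hx(2)[OF ends(2)]]) (use i in auto)
  ultimately show "x \<in> {x \<in> H. fst x + snd x = N}"
    using i hx(1)[OF ends(2)] ends(4) unfolding H_def by auto
qed

lemma card_H: "card H = sum line_height lines"
proof -
  have "card {x \<in> H. fst x + snd x = N} = line_height N" if "N \<in> lines" for N
  proof -
    have "card {x \<in> H. fst x + snd x = N} = card {top_row N..last_row N}"
      unfolding line_H[OF that] by (rule card_image) (auto simp: inj_on_def)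
    then show ?thesis using line_ends(3)[OF that] by (simp add: line_height_def)
  qed
  then have "(\<Sum>N\<in>lines. line_height N) = (\<Sum>N\<in>lines. \<Sum>x\<in>{x \<in> H. fst x + snd x = N}. 1)" by simp
  also have "\<dots> = (\<Sum>x\<in>H. 1)"
    unfolding lines_def by (rule sum.group) (use finite_H in auto)
  finally show ?thesis by simp
qed

text \<open>The square of the line minor has the same south-west corner as the block of the last
  special entry. It therefore fits between the first entry of the line and the corner of that
  entry's region.\<close>

lemma line_entries:
  assumes N: "N \<in> lines" and ab: "a < line_length N" "b < line_length N"
  shows "(top_row N + a, N - top_row N - b) \<in> region (hx (last_row N, N - last_row N))" "b < N - top_row N"
proof -
  note ends = line_ends[OF N]
  let ?h = "hx (last_row N, N - last_row N)"
  have h: "?h \<in> {1..v}" "in_H ?h (last_row N, N - last_row N)" using hx(1,2)[OF ends(2)] by auto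
  then have *: "last_row N + t ?h \<le> d ?h + 1" "c ?h + t ?h \<le> N - last_row N + 1" "0 < t ?h" "1 \<le> c ?h"
    using t_pos[OF h(1)] L_bounds[OF corner[OF h(1)]] by (auto simp: in_H_def)
  have ab': "a < last_row N - top_row N + t ?h" "b < last_row N - top_row N + t ?h"
    using ab * by (auto simp: line_length_def line_height_def)
  show "(top_row N + a, N - top_row N - b) \<in> region ?h"
  proof (rule block_region[OF h(1) ends(1)])
    show "fst (top_row N + a, N - top_row N - b) \<le> d ?h" unfolding fst_conv using * ab' ends(3,4) by linarith
    show "c ?h \<le> snd (top_row N + a, N - top_row N - b)" unfolding snd_conv using * ab' ends(3,4) by linarith
  qed simp_all
  show "b < N - top_row N" using * ab' ends by linarith
qed

lemma segment_sum:
  assumes "N \<in> lines" "x \<in> segment N"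
  shows "fst x + snd x = N" "x \<in> L"
proof -
  obtain a where a: "a < line_length N" "x = (top_row N + a, N - top_row N - a)" using assms(2) by (auto simp: segment_def)
  show "fst x + snd x = N" using line_entries(2)[OF assms(1) a(1) a(1)] a(2) by simp
  show "x \<in> L" using line_entries(1)[OF assms(1) a(1) a(1)] a(2) region_L by auto
qed

lemma line_minor_polys: "N \<in> lines \<Longrightarrow> line_minor N \<in> polys L"
  unfolding line_minor_def by (rule minor_polys) (rule subsetD[OF region_L line_entries(1)])

lemma mon_distinct: "distinct xs \<Longrightarrow> mon xs = (\<Sum>x\<in>set xs. single x 1)"
  unfolding mon_def by (rule sum_list_distinct_conv_sum_set)

lemma lead_line_minor:
  assumes N: "N \<in> lines"
  shows "lead (line_minor N :: 'k::field mat_poly) (\<Sum>x\<in>segment N. single x 1)"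
proof -
  let ?xs = "map (\<lambda>a. (top_row N + a, N - top_row N - a)) [0..<line_length N]"
  have "lead (line_minor N :: 'k mat_poly) (mon ?xs)"
    unfolding line_minor_def
  proof (rule lead_minor)
    show "N - top_row N - b < N - top_row N - a" if "a < b" "b < line_length N" for a b
      using line_entries(2)[OF N that(2) that(2)] that by linarith
  qed (simp add: strict_mono_on_def)
  moreover have "distinct ?xs" by (simp add: distinct_map inj_on_def)
  ultimately show ?thesis by (simp add: mon_distinct segment_def atLeast0LessThan)
qed

text \<open>Sylvester's identity with pivot \<open>del\<close> of the last special entry of the
  line: the bordered minors have size t in the region of that entry, hence lie in the kernel, and
  the determinant of the matrix they form lies in the power of order
  \<open>line_height N\<close>.\<close>

lemma line_minor_local:
  assumes N: "N \<in> lines"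
  shows "\<exists>s\<in>polys L. psi s \<noteq> 0 \<and> s * (line_minor N :: 'k::field mat_poly) \<in> ideal_powers.pw (polys L) ker (line_height N)"
proof -
  interpret I: ideal_powers "polys L" "ker :: 'k mat_poly set" by (rule ideal_powers_ker)
  note ends = line_ends[OF N]
  let ?x = "(last_row N, N - last_row N)"
  let ?r = "\<lambda>a. top_row N + a" and ?s = "\<lambda>b. N - top_row N - b" and ?m = "line_height N" and ?q = "t (hx ?x) - 1"
  let ?\<delta> = "del ?x :: 'k mat_poly"
  have t: "Suc ?q = t (hx ?x)" using t_pos[OF hx(1)[OF ends(2)]] by simp
  \<comment> \<open>Since \<open>top_row N + line_height N = last_row N + 1\<close>, the trailing
    rows and columns are exactly those of \<open>del\<close>.\<close>
  have \<delta>: "minor ?q (\<lambda>a. ?r (?m + a)) (\<lambda>b. ?s (?m + b)) = ?\<delta>"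
    unfolding del_def minor_def
    by (rule arg_cong[where f = det], rule eq_matI) (use ends in \<open>auto simp: line_height_def\<close>)
  have nz: "psi ?\<delta> \<noteq> 0" by (rule del_nonzero[OF ends(2)])
  then have nz': "?\<delta> \<noteq> 0" using psi_zero by metis
  have \<delta>L: "?\<delta> \<in> polys L"
    using del_polys[OF ends(2)] polys_mono[of "block ?x - {?x}" L] block_subset_region[OF ends(2)] region_L by blast
  obtain M :: "'k mat_poly mat" where M: "M \<in> carrier_mat ?m ?m" "minor (?m + ?q) ?r ?s * ?\<delta> ^ ?m = det M * ?\<delta>"
    "\<And>i j. i < ?m \<Longrightarrow> j < ?m \<Longrightarrow> M $$ (i, j) * ?\<delta> =
       minor (Suc ?q) (\<lambda>a. if a = 0 then ?r i else ?r (?m + (a - 1))) (\<lambda>b. if b = 0 then ?s j else ?s (?m + (b - 1))) * ?\<delta>"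
    using minor_bordered[of ?m ?q ?r ?s, where 'k = 'k] unfolding \<delta> by blast
  have ent: "M $$ (i, j) \<in> ker" if ij: "i < ?m" "j < ?m" for i j
  proof -
    let ?r' = "\<lambda>a. if a = 0 then ?r i else ?r (?m + (a - 1))" and ?s' = "\<lambda>b. if b = 0 then ?s j else ?s (?m + (b - 1))"
    have eq: "M $$ (i, j) = minor (Suc ?q) ?r' ?s'" using M(3)[OF ij] nz' by simp
    have e: "(?r' a, ?s' b) \<in> region (hx ?x)" if "a < Suc ?q" "b < Suc ?q" for a b
    proof -
      define a' where "a' = (if a = 0 then i else ?m + (a - 1))"
      define b' where "b' = (if b = 0 then j else ?m + (b - 1))"
      have "a' < line_length N" "b' < line_length N" using ij that by (auto simp: a'_def b'_def line_length_def)
      from line_entries(1)[OF N this] show ?thesis by (auto simp: a'_def b'_def split: if_splits)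
    qed
    have "psi (minor (Suc ?q) ?r' ?s' :: 'k mat_poly) = 0"
      by (rule psi_minor[OF hx(1)[OF ends(2)] _ e]) (use t in simp)
    moreover have "(minor (Suc ?q) ?r' ?s' :: 'k mat_poly) \<in> polys L"
      by (rule minor_polys) (rule subsetD[OF region_L e])
    ultimately show ?thesis by (simp add: eq ker_def)
  qed
  have "?\<delta> * det M \<in> I.pw ?m" by (intro I.pw_A_mult \<delta>L I.pw_det M(1) ent)
  then have "?\<delta> ^ ?m * line_minor N \<in> I.pw ?m"
    using M(2) by (simp add: line_minor_def line_length_def mult.commute)
  moreover have "psi (?\<delta> ^ ?m) \<noteq> 0" using nz by (simp add: psi_power)
  ultimately show ?thesis using polys_power[OF \<delta>L] by blast
qed

definition frob_poly :: "'k::field mat_poly" where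
  "frob_poly = (\<Prod>N\<in>lines. line_minor N) * (\<Prod>x\<in>L - (\<Union>N\<in>lines. segment N). Var x)"

lemma finite_lines: "finite lines" using finite_H by (simp add: lines_def)

lemma frob_poly_polys: "frob_poly \<in> polys L"
  unfolding frob_poly_def by (intro polys_mult polys_prod line_minor_polys) auto

text \<open>Segments on different lines are disjoint, as i + j differs, so the antidiagonals
  multiply to a squarefree monomial and the extra variables fill up the rest of L.\<close>

lemma lead_frob_poly: "lead (frob_poly :: 'k::field mat_poly) (\<Sum>x\<in>L. single x 1)"
proof -
  let ?U = "\<Union>N\<in>lines. segment N"
  have UL: "?U \<subseteq> L" using segment_sum(2) by blast
  have "lead (frob_poly :: 'k mat_poly)
      ((\<Sum>N\<in>lines. \<Sum>x\<in>segment N. single x 1) + (\<Sum>x\<in>L - ?U. single x 1))"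
    unfolding frob_poly_def by (intro lead_mult lead_prod lead_line_minor lead_Var)
  also have "(\<Sum>N\<in>lines. \<Sum>x\<in>segment N. single x 1) = (\<Sum>x\<in>?U. single x (1::nat))"
  proof (rule sum.UNION_disjoint[symmetric, OF finite_lines])
    show "\<forall>N\<in>lines. finite (segment N)" by (simp add: segment_def)
    show "\<forall>i\<in>lines. \<forall>j\<in>lines. i \<noteq> j \<longrightarrow> segment i \<inter> segment j = {}"
      using segment_sum(1) by (metis disjoint_iff)
  qed
  also have "(\<Sum>x\<in>?U. single x (1::nat)) + (\<Sum>x\<in>L - ?U. single x 1) = (\<Sum>x\<in>L. single x 1)"
    using sum.subset_diff[OF UL finite_L, of "\<lambda>x. single x (1::nat)"] by (simp add: add.commute)
  finally show ?thesis .
qed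

lemma psi_prod_nonzero: "finite S \<Longrightarrow> (\<And>i. i \<in> S \<Longrightarrow> psi (f i) \<noteq> 0) \<Longrightarrow> psi (prod f S :: 'k::field mat_poly) \<noteq> 0"
  by (induction S rule: finite_induct) (auto simp: psi_one psi_mult)

lemma frob_poly_local:
  "\<exists>s\<in>polys L. psi s \<noteq> 0 \<and> s * (frob_poly :: 'k::field mat_poly) \<in> ideal_powers.pw (polys L) ker (card H)"
proof -
  interpret I: ideal_powers "polys L" "ker :: 'k mat_poly set" by (rule ideal_powers_ker)
  obtain s :: "nat \<Rightarrow> 'k mat_poly" where s: "\<And>N. N \<in> lines \<Longrightarrow> s N \<in> polys L \<and> psi (s N) \<noteq> 0 \<and> s N * line_minor N \<in> I.pw (line_height N)"
  proof -
    have "\<forall>N. \<exists>s. N \<in> lines \<longrightarrow> s \<in> polys L \<and> psi s \<noteq> 0 \<and> s * (line_minor N :: 'k mat_poly) \<in> I.pw (line_height N)"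
      using line_minor_local by blast
    from choice[OF this] show ?thesis using that by blast
  qed
  let ?V = "\<Prod>x\<in>L - (\<Union>N\<in>lines. segment N). Var x :: 'k mat_poly"
  have "(\<Prod>N\<in>lines. s N * line_minor N) \<in> I.pw (card H)"
    unfolding card_H using s by (intro I.pw_prod finite_lines) auto
  then have "?V * (\<Prod>N\<in>lines. s N * line_minor N) \<in> I.pw (card H)"
    by (intro I.pw_A_mult polys_prod) auto
  then have "(\<Prod>N\<in>lines. s N) * frob_poly \<in> I.pw (card H)"
    by (simp add: frob_poly_def prod.distrib mult_ac)
  moreover have "(\<Prod>N\<in>lines. s N) \<in> polys L" using s by (intro polys_prod) auto
  moreover have "psi (\<Prod>N\<in>lines. s N) \<noteq> 0" using s by (intro psi_prod_nonzero finite_lines) auto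
  ultimately show ?thesis by blast
qed

end

text \<open>With c acting as multiplication by c^p, the field is a vector space over itself. As 1 is
  a nonzero vector, there is a linear functional taking it to 1.\<close>

lemma ex_p_linear_retraction:
  fixes p :: nat
  assumes p: "p = CHAR('k::field)" "Factorial_Ring.prime p"
  shows "\<exists>\<pi> :: 'k \<Rightarrow> 'k. (\<forall>x y. \<pi> (x + y) = \<pi> x + \<pi> y) \<and> (\<forall>c x. \<pi> (c ^ p * x) = c * \<pi> x) \<and> \<pi> 1 = 1"
proof -
  have p0: "p > 0" using p(2) by (simp add: prime_gt_0_nat)
  interpret V: vector_space_pair "\<lambda>c x :: 'k. c ^ p * x" "\<lambda>c x :: 'k. c * x"
    by unfold_locales (use p in \<open>auto simp: distrib_left distrib_right power_mult_distrib freshmans_dream\<close>)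
  have "V.vs1.independent {1}" using V.vs1.dependent_single by simp
  then obtain \<pi> where lin: "Vector_Spaces.linear (\<lambda>c x :: 'k. c ^ p * x) (\<lambda>c x :: 'k. c * x) \<pi>" and 1: "\<pi> 1 = 1"
    using V.linear_independent_extend[of "{1}" "\<lambda>_. 1"] by auto
  interpret l: Vector_Spaces.linear "\<lambda>c x :: 'k. c ^ p * x" "\<lambda>c x :: 'k. c * x" \<pi> by (rule lin)
  show ?thesis using l.add l.scale 1 by blast
qed

lemma CHAR_mpoly: "CHAR(('v, 'k::comm_ring_1) mpoly) = CHAR('k)"
proof (rule CHAR_eqI)
  have e: "of_nat n = (single 0 (of_nat n) :: ('v, 'k) mpoly)" for n by simp
  have iff: "of_nat n = (0 :: ('v, 'k) mpoly) \<longleftrightarrow> of_nat n = (0 :: 'k)" for n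
    unfolding e[of n] by (metis lookup_single_eq lookup_zero single_zero)
  show "of_nat CHAR('k) = (0 :: ('v, 'k) mpoly)" unfolding iff by simp
  show "CHAR('k) dvd n" if "of_nat n = (0 :: ('v, 'k) mpoly)" for n
    using that unfolding iff by (simp add: of_nat_eq_0_iff_char_dvd)
qed

text \<open>The trace-like operator attached to \<open>\<pi>\<close>: it sends \<open>c x\<^sup>m\<close> to \<open>\<pi> c x\<^sup>n\<close> if
  \<open>m = p n + (p - 1) u\<close>, and to \<open>0\<close> if there is no such \<open>n\<close>.\<close>

locale trace_operator =
  fixes p :: nat and \<pi> :: "'k::field \<Rightarrow> 'k" and u :: "'v \<Rightarrow>\<^sub>0 nat"
  assumes prime_p: "Factorial_Ring.prime p" and p_CHAR: "p = CHAR('k)"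
    and \<pi>_add: "\<And>x y. \<pi> (x + y) = \<pi> x + \<pi> y" and \<pi>_mult: "\<And>c x. \<pi> (c ^ p * x) = c * \<pi> x" and \<pi>_one: "\<pi> 1 = 1"
    and u: "\<And>x. lookup u x \<le> 1"
begin

definition shift :: "('v \<Rightarrow>\<^sub>0 nat) \<Rightarrow> 'v \<Rightarrow>\<^sub>0 nat" where
  "shift n = (\<Sum>i<p. n) + (\<Sum>i<p - 1. u)"

lemma p_pos: "p > 0" using prime_p by (simp add: prime_gt_0_nat)

lemma lookup_shift: "lookup (shift n) x = p * lookup n x + (p - 1) * lookup u x"
  by (simp add: shift_def lookup_add lookup_sum)

lemma shift_inj: "shift m = shift n \<longleftrightarrow> m = n"
proof
  assume e: "shift m = shift n"
  have "p * lookup m x = p * lookup n x" for x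
    using arg_cong[OF e, of "\<lambda>f. lookup f x"] by (simp only: lookup_shift add_right_cancel)
  then show "m = n" using p_pos by (intro poly_mapping_eqI) auto
qed simp

lemma \<pi>_zero: "\<pi> 0 = 0"
proof -
  have "\<pi> 0 + \<pi> 0 = \<pi> 0 + 0" using \<pi>_add[of 0 0] by simp
  then show ?thesis by (simp only: add_left_cancel)
qed

definition tr :: "('v, 'k) mpoly \<Rightarrow> ('v, 'k) mpoly" where
  "tr f = Abs_poly_mapping (\<lambda>n. \<pi> (lookup f (shift n)))"

lemma lookup_tr: "lookup (tr f) n = \<pi> (lookup f (shift n))"
proof -
  have "{n. \<pi> (lookup f (shift n)) \<noteq> 0} \<subseteq> shift -` keys f"
    by (auto simp: in_keys_iff \<pi>_zero)
  moreover have "finite (shift -` keys f)"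
    by (rule finite_vimageI) (auto simp: inj_on_def shift_inj)
  ultimately have "finite {n. \<pi> (lookup f (shift n)) \<noteq> 0}" by (rule finite_subset)
  then show ?thesis by (simp add: tr_def)
qed

lemma tr_add: "tr (f + g) = tr f + tr g"
  by (rule poly_mapping_eqI) (simp add: lookup_tr lookup_add \<pi>_add)

lemma tr_zero: "tr 0 = 0"
  by (rule poly_mapping_eqI) (simp add: lookup_tr \<pi>_zero)

lemma tr_polys: "f \<in> polys V \<Longrightarrow> tr f \<in> polys V"
proof -
  assume f: "f \<in> polys V"
  have "keys n \<subseteq> V" if n: "n \<in> keys (tr f)" for n
  proof -
    have "shift n \<in> keys f" using n by (auto simp: in_keys_iff lookup_tr \<pi>_zero)
    then have "keys (shift n) \<subseteq> V" using f by (simp add: polys_def)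
    moreover have "keys n \<subseteq> keys (shift n)"
      using p_pos by (auto simp: in_keys_iff lookup_shift)
    ultimately show ?thesis by simp
  qed
  then show ?thesis by (simp add: polys_def)
qed

lemma tr_single_shift: "tr (single (shift n) a) = single n (\<pi> a)"
  by (rule poly_mapping_eqI) (simp add: lookup_tr lookup_single when_def shift_inj \<pi>_zero)

lemma tr_single_other: "m \<notin> range shift \<Longrightarrow> tr (single m a) = 0"
  by (rule poly_mapping_eqI) (auto simp: lookup_tr lookup_single when_def \<pi>_zero)

lemma single_power: "single m a ^ n = single (\<Sum>i<n. m) (a ^ n)"
  for m :: "'v \<Rightarrow>\<^sub>0 nat" and a :: 'k
  by (induction n) (simp_all add: mult_single add.commute)

lemma shift_plus: "(\<Sum>i<p. m) + shift n = shift (m + n)"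
  by (simp add: shift_def sum.distrib add.assoc)

text \<open>Here the exponents of \<open>u\<close> being at most 1 matters: from p m + m' = p n + (p
  - 1) u and (p - 1) u < p one gets m \<le> n, so m' is the shift of n - m. A p-th power therefore
  cannot move a term that is killed to one that survives.\<close>

lemma shift_cancel:
  assumes "(\<Sum>i<p. m) + m' \<in> range shift"
  shows "m' \<in> range shift"
proof -
  obtain n where n: "(\<Sum>i<p. m) + m' = shift n" using assms by blast
  have e: "p * lookup m x + lookup m' x = p * lookup n x + (p - 1) * lookup u x" for x
    using arg_cong[OF n, of "\<lambda>f. lookup f x"] by (simp add: lookup_add lookup_sum lookup_shift)
  have le: "lookup m x \<le> lookup n x" for x
  proof (rule ccontr)
    assume "\<not> ?thesis"
    then have "Suc (lookup n x) \<le> lookup m x" by simp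
    then have "p * Suc (lookup n x) \<le> p * lookup m x" by (rule mult_le_mono2)
    moreover have "(p - 1) * lookup u x \<le> (p - 1) * 1" using u by (rule mult_le_mono2)
    ultimately show False using e[of x] p_pos unfolding mult_Suc_right mult_1_right by linarith
  qed
  have "m' = shift (n - m)"
  proof (rule poly_mapping_eqI)
    fix x
    have "p * (lookup n x - lookup m x) + p * lookup m x = p * lookup n x"
      using le[of x] by (simp flip: distrib_left)
    then show "lookup m' x = lookup (shift (n - m)) x"
      using e[of x] by (simp add: lookup_shift lookup_minus)
  qed
  then show ?thesis by blast
qed

lemma tr_mult: "tr (f ^ p * g) = f * tr g"
proof (induction f rule: poly_mapping_add_induct)
  case zero
  show ?case using p_pos by (simp add: tr_zero zero_power)
next
  case (add f f')
  have "(f + f') ^ p = f ^ p + f' ^ p"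
    by (rule freshmans_dream) (use prime_p p_CHAR in \<open>simp_all add: CHAR_mpoly\<close>)
  with add show ?case by (simp add: distrib_right tr_add)
next
  case (single m a)
  show ?case
  proof (induction g rule: poly_mapping_add_induct)
    case zero
    show ?case by (simp add: tr_zero)
  next
    case (add g g')
    then show ?case by (simp add: distrib_left tr_add)
  next
    case (single m' b)
    have e: "single m a ^ p * single m' b = single ((\<Sum>i<p. m) + m') (a ^ p * b)"
      by (simp only: single_power mult_single)
    show ?case
    proof (cases "m' \<in> range shift")
      case True
      then obtain n where n: "m' = shift n" by blast
      show ?thesis 
        unfolding e unfolding n shift_plus tr_single_shift by (simp add: mult_single \<pi>_mult)
    next
      case False
      then have "(\<Sum>i<p. m) + m' \<notin> range shift" using shift_cancel by blast
      with False show ?thesis unfolding e by (simp add: tr_single_other)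
    qed
  qed
qed

text \<open>The degree of \<open>shift n\<close> exceeds that of \<open>shift 0\<close> by p times
  the degree of n, so homogeneity leaves only n = 0.\<close>

lemma tr_lead:
  assumes "lookup f (shift 0) = 1"
    and "\<And>m. m \<in> keys f \<Longrightarrow> wt (\<lambda>_. 1) m = wt (\<lambda>_. 1) (shift 0)"
  shows "tr f = 1"
proof (rule poly_mapping_eqI)
  fix n
  show "lookup (tr f) n = lookup 1 n"
  proof (cases "n = 0")
    case True
    then show ?thesis using assms(1) by (simp add: lookup_tr \<pi>_one)
  next
    case False
    have "shift n \<notin> keys f"
    proof
      assume "shift n \<in> keys f"
      from assms(2)[OF this] have e: "wt (\<lambda>_. 1) (shift n) = wt (\<lambda>_. 1) (shift 0)" .
      have "shift n = (\<Sum>i<p. n) + shift 0" by (simp add: shift_def)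
      then have "wt (\<lambda>_. 1) (\<Sum>i<p. n) = 0" using e by (simp add: wt_plus)
      moreover have "(\<Sum>i<p. n) = n + (\<Sum>i<p - 1. n)"
        using p_pos by (metis Suc_pred' sum.lessThan_Suc add.commute)
      ultimately have "wt (\<lambda>_. 1) n = 0" by (simp add: wt_plus)
      then have "lookup n x = 0" for x by (cases "x \<in> keys n") (auto simp: wt_def in_keys_iff)
      then have "n = 0" by (intro poly_mapping_eqI) simp
      with False show False ..
    qed
    then show ?thesis using False by (simp add: lookup_tr in_keys_iff \<pi>_zero lookup_one)
  qed
qed

end

section \<open>Mixed ladder determinantal ideals\<close>

lemma ladder_ring_eq: "ladder_ring L = ring_of_type_algebra\<lparr>carrier := polys L\<rparr>"
  by (simp add: ladder_ring_def polys_def)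

lemma ladder_ring_sel:
  fixes L :: "(nat \<times> nat) set"
  defines "R \<equiv> ladder_ring L :: 'k::field mat_poly ring"
  shows "carrier R = polys L" "x \<otimes>\<^bsub>R\<^esub> y = x * y" "\<one>\<^bsub>R\<^esub> = 1" "\<zero>\<^bsub>R\<^esub> = 0" "x \<oplus>\<^bsub>R\<^esub> y = x + y"
  by (simp_all add: R_def ladder_ring_eq)

context mixed_ladder
begin

lemma subladder_eq: "subladder l L d c h = region h"
proof -
  have "1 \<le> b \<and> a \<le> l" if "(b, a) \<in> L" for a b using L_bounds[OF that] by simp
  then show ?thesis unfolding subladder_def region_def by force
qed

lemma ladder_ring_cring: "cring (ladder_ring L :: 'k::field mat_poly ring)"
proof (rule cringI)
  let ?R = "ladder_ring L :: 'k mat_poly ring"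
  have sel: "carrier ?R = polys L" "monoid.mult ?R = (*)" "one ?R = 1" "ring.zero ?R = 0" "add ?R = (+)"
    by (simp_all add: ladder_ring_eq)
  show "abelian_group ?R"
    by (rule abelian_groupI) (auto simp: sel algebra_simps polys_add polys_uminus intro!: bexI[of _ "- _"])
  show "comm_monoid ?R"
    by (rule comm_monoidI) (auto simp: sel algebra_simps polys_mult)
  show "(x \<oplus>\<^bsub>?R\<^esub> y) \<otimes>\<^bsub>?R\<^esub> z = x \<otimes>\<^bsub>?R\<^esub> z \<oplus>\<^bsub>?R\<^esub> y \<otimes>\<^bsub>?R\<^esub> z" for x y z by (simp add: sel distrib_right)
qed

lemma ker_ideal: "ideal (ker :: 'k::field mat_poly set) (ladder_ring L)"
proof (rule idealI)
  interpret R: cring "ladder_ring L :: 'k mat_poly ring" by (rule ladder_ring_cring)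
  show "ring (ladder_ring L :: 'k mat_poly ring)" by (rule R.ring_axioms)
  show "subgroup ker (add_monoid (ladder_ring L :: 'k mat_poly ring))"
  proof (rule R.add.subgroupI)
    fix a :: "'k mat_poly" assume a: "a \<in> ker"
    have "\<ominus>\<^bsub>ladder_ring L\<^esub> a = - a"
      using a by (intro R.minus_equality) (auto simp: ladder_ring_sel ker_def polys_uminus)
    then show "\<ominus>\<^bsub>ladder_ring L\<^esub> a \<in> ker" using a by (simp add: ker_def polys_uminus psi_uminus)
  next
    show "ker \<noteq> ({} :: 'k mat_poly set)" using psi_zero polys_0 unfolding ker_def by blast
  qed (auto simp: ladder_ring_sel ker_def polys_add psi_add)
qed (auto simp: ladder_ring_sel ker_def polys_mult psi_mult)

lemma minors_ker: "h \<in> {1..v} \<Longrightarrow> minors (t h) (region h) \<subseteq> (ker :: 'k::field mat_poly set)"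
proof
  fix f :: "'k mat_poly" assume h: "h \<in> {1..v}" and "f \<in> minors (t h) (region h)"
  then obtain r s where f: "f = minor (t h) r s" and rs: "square_submatrix (t h) (region h) r s"
    unfolding minors_def minor_def indeterminate_def Var_def by blast
  have e: "(r a, s b) \<in> region h" if "a < t h" "b < t h" for a b
    using rs that by (simp add: square_submatrix_def)
  have "f \<in> polys L" unfolding f by (rule minor_polys) (rule subsetD[OF region_L e])
  moreover have "psi f = 0" unfolding f by (rule psi_minor[OF h order_refl e])
  ultimately show "f \<in> ker" by (simp add: ker_def)
qed

text \<open>The generators are killed because of the rank bound on each region. Conversely,
  \<open>kernel_subset\<close> applies to the mixed ideal itself; its minors are put into the
  required column order by \<open>minor_reverse\<close>.\<close>

lemma mixed_ladder_ideal_eq_ker: "mixed_ladder_ideal l L v d c t = (ker :: 'k::field mat_poly set)"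
proof -
  let ?R = "ladder_ring L :: 'k mat_poly ring"
  interpret R: cring ?R by (rule ladder_ring_cring)
  let ?D = "\<lambda>j. determinantal_ideal L (t j) (subladder l L d c j) :: 'k mat_poly set"
  let ?K = "mixed_ladder_ideal l L v d c t :: 'k mat_poly set"
  have minL: "minors (t j) (region j) \<subseteq> carrier ?R" if "j \<in> {1..v}" for j
    using minors_ker[OF that, where 'k = 'k] by (auto simp: ladder_ring_sel ker_def)
  have D: "ideal (?D j) ?R" "minors (t j) (region j) \<subseteq> ?D j" "?D j \<subseteq> ker" if "j \<in> {1..v}" for j
    unfolding determinantal_ideal_def subladder_eq
    using R.genideal_ideal[OF minL[OF that]] R.genideal_self[OF minL[OF that]]
      R.genideal_minimal[OF ker_ideal minors_ker[OF that]] by auto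
  have DL: "f \<in> polys L" if "j \<in> {1..v}" "f \<in> ?D j" for f j using D(3)[OF that(1)] that(2) by (auto simp: ker_def)
  have fs: "finsum ?R f S = sum f S" if "finite S" "\<And>j. j \<in> S \<Longrightarrow> f j \<in> polys L" for f S
    using that
  proof (induction S rule: finite_induct)
    case (insert x S)
    then show ?case by (subst R.finsum_insert) (auto simp: ladder_ring_sel)
  qed (simp add: ladder_ring_sel)
  have K: "?K = {\<Sum>j\<in>{1..v}. f j | f. \<forall>j\<in>{1..v}. f j \<in> ?D j}"
    unfolding mixed_ladder_ideal_def using fs[of "{1..v}"] DL by (metis (no_types, lifting) finite_atLeastAtMost)
  have Dadd: "f + g \<in> ?D j" if "j \<in> {1..v}" "f \<in> ?D j" "g \<in> ?D j" for f g j
    using additive_subgroup.a_closed[OF ideal.axioms(1)[OF D(1)[OF that(1)]] that(2,3)] by (simp add: ladder_ring_sel)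
  have Dmult: "f * g \<in> ?D j" if "j \<in> {1..v}" "f \<in> polys L" "g \<in> ?D j" for f g j
    using ideal.I_l_closed[OF D(1)[OF that(1)] that(3), of f] that(2) by (simp add: ladder_ring_sel)
  have D0: "0 \<in> ?D j" if "j \<in> {1..v}" for j
    using additive_subgroup.zero_closed[OF ideal.axioms(1)[OF D(1)[OF that]]] by (simp add: ladder_ring_sel)
  have sub: "sub_ideal ?K"
    unfolding sub_ideal_def
  proof (intro conjI ballI)
    show "0 \<in> ?K" unfolding K using D0 by (intro CollectI exI[of _ "\<lambda>_. 0"]) auto
  next
    fix f g assume "f \<in> ?K" "g \<in> ?K"
    then obtain f' g' where "f = sum f' {1..v}" "\<forall>j\<in>{1..v}. f' j \<in> ?D j" "g = sum g' {1..v}" "\<forall>j\<in>{1..v}. g' j \<in> ?D j"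
      unfolding K by blast
    then show "f + g \<in> ?K" unfolding K
      using Dadd by (intro CollectI exI[of _ "\<lambda>j. f' j + g' j"]) (auto simp: sum.distrib)
  next
    fix f g :: "'k mat_poly" assume f: "f \<in> polys L" and "g \<in> ?K"
    then obtain g' where "g = sum g' {1..v}" "\<forall>j\<in>{1..v}. g' j \<in> ?D j" unfolding K by blast
    then show "f * g \<in> ?K" unfolding K
      using Dmult f by (intro CollectI exI[of _ "\<lambda>j. f * g' j"]) (auto simp: sum_distrib_left)
  qed
  have Kker: "f \<in> ker" if "f \<in> ?K" for f
  proof -
    interpret I: ideal_powers "polys L" "ker :: 'k mat_poly set" by (rule ideal_powers_ker)
    from that obtain f' where "f = sum f' {1..v}" "\<forall>j\<in>{1..v}. f' j \<in> ?D j" unfolding K by blast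
    moreover from this have "f' j \<in> ker" if "j \<in> {1..v}" for j using D(3)[OF that] that by blast
    then have "sum f' {1..v} \<in> I.pw (Suc 0)" by (intro I.pw_sum) (simp only: I.pw_1)
    ultimately show ?thesis by (simp only: I.pw_1)
  qed
  have Kminor: "minor (t h) r s \<in> ?K"
    if h: "h \<in> {1..v}" and r: "strict_mono_on {..<t h} r" and s: "\<And>a b. a < b \<Longrightarrow> b < t h \<Longrightarrow> s b < s a"
      and e: "\<And>a b. a < t h \<Longrightarrow> b < t h \<Longrightarrow> (r a, s b) \<in> region h" for h r s
  proof -
    let ?s = "\<lambda>b. s (t h - 1 - b)"
    have "strict_mono_on {..<t h} ?s" using s by (auto simp: strict_mono_on_def)
    then have "square_submatrix (t h) (region h) r ?s" using r e by (simp add: square_submatrix_def)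
    then have "minor (t h) r ?s \<in> (minors (t h) (region h) :: 'k mat_poly set)"
      unfolding minors_def minor_def indeterminate_def Var_def
      by (intro CollectI exI[of _ r] exI[of _ ?s] conjI refl)
    then have "minor (t h) r ?s \<in> ?D h" using D(2)[OF h] by blast
    moreover from Dmult[OF h _ this, of "- 1"] have "- minor (t h) r ?s \<in> ?D h" by (simp add: polys_uminus)
    ultimately have "minor (t h) r s \<in> ?D h" using minor_reverse[of "t h" r s, where 'k = 'k] by (metis minus_minus)
    then show ?thesis
      unfolding K using D0 h
      by (intro CollectI exI[of _ "\<lambda>j. if j = h then minor (t h) r s else 0"]) auto
  qed
  show ?thesis
  proof (intro equalityI subsetI)
    fix F :: "'k mat_poly" assume F: "F \<in> ker"
    show "F \<in> ?K"
      by (rule kernel_subset[OF sub Kminor]) (use Kker F in \<open>auto simp: ker_def\<close>)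
  qed (rule Kker)
qed

lemma symbolic_splitting_ker:
  fixes \<pi> :: "'k::field \<Rightarrow> 'k"
  assumes p: "Factorial_Ring.prime p" "p = CHAR('k)"
    and \<pi>: "\<forall>x y. \<pi> (x + y) = \<pi> x + \<pi> y" "\<forall>c x. \<pi> (c ^ p * x) = c * \<pi> x" "\<pi> 1 = 1"
  shows "symbolic_splitting (polys L) (ker :: 'k mat_poly set) H gen frob_poly
    (trace_operator.tr p \<pi> (\<Sum>x\<in>L. single x 1)) p"
proof -
  let ?u = "\<Sum>x\<in>L. single x (1::nat)"
  interpret I: ideal_powers "polys L" "ker :: 'k mat_poly set" by (rule ideal_powers_ker)
  have lu: "lookup ?u x \<le> 1" for x
  proof -
    have "lookup ?u x = (\<Sum>y\<in>L. if y = x then 1 else (0::nat))"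
      by (simp add: lookup_sum lookup_single when_def del: One_nat_def)
    then show ?thesis using finite_L by simp
  qed
  interpret T: trace_operator p \<pi> ?u
    by unfold_locales (use p \<pi> lu in auto)
  show ?thesis
  proof unfold_locales
    show "a \<in> ker \<or> b \<in> ker" if "a \<in> polys L" "b \<in> polys L" "a * b \<in> (ker :: 'k mat_poly set)" for a b
      using that by (auto simp: ker_def psi_mult)
    show "1 \<notin> (ker :: 'k mat_poly set)" by (simp add: ker_def psi_one)
    show "\<exists>s\<in>polys L - ker. \<exists>q. (\<forall>x\<in>H. q x \<in> polys L) \<and> s * F = (\<Sum>x\<in>H. q x * gen x)" if F: "F \<in> ker" for F :: "'k mat_poly"
    proof -
      obtain s where s: "s \<in> polys L" "psi s \<noteq> 0" "s * F \<in> gen_span" using ker_locally_generated[OF F] by blast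
      then obtain q where "s * F = (\<Sum>x\<in>H. q x * gen x)" "\<forall>x\<in>H. q x \<in> polys L" unfolding gen_span_def by blast
      moreover have "s \<in> polys L - ker" using s by (simp add: ker_def)
      ultimately show ?thesis by blast
    qed
    show "\<exists>s\<in>polys L - ker. s * frob_poly \<in> I.pw (card H)"
    proof -
      obtain s :: "'k mat_poly" where s: "s \<in> polys L" "psi s \<noteq> 0" "s * frob_poly \<in> I.pw (card H)" using frob_poly_local by blast
      then have "s \<in> polys L - ker" by (simp add: ker_def)
      with s show ?thesis by blast
    qed
    show "p = CHAR('k mat_poly)" by (simp add: CHAR_mpoly p(2))
    \<comment> \<open>The lightest term of g is the product of all variables, so that of g^(p-1) has
      the exponent (p - 1) u, which is \<open>shift 0\<close>.\<close>
    have lp: "lead ((frob_poly :: 'k mat_poly) ^ (p - 1)) (T.shift 0)"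
      using lead_power[OF lead_frob_poly[where 'k = 'k], of "p - 1"] by (simp only: T.shift_def sum.neutral_const add_0_left)
    show "T.tr (frob_poly ^ (p - 1)) = 1"
      by (rule T.tr_lead) (use lp in \<open>auto simp: lead_def\<close>)
  qed (use p finite_H gen_in_ker frob_poly_polys T.tr_polys T.tr_add T.tr_mult in auto)
qed

theorem blowup_algebras_F_pure:
  assumes p: "Factorial_Ring.prime p" "p = CHAR('k::field)"
    and R: "R = ladder_ring L" and I: "I = (mixed_ladder_ideal l L v d c t :: 'k mat_poly set)"
  shows "F_pure TYPE('m) p (symbolic_rees R I)" "F_pure TYPE('m) p (symbolic_gr R I)" "F_pure TYPE('m) p (R Quot I)"
proof -
  obtain \<pi> :: "'k \<Rightarrow> 'k" where \<pi>: "\<forall>x y. \<pi> (x + y) = \<pi> x + \<pi> y" "\<forall>c x. \<pi> (c ^ p * x) = c * \<pi> x" "\<pi> 1 = 1"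
    using ex_p_linear_retraction[OF p(2,1)] by blast
  interpret Y: symbolic_splitting "polys L" "ker :: 'k mat_poly set" H gen frob_poly
    "trace_operator.tr p \<pi> (\<Sum>x\<in>L. single x 1)" p
    by (rule symbolic_splitting_ker[OF p \<pi>])
  have IK: "I = ker" unfolding I by (rule mixed_ladder_ideal_eq_ker)
  have R': "R = ring_of_type_algebra\<lparr>carrier := polys L\<rparr>" unfolding R by (rule ladder_ring_eq)
  interpret S: split_filtration "polys L" Y.J "\<lambda>x. trace_operator.tr p \<pi> (\<Sum>x\<in>L. single x 1) (frob_poly ^ (p - 1) * x)" p
    "ring_of_type_algebra\<lparr>carrier := polys L\<rparr>"
    by (rule Y.split_filtration) simp
  have prime: "primeideal I R"
  proof (rule primeidealI)
    show "ideal I R" unfolding IK R by (rule ker_ideal)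
    show "cring R" unfolding R by (rule ladder_ring_cring)
    show "carrier R \<noteq> I" using Y.I1 by (auto simp: IK R')
    show "a \<in> I \<or> b \<in> I" if "a \<in> carrier R" "b \<in> carrier R" "a \<otimes>\<^bsub>R\<^esub> b \<in> I" for a b
      using Y.I_prime that by (auto simp: IK R')
  qed
  \<comment> \<open>A prime ideal is its own only minimal prime, so the intersection defining
    \<open>symbolic_power\<close> reduces to the single condition that defines
    \<open>Y.J\<close>.\<close>
  have min: "minimal_primes R I = {I}"
    unfolding minimal_primes_def using prime by auto
  have sp: "symbolic_power R I = Y.J"
  proof
    fix n
    show "symbolic_power R I n = Y.J n"
      unfolding symbolic_power_def min Y.J_def using Y.pw_eq_nat_pow[of n] by (auto simp: IK R')
  qed
  have "symbolic_rees R I = S.rees"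
    unfolding symbolic_rees_def S.rees_def sp unfolding R' ..
  with S.rees_F_pure show "F_pure TYPE('m) p (symbolic_rees R I)" by simp
  have "symbolic_gr R I = S.gr"
    unfolding symbolic_gr_def S.gr_def sp Let_def unfolding R' ..
  with S.gr_F_pure show "F_pure TYPE('m) p (symbolic_gr R I)" by simp
  from S.Quot_F_pure show "F_pure TYPE('m) p (R Quot I)" unfolding R' IK Y.J_1 .
qed

end

theorem corollary4p3:
  fixes p k l v :: nat
    and L :: "(nat \<times> nat) set"
    and d c t :: "nat \<Rightarrow> nat"
    and R :: "'k::field mat_poly ring"
    and I :: "'k mat_poly set"
  assumes "CHAR('k) = p" and "p > 0" and "F_finite_field TYPE('k)"
    and "ladder k l L"
    and "lower_outside_corners k L v d c"
    and "distinct_corners L v d c"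
    and "\<forall>j\<in>{1..v}. t j > 0"
    and "all_entries_involved l L v d c t"
    and "\<forall>x\<in>upper_outside_corners L. \<forall>y\<in>upper_outside_corners L.
           x \<noteq> y \<longrightarrow> fst x \<noteq> fst y \<and> snd x \<noteq> snd y"
    and "\<forall>i\<in>{1..v}. \<forall>j\<in>{1..v}. i \<noteq> j \<longrightarrow>
           \<not> (determinantal_ideal L (t i) (subladder l L d c i) :: 'k mat_poly set)
               \<subseteq> determinantal_ideal L (t j) (subladder l L d c j)"
    and "in_no_proper_submatrix k l L"
    and "R = ladder_ring L"
    and "I = mixed_ladder_ideal l L v d c t"
  shows "F_pure TYPE('m) p (symbolic_rees R I) \<and>
         F_pure TYPE('m) p (symbolic_gr R I) \<and>
         F_pure TYPE('m) p (R Quot I)"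
proof -
  interpret mixed_ladder k l v L d c t
    using assms(4,5,7) by unfold_locales (auto simp: lower_outside_corners_def)
  have "Factorial_Ring.prime p"
    using prime_CHAR_semidom[where 'a = 'k] assms(1,2) by simp
  then show ?thesis
    using blowup_algebras_F_pure[OF _ assms(1)[symmetric] assms(12,13)] by blast
qed

end
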